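(* There is an algorithm which, given $n$, computes the first $n$ coefficients of the cogrowth series of the Navas-Brin group $B$ with respect to its generators $a,t$ in time polynomial in $n$; that is, it computes the numbers $b_k$, $k\le n$, of words of length $k$ over the alphabet $\{a,t,a^{-1},t^{-1}\}$ that represent the identity of $B$.
   Context: The Navas-Brin group is the semidirect product $$B=\left(\cdots\wr\mathbb{Z}\wr\mathbb{Z}\wr\mathbb{Z}\wr\mathbb{Z}\wr\cdots\right)\rtimes\mathbb{Z},$$ where the copies of $\mathbb{Z}$ in the bi-infinite wreath product are generated, in order from left to right, by $\ldots,a_2,a_1,a_0,a_{-1},a_{-2},\ldots$, and the generator $t$ of the last factor $\mathbb{Z}$ satisfies $ta_it^{-1}=a_{i+1}$ for every $i\in\mathbb{Z}$. Here $G\wr\mathbb{Z}=\left(\bigoplus_{i\in\mathbb{Z}}G\right)\rtimes\mathbb{Z}$ is the restricted wreath product, with $G$ identified with the copy at index $0$. Explicitly, for integers $i\le j$ let $W_{j,j}=\langle a_j\rangle\cong\mathbb{Z}$ and $W_{i,j}=W_{i+1,j}\wr\langle a_i\rangle$ for $i<j$; with the natural inclusions $W_{i,j}\subset W_{i-1,j}$ (the copy at index $0$) and $W_{i,j}\subset W_{i,j+1}$ (generators mapping to generators of the same name), the bi-infinite wreath product is the union (direct limit) of the groups $W_{i,j}$, and $t$ acts on it by the automorphism $a_i\mapsto a_{i+1}$. The group $B$ is generated by $t$ and $a=a_0$. *)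

theory Defs
  imports
    "HOL-Algebra.Algebra"
    "HOL-Computational_Algebra.Polynomial"
    "HOL-Computational_Algebra.Formal_Power_Series"
    "HOL-Library.Discrete_Functions"
begin

section \<open>Semidirect products, wreath products and direct limits\<close>

text \<open>
  \<open>\<phi> h\<close> is the automorphism of \<open>G\<close> by which \<open>h\<close> acts.
\<close>

definition semidirect ::
  "('a, 'm) monoid_scheme \<Rightarrow> ('h, 'n) monoid_scheme \<Rightarrow> ('h \<Rightarrow> 'a \<Rightarrow> 'a) \<Rightarrow> ('a \<times> 'h) monoid" where
  "semidirect G H \<phi> =
     \<lparr>carrier = carrier G \<times> carrier H,
      monoid.mult = (\<lambda>(x, h) (y, k). (x \<otimes>\<^bsub>G\<^esub> \<phi> h y, h \<otimes>\<^bsub>H\<^esub> k)),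
      one = (\<one>\<^bsub>G\<^esub>, \<one>\<^bsub>H\<^esub>)\<rparr>"

text \<open>
  The restricted wreath product of \<open>G\<close> with the integers: the generator \<open>1\<close> of the
  acting group conjugates the copy of \<open>G\<close> at index \<open>m\<close> to the copy at index \<open>m + 1\<close>.
\<close>

definition wreath_int :: "('a, 'm) monoid_scheme \<Rightarrow> ((int \<Rightarrow> 'a) \<times> int) monoid" where
  "wreath_int G = semidirect (sum_group UNIV (\<lambda>_. G)) integer_group (\<lambda>k f m. f (m - k))"

text \<open>
  The direct limit of groups \<open>G i\<close> (\<open>i \<in> I\<close>) along homomorphisms \<open>h i j : G i \<rightarrow> G j\<close>
  for \<open>R i j\<close>. Its elements are equivalence classes of pairs \<open>(i, x)\<close> with \<open>x\<close> in \<open>G i\<close>;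
  classes are multiplied through representatives with a common index.
\<close>

definition limit_rel ::
  "'i set \<Rightarrow> ('i \<Rightarrow> 'i \<Rightarrow> bool) \<Rightarrow> ('i \<Rightarrow> ('a, 'm) monoid_scheme) \<Rightarrow> ('i \<Rightarrow> 'i \<Rightarrow> 'a \<Rightarrow> 'a)
     \<Rightarrow> (('i \<times> 'a) \<times> ('i \<times> 'a)) set" where
  "limit_rel I R G h =
     {((i, x), (j, y)) | i x j y.
        i \<in> I \<and> j \<in> I \<and> x \<in> carrier (G i) \<and> y \<in> carrier (G j) \<and>
        (\<exists>k\<in>I. R i k \<and> R j k \<and> h i k x = h j k y)}"

definition direct_limit ::
  "'i set \<Rightarrow> ('i \<Rightarrow> 'i \<Rightarrow> bool) \<Rightarrow> ('i \<Rightarrow> ('a, 'm) monoid_scheme) \<Rightarrow> ('i \<Rightarrow> 'i \<Rightarrow> 'a \<Rightarrow> 'a)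
     \<Rightarrow> ('i \<times> 'a) set monoid" where
  "direct_limit I R G h =
     \<lparr>carrier = (SIGMA i:I. carrier (G i)) // limit_rel I R G h,
      monoid.mult = (\<lambda>C D. limit_rel I R G h ``
         {(k, x \<otimes>\<^bsub>G k\<^esub> y) | k x y. (k, x) \<in> C \<and> (k, y) \<in> D}),
      one = limit_rel I R G h `` {(k, \<one>\<^bsub>G k\<^esub>) | k. k \<in> I}\<rparr>"


section \<open>The Navas-Brin group\<close>

text \<open>
  Iterating the wreath product changes the type of the elements. The following type holds
  the elements of all the iterated wreath products: \<open>Leaf k\<close> is the \<open>k\<close>-th power of the
  leftmost generator, and \<open>Node f k\<close> is the element \<open>(f, k)\<close> of a wreath product.
\<close>

datatype wtree = Leaf int | Node "int \<Rightarrow> wtree" int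

text \<open>
  \<open>W i j\<close> for \<open>i \<le> j\<close> is generated by \<open>a\<^sub>j, \<dots>, a\<^sub>i\<close>; the values for \<open>j < i\<close> are not used.
\<close>

function W :: "int \<Rightarrow> int \<Rightarrow> wtree monoid" where
  "W i j = (if i < j then image_group (case_prod Node) (wreath_int (W (i + 1) j))
            else image_group Leaf integer_group)"
  by pat_completeness auto
termination by (relation "measure (\<lambda>(i, j). nat (j - i))") auto

declare W.simps [simp del]

text \<open>
  The inclusion \<open>W i j \<rightarrow> W (i - 1) j\<close> as the copy at index \<open>0\<close>.
\<close>

definition incl_left :: "int \<Rightarrow> int \<Rightarrow> wtree \<Rightarrow> wtree" where
  "incl_left i j g = Node (\<lambda>m. if m = 0 then g else \<one>\<^bsub>W i j\<^esub>) 0"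

text \<open>
  The inclusion \<open>W i j \<rightarrow> W i (j + 1)\<close> taking each generator to the generator of the same
  name: the leftmost generator \<open>a\<^sub>j\<close> becomes the acting generator of the wreath product
  \<open>W j (j + 1)\<close>.
\<close>

primrec incl_right :: "wtree \<Rightarrow> wtree" where
  "incl_right (Leaf k) = Node (\<lambda>_. Leaf 0) k"
| "incl_right (Node f k) = Node (\<lambda>m. incl_right (f m)) k"

primrec incl_left_iter :: "nat \<Rightarrow> int \<Rightarrow> int \<Rightarrow> wtree \<Rightarrow> wtree" where
  "incl_left_iter 0 i j g = g"
| "incl_left_iter (Suc d) i j g = incl_left (i - int d) j (incl_left_iter d i j g)"

text \<open>
  The composite inclusion \<open>W i j \<rightarrow> W i' j'\<close> for \<open>i' \<le> i\<close> and \<open>j \<le> j'\<close>.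
\<close>

definition incl :: "int \<times> int \<Rightarrow> int \<times> int \<Rightarrow> wtree \<Rightarrow> wtree" where
  "incl = (\<lambda>(i, j) (i', j') g.
     incl_left_iter (nat (i - i')) i j' ((incl_right ^^ nat (j' - j)) g))"

text \<open>
  The generator \<open>a\<^sub>m\<close> as an element of \<open>W i j\<close>, for \<open>i \<le> m \<le> j\<close>.
\<close>

function wgen :: "int \<Rightarrow> int \<Rightarrow> int \<Rightarrow> wtree" where
  "wgen i j m =
     (if m \<le> i then (if i < j then Node (\<lambda>_. \<one>\<^bsub>W (i + 1) j\<^esub>) 1 else Leaf 1)
      else incl_left (i + 1) j (wgen (i + 1) j m))"
  by pat_completeness auto
termination by (relation "measure (\<lambda>(i, j, m). nat (m - i))") auto

declare wgen.simps [simp del]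

lemma one_W: "\<one>\<^bsub>W i j\<^esub> = (if i < j then Node (\<lambda>_. \<one>\<^bsub>W (i+1) j\<^esub>) 0 else Leaf 0)"
  by (subst W.simps) (auto simp: image_group_def wreath_int_def semidirect_def restrict_def)

lemma incl_right_one: "i \<le> j \<Longrightarrow> incl_right \<one>\<^bsub>W i j\<^esub> = \<one>\<^bsub>W i (j + 1)\<^esub>"
proof (induction i j rule: W.induct)
  case (1 i j)
  then show ?case by (subst (1 2) one_W) (auto simp: one_W[of "j+1"])
qed

lemma incl_left_wgen: "i \<le> m \<Longrightarrow> m \<le> j \<Longrightarrow> incl_left i j (wgen i j m) = wgen (i - 1) j m"
  by (subst (2) wgen.simps) auto

lemma incl_right_wgen: "i \<le> m \<Longrightarrow> m \<le> j \<Longrightarrow> incl_right (wgen i j m) = wgen i (j + 1) m"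
proof (induction i j m rule: wgen.induct)
  case (1 i j m)
  show ?case
    by (subst (1 2) wgen.simps) (use 1 in \<open>auto simp: incl_left_def incl_right_one one_W[of "_ + 1" "j+1"]\<close>)
qed

definition intervals :: "(int \<times> int) set" where
  "intervals = {(i, j). i \<le> j}"

definition interval_le :: "int \<times> int \<Rightarrow> int \<times> int \<Rightarrow> bool" where
  "interval_le = (\<lambda>(i, j) (i', j'). i' \<le> i \<and> j \<le> j')"

abbreviation W_inf_rel :: "(((int \<times> int) \<times> wtree) \<times> ((int \<times> int) \<times> wtree)) set" where
  "W_inf_rel \<equiv> limit_rel intervals interval_le (case_prod W) incl"

definition W_inf :: "((int \<times> int) \<times> wtree) set monoid" where
  "W_inf = direct_limit intervals interval_le (case_prod W) incl"

definition gen_inf :: "int \<Rightarrow> ((int \<times> int) \<times> wtree) set" where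
  "gen_inf m = W_inf_rel `` {((m, m), wgen m m m)}"

text \<open>
  The action of \<open>k\<close> takes \<open>a\<^sub>m\<close> to \<open>a\<^sub>m\<^sub>+\<^sub>k\<close>. The groups \<open>W i j\<close> and \<open>W (i + k) (j + k)\<close> have
  the same elements, and \<open>a\<^sub>m\<close> in the former is the same tree as \<open>a\<^sub>m\<^sub>+\<^sub>k\<close> in the latter.
\<close>

definition shift_inf :: "int \<Rightarrow> ((int \<times> int) \<times> wtree) set \<Rightarrow> ((int \<times> int) \<times> wtree) set" where
  "shift_inf k C = (\<lambda>((i, j), g). ((i + k, j + k), g)) ` C"

definition navas_brin :: "(((int \<times> int) \<times> wtree) set \<times> int) monoid" where
  "navas_brin = semidirect W_inf integer_group shift_inf"

definition nb_a :: "((int \<times> int) \<times> wtree) set \<times> int" where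
  "nb_a = (gen_inf 0, 0)"

definition nb_t :: "((int \<times> int) \<times> wtree) set \<times> int" where
  "nb_t = (\<one>\<^bsub>W_inf\<^esub>, 1)"


section \<open>Cogrowth\<close>

datatype letter = letter_a | letter_t | letter_a_inv | letter_t_inv

primrec letter_value :: "letter \<Rightarrow> ((int \<times> int) \<times> wtree) set \<times> int" where
  "letter_value letter_a = nb_a"
| "letter_value letter_t = nb_t"
| "letter_value letter_a_inv = inv\<^bsub>navas_brin\<^esub> nb_a"
| "letter_value letter_t_inv = inv\<^bsub>navas_brin\<^esub> nb_t"

primrec word_value :: "letter list \<Rightarrow> ((int \<times> int) \<times> wtree) set \<times> int" where
  "word_value [] = \<one>\<^bsub>navas_brin\<^esub>"
| "word_value (x # w) = letter_value x \<otimes>\<^bsub>navas_brin\<^esub> word_value w"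

definition cogrowth_series :: "nat fps" where
  "cogrowth_series = Abs_fps (\<lambda>k. card {w. length w = k \<and> word_value w = \<one>\<^bsub>navas_brin\<^esub>})"


section \<open>Random access machines with logarithmic cost\<close>

text \<open>
  The random access machine of Aho, Hopcroft and Ullman under the logarithmic cost criterion,
  with structured control flow in place of jumps. Registers hold natural numbers of any size,
  indexed by natural numbers; subtraction is truncated and division by \<open>0\<close> gives \<open>0\<close>. Under
  logarithmic cost, polynomial time on these machines is polynomial time on Turing machines.
  \<open>Load (Lit r)\<close> is direct and \<open>Load (Load (Lit r))\<close> indirect addressing.
\<close>

datatype ram_op = Add | Sub | Mul | Div

datatype ram_expr = Lit nat | Load ram_expr | Op ram_op ram_expr ram_expr

datatype ram_prog =
    Skip
  | Store ram_expr ram_expr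
  | Print ram_expr
  | Seq ram_prog ram_prog
  | Cond ram_expr ram_prog ram_prog
  | Loop ram_expr ram_prog

primrec op_val :: "ram_op \<Rightarrow> nat \<Rightarrow> nat \<Rightarrow> nat" where
  "op_val Add x y = x + y"
| "op_val Sub x y = x - y"
| "op_val Mul x y = x * y"
| "op_val Div x y = x div y"

primrec expr_val :: "(nat \<Rightarrow> nat) \<Rightarrow> ram_expr \<Rightarrow> nat" where
  "expr_val m (Lit k) = k"
| "expr_val m (Load e) = m (expr_val m e)"
| "expr_val m (Op b e e') = op_val b (expr_val m e) (expr_val m e')"

text \<open>The number of binary digits, with one digit for \<open>0\<close>.\<close>

definition num_size :: "nat \<Rightarrow> nat" where
  "num_size k = Suc (floor_log k)"

primrec expr_cost :: "(nat \<Rightarrow> nat) \<Rightarrow> ram_expr \<Rightarrow> nat" where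
  "expr_cost m (Lit k) = num_size k"
| "expr_cost m (Load e) = expr_cost m e + num_size (expr_val m (Load e))"
| "expr_cost m (Op b e e') =
     expr_cost m e + expr_cost m e' + num_size (expr_val m (Op b e e'))"

text \<open>
  \<open>ram_exec c s t s'\<close>: started in \<open>s\<close>, the program \<open>c\<close> halts in \<open>s'\<close> after time \<open>t\<close>.
  A state consists of the registers and the list of numbers printed so far. Branches and
  loops test for a nonzero value.
\<close>

inductive ram_exec ::
  "ram_prog \<Rightarrow> (nat \<Rightarrow> nat) \<times> nat list \<Rightarrow> nat \<Rightarrow> (nat \<Rightarrow> nat) \<times> nat list \<Rightarrow> bool" where
  Skip: "ram_exec Skip s 1 s"
| Store: "ram_exec (Store e e') (m, out) (expr_cost m e + expr_cost m e')
            (m(expr_val m e := expr_val m e'), out)"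
| Print: "ram_exec (Print e) (m, out) (expr_cost m e) (m, out @ [expr_val m e])"
| Seq: "ram_exec c s t s' \<Longrightarrow> ram_exec c' s' t' s'' \<Longrightarrow> ram_exec (Seq c c') s (t + t') s''"
| Cond_true: "expr_val (fst s) e \<noteq> 0 \<Longrightarrow> ram_exec c s t s' \<Longrightarrow>
    ram_exec (Cond e c c') s (expr_cost (fst s) e + t) s'"
| Cond_false: "expr_val (fst s) e = 0 \<Longrightarrow> ram_exec c' s t s' \<Longrightarrow>
    ram_exec (Cond e c c') s (expr_cost (fst s) e + t) s'"
| Loop_true: "expr_val (fst s) e \<noteq> 0 \<Longrightarrow> ram_exec c s t s' \<Longrightarrow> ram_exec (Loop e c) s' t' s'' \<Longrightarrow>
    ram_exec (Loop e c) s (expr_cost (fst s) e + t + t') s''"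
| Loop_false: "expr_val (fst s) e = 0 \<Longrightarrow> ram_exec (Loop e c) s (expr_cost (fst s) e) s"

inductive_cases ram_exec_elims:
  "ram_exec Skip s u s''" "ram_exec (Store e e') s u s''" "ram_exec (Print e) s u s''"
  "ram_exec (Seq c c') s u s''" "ram_exec (Cond e c c') s u s''" "ram_exec (Loop e c) s u s''"

lemma ram_exec_deterministic:
  "ram_exec c s t s' \<Longrightarrow> ram_exec c s u s'' \<Longrightarrow> u = t \<and> s'' = s'"
proof (induction arbitrary: u s'' rule: ram_exec.induct)
  case (Skip s)
  then show ?case by (elim ram_exec_elims) simp
next
  case (Store e e' m out)
  then show ?case by (elim ram_exec_elims) simp
next
  case (Print e m out)
  then show ?case by (elim ram_exec_elims) simp
next
  case (Seq c s t s' c' t' s1 u s'')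
  from Seq.prems show ?case
    by (elim ram_exec_elims) (metis Seq.IH)
next
  case (Cond_true s e c t s' c' u s'')
  from Cond_true.prems show ?case
    by (elim ram_exec_elims) (metis Cond_true.IH Cond_true.hyps(1) less_irrefl)+
next
  case (Cond_false s e c' t s' c u s'')
  from Cond_false.prems show ?case
    by (elim ram_exec_elims) (metis Cond_false.IH Cond_false.hyps(1) less_irrefl)+
next
  case (Loop_true s e c t s' t' s1 u s'')
  from Loop_true.prems show ?case
    by (rule ram_exec_elims(6)) (metis Loop_true.IH Loop_true.hyps(1) less_irrefl)+
next
  case (Loop_false s e c u s'')
  from Loop_false.prems show ?case
    by (rule ram_exec_elims(6)) (use Loop_false.hyps in auto)
qed

text \<open>The input is placed in register \<open>0\<close>; all other registers are \<open>0\<close>.\<close>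

definition ram_input :: "nat \<Rightarrow> (nat \<Rightarrow> nat) \<times> nat list" where
  "ram_input n = ((\<lambda>_. 0)(0 := n), [])"

end

(*
  In an iterated wreath product triviality is decided level by level: a word is trivial iff
  its exponent in the lowest generator a_i is 0 and, for every m, the concatenation of the
  subwords in higher generators read while that exponent equals m is trivial.  Both the exponent
  of t along a word and the exponent of a_i along the syllables of a nonnegative word are closed
  paths on the integers, and triviality is invariant under cyclic rotation.  Rotating a path to
  one of its minima therefore expresses the number of all closed paths through the number of
  nonnegative ones, weighted by (length) / (number of minima).

  Let N(l,s) count the trivial nonnegative words of length l with s syllables on the lowest level,
  and Q(l,s,z) those whose exponent path is nonnegative as well and has z returns.  Then
    b_l = sum_s l N(l,s) / s,    N(l,s) = sum_z s Q(l,s,z) / z,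
  and cutting a nonnegative path at its returns gives two lists, of e subwords read at exponent 0
  and of z - e excursions above 0, interleaved arbitrarily, whose concatenations must be trivial.
  Hence Q(l,s,z) is a sum over e and the lengths of
    (z choose e) (sum_s' C(s'+e-1, s') N(l',s')) (sum_z' C(z'+z-e-1, z') Q(l'',s'',z'))
  with l', l'' < l, a recursion of polynomial size between numbers of linearly many digits.
*)

theory Submission
  imports Defs
begin

section \<open>The group\<close>

text \<open>Rotation to a minimum is useful because a closed word whose exponent of \<open>t\<close>
  never becomes negative has its value in a single group \<open>W 0 d\<close>. There triviality is
  decided one wreath product at a time, and injectivity of the inclusions makes it agree with
  triviality in the limit. The weights come from double counting pairs of a closed path and a
  position of minimal height: every rotation permutes the trivial words with z minima, so z times
  their number is the length times the number of nonnegative ones among them. Hence each division by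
  z is exact.

  The recursion ends because each of the z blocks between returns costs two letters, either t and
  its inverse or a and its inverse, so the lengths drop by at least 2 z. The counts are at most 4^l,
  being numbers of words, and binomial coefficients are quotients of tabulated factorials; registers
  of O(n^2) bits suffice. The division by s in the last sum is known to be exact only after
  summation over z; the weights n! / s defer it to a single division by n!.\<close>

lemma semidirect_simps:
  "carrier (semidirect G H \<phi>) = carrier G \<times> carrier H"
  "(x, h) \<otimes>\<^bsub>semidirect G H \<phi>\<^esub> (y, k) = (x \<otimes>\<^bsub>G\<^esub> \<phi> h y, h \<otimes>\<^bsub>H\<^esub> k)"
  "\<one>\<^bsub>semidirect G H \<phi>\<^esub> = (\<one>\<^bsub>G\<^esub>, \<one>\<^bsub>H\<^esub>)"
  by (auto simp: semidirect_def)

lemma group_semidirect: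
  assumes "group G" "group H"
    and hom: "\<And>h. h \<in> carrier H \<Longrightarrow> \<phi> h \<in> hom G G"
    and act: "\<And>h k x. h \<in> carrier H \<Longrightarrow> k \<in> carrier H \<Longrightarrow> x \<in> carrier G \<Longrightarrow> \<phi> (h \<otimes>\<^bsub>H\<^esub> k) x = \<phi> h (\<phi> k x)"
    and one: "\<And>x. x \<in> carrier G \<Longrightarrow> \<phi> \<one>\<^bsub>H\<^esub> x = x"
  shows "group (semidirect G H \<phi>)"
proof -
  interpret G: group G by fact
  interpret H: group H by fact
  have cl: "\<phi> h x \<in> carrier G" if "h \<in> carrier H" "x \<in> carrier G" for h x
    using hom[OF that(1)] that(2) by (auto simp: hom_def)
  have mul: "\<phi> h (x \<otimes>\<^bsub>G\<^esub> y) = \<phi> h x \<otimes>\<^bsub>G\<^esub> \<phi> h y" if "h \<in> carrier H" "x \<in> carrier G" "y \<in> carrier G" for h x y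
    using hom[OF that(1)] that(2,3) by (auto simp: hom_def)
  show ?thesis
  proof (rule groupI, goal_cases)
    case (1 x y) then show ?case by (cases x; cases y) (auto simp: semidirect_simps cl)
  next
    case 2 show ?case by (auto simp: semidirect_simps)
  next
    case (3 x y z) then show ?case
      by (cases x; cases y; cases z) (auto simp: semidirect_simps cl mul act G.m_assoc H.m_assoc)
  next
    case (4 x) then show ?case by (cases x) (auto simp: semidirect_simps one)
  next
    case (5 x)
    obtain g h where x: "x = (g, h)" "g \<in> carrier G" "h \<in> carrier H" using 5 by (cases x) (auto simp: semidirect_simps)
    have "\<phi> (inv\<^bsub>H\<^esub> h) (inv\<^bsub>G\<^esub> g) \<otimes>\<^bsub>G\<^esub> \<phi> (inv\<^bsub>H\<^esub> h) g = \<phi> (inv\<^bsub>H\<^esub> h) \<one>\<^bsub>G\<^esub>"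
      using x by (simp flip: mul)
    also have "\<dots> = \<one>\<^bsub>G\<^esub>"
      using hom[of "inv\<^bsub>H\<^esub> h"] x hom_one[OF _ assms(1) assms(1)] by auto
    finally show ?case using x
      by (intro bexI[of _ "(\<phi> (inv\<^bsub>H\<^esub> h) (inv\<^bsub>G\<^esub> g), inv\<^bsub>H\<^esub> h)"]) (auto simp: semidirect_simps cl)
  qed
qed

lemma carrier_wreath_int:
  assumes "group G"
  shows "carrier (wreath_int G) = {f. (\<forall>m. f m \<in> carrier G) \<and> finite {m. f m \<noteq> \<one>\<^bsub>G\<^esub>}} \<times> UNIV"
  using assms by (auto simp: wreath_int_def semidirect_simps carrier_sum_group)

lemma mult_wreath_int:
  "(f, k) \<otimes>\<^bsub>wreath_int G\<^esub> (g, l) = (\<lambda>m. f m \<otimes>\<^bsub>G\<^esub> g (m - k), k + l)"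
  by (simp add: wreath_int_def semidirect_simps restrict_def)

lemma finite_support_shift:
  fixes k :: int
  assumes "finite {m. f m \<noteq> c}"
  shows "finite {m. f (m - k) \<noteq> c}"
proof -
  have "{m. f (m - k) \<noteq> c} = (\<lambda>m. m + k) ` {m. f m \<noteq> c}"
    by (auto simp: image_iff) (metis diff_add_cancel)
  then show ?thesis using assms by simp
qed

lemma group_wreath_int:
  assumes "group G"
  shows "group (wreath_int G)"
  unfolding wreath_int_def
proof (rule group_semidirect)
  interpret G: group G by fact
  show "group (sum_group UNIV (\<lambda>_. G))" using assms by simp
  show "group integer_group" by simp
  fix h :: int
  show "(\<lambda>f m. f (m - h)) \<in> hom (sum_group UNIV (\<lambda>_. G)) (sum_group UNIV (\<lambda>_. G))"
    using assms by (auto simp: hom_def carrier_sum_group finite_support_shift)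
qed (auto simp: algebra_simps)

lemma inj_on_Node: "inj_on (case_prod Node) A" by (auto simp: inj_on_def)

lemma inj_on_Leaf: "inj_on Leaf A" by (auto simp: inj_on_def)

lemma group_W: "group (W i j)"
proof (induction i j rule: W.induct)
  case (1 i j)
  show ?case
    by (subst W.simps)
      (auto intro!: group.inj_imp_image_group_is_group inj_on_Node inj_on_Leaf group_wreath_int 1)
qed

lemma monoid_W: "monoid (W i j)" using group_W by (rule group.is_monoid)

lemma carrier_W:
  "i < j \<Longrightarrow> x \<in> carrier (W i j) \<longleftrightarrow>
     (\<exists>f k. x = Node f k \<and> (\<forall>m. f m \<in> carrier (W (i+1) j)) \<and> finite {m. f m \<noteq> \<one>\<^bsub>W (i+1) j\<^esub>})"
  by (subst W.simps) (auto simp: image_group_carrier carrier_wreath_int[OF group_W])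

lemma carrier_W_Node:
  "i < j \<Longrightarrow> Node f k \<in> carrier (W i j) \<longleftrightarrow>
     (\<forall>m. f m \<in> carrier (W (i+1) j)) \<and> finite {m. f m \<noteq> \<one>\<^bsub>W (i+1) j\<^esub>}"
  by (auto simp: carrier_W)

lemma carrier_W_Leaf: "\<not> i < j \<Longrightarrow> carrier (W i j) = range Leaf"
  by (subst W.simps) (auto simp: image_group_carrier)

lemma mult_W_Leaf: "\<not> i < j \<Longrightarrow> Leaf k \<otimes>\<^bsub>W i j\<^esub> Leaf l = Leaf (k + l)"
  by (subst W.simps) (simp add: image_group_def inj_on_Leaf)

lemma mult_W_Node:
  assumes "i < j" "Node f k \<in> carrier (W i j)" "Node g l \<in> carrier (W i j)"
  shows "Node f k \<otimes>\<^bsub>W i j\<^esub> Node g l = Node (\<lambda>m. f m \<otimes>\<^bsub>W (i+1) j\<^esub> g (m - k)) (k + l)"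
proof -
  let ?G = "wreath_int (W (i+1) j)"
  have "case_prod Node \<in> hom ?G (image_group (case_prod Node) ?G)"
    using inj_imp_image_group_iso[OF inj_on_Node] by (auto simp: iso_def)
  moreover have W: "W i j = image_group (case_prod Node) ?G" using assms(1) by (subst W.simps) simp
  moreover have "(f, k) \<in> carrier ?G" "(g, l) \<in> carrier ?G"
    using assms by (auto simp: carrier_W_Node carrier_wreath_int[OF group_W])
  ultimately show ?thesis
    using hom_mult[of "case_prod Node" ?G "image_group (case_prod Node) ?G" "(f, k)" "(g, l)"]
    by (simp add: mult_wreath_int)
qed

text \<open>Only \<open>j - i\<close> enters the recursion of \<open>W\<close>. This is an equality
  and not just an isomorphism, so the shift can leave the trees alone and move the indices.\<close>

lemma W_shift: "W (i + k) (j + k) = W i j"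
proof (induction i j rule: W.induct)
  case (1 i j)
  then show ?case by (subst (1 2) W.simps) (auto simp: algebra_simps)
qed

subsection \<open>Inclusions\<close>

lemma incl_left_hom:
  assumes "i \<le> j"
  shows "incl_left i j \<in> hom (W i j) (W (i - 1) j)"
proof -
  interpret G: group "W i j" by (rule group_W)
  have c: "incl_left i j x \<in> carrier (W (i - 1) j)" if "x \<in> carrier (W i j)" for x
    using assms that by (auto simp: incl_left_def carrier_W_Node)
  show ?thesis
  proof (rule homI[OF c])
    fix x y assume xy: "x \<in> carrier (W i j)" "y \<in> carrier (W i j)"
    show "incl_left i j (x \<otimes>\<^bsub>W i j\<^esub> y) = incl_left i j x \<otimes>\<^bsub>W (i - 1) j\<^esub> incl_left i j y"
      using c[OF xy(1)] c[OF xy(2)] assms unfolding incl_left_def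
      by (subst mult_W_Node) (auto simp: fun_eq_iff)
  qed
qed

lemma inj_incl_left: "inj (incl_left i j)"
  by (rule injI) (auto simp: incl_left_def dest: fun_cong[of _ _ 0])

text \<open>Separates the two kinds of images: that of a \<open>Leaf\<close> is a node with leaves
  as values, that of a \<open>Node\<close> has no leaf among its values.\<close>

lemma incl_right_neq_Leaf: "incl_right x \<noteq> Leaf k"
  by (cases x) auto

lemma incl_right_inj: "incl_right x = incl_right y \<longleftrightarrow> x = y"
proof (induction x arbitrary: y)
  case (Leaf k)
  show ?case by (cases y) (auto simp: fun_eq_iff incl_right_neq_Leaf[symmetric])
next
  case (Node f k)
  show ?case using Node by (cases y) (auto simp: fun_eq_iff incl_right_neq_Leaf)
qed

lemma incl_right_hom:
  assumes "i \<le> j"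
  shows "incl_right \<in> hom (W i j) (W i (j + 1))"
  using assms
proof (induction i j rule: W.induct)
  case (1 i j)
  show ?case
  proof (cases "i < j")
    case True
    then have IH: "incl_right \<in> hom (W (i+1) j) (W (i+1) (j + 1))" using 1 by simp
    \<comment> \<open>Injectivity keeps the support unchanged, which transfers its finiteness to the
      image.\<close>
    have one: "incl_right x = \<one>\<^bsub>W (i+1) (j+1)\<^esub> \<longleftrightarrow> x = \<one>\<^bsub>W (i+1) j\<^esub>" for x
      using incl_right_inj[of x "\<one>\<^bsub>W (i+1) j\<^esub>"] incl_right_one[of "i+1" j] True by simp
    have c: "incl_right x \<in> carrier (W i (j + 1))" if "x \<in> carrier (W i j)" for x
    proof -
      obtain f k where x: "x = Node f k" using \<open>x \<in> carrier (W i j)\<close> True by (auto simp: carrier_W)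
      show ?thesis using that True hom_in_carrier[OF IH] by (simp add: x carrier_W_Node one)
    qed
    show ?thesis
    proof (rule homI[OF c])
      fix x y assume xy: "x \<in> carrier (W i j)" "y \<in> carrier (W i j)"
      obtain f k g l where *: "x = Node f k" "y = Node g l" using xy True by (auto simp: carrier_W)
      show "incl_right (x \<otimes>\<^bsub>W i j\<^esub> y) = incl_right x \<otimes>\<^bsub>W i (j + 1)\<^esub> incl_right y"
        using c[OF xy(1)] c[OF xy(2)] xy True unfolding *
        by (simp add: mult_W_Node) (auto simp: carrier_W_Node hom_mult[OF IH])
    qed
  next
    case False
    with 1 have [simp]: "i = j" by simp
    have one: "\<one>\<^bsub>W (j+1) (j+1)\<^esub> = Leaf 0" by (subst one_W) simp
    have "Leaf 0 \<otimes>\<^bsub>W (j+1) (j+1)\<^esub> Leaf 0 = Leaf 0" by (simp add: mult_W_Leaf)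
    then show ?thesis
      by (auto intro!: homI simp: carrier_W_Leaf carrier_W_Node one mult_W_Leaf mult_W_Node)
  qed
qed

lemma incl_right_incl_left:
  "i \<le> j \<Longrightarrow> incl_right (incl_left i j g) = incl_left i (j + 1) (incl_right g)"
  by (auto simp: incl_left_def incl_right_one)

lemma incl_right_iter_hom: "i \<le> j \<Longrightarrow> (incl_right ^^ d) \<in> hom (W i j) (W i (j + int d))"
proof (induction d)
  case 0
  then show ?case by (auto simp: hom_def)
next
  case (Suc d)
  then have "incl_right \<circ> (incl_right ^^ d) \<in> hom (W i j) (W i (j + int d + 1))"
    by (intro hom_compose[OF Suc.IH incl_right_hom]) auto
  then show ?case by (simp add: algebra_simps comp_def)
qed

lemma incl_left_iter_hom: "i \<le> j \<Longrightarrow> incl_left_iter d i j \<in> hom (W i j) (W (i - int d) j)"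
proof (induction d)
  case 0
  then show ?case by (auto simp: hom_def)
next
  case (Suc d)
  then have "incl_left (i - int d) j \<circ> incl_left_iter d i j \<in> hom (W i j) (W (i - int d - 1) j)"
    by (intro hom_compose[OF Suc.IH incl_left_hom]) auto
  then show ?case by (simp add: algebra_simps comp_def)
qed

lemma incl_left_iter_add:
  "incl_left_iter d (i - int e) j (incl_left_iter e i j g) = incl_left_iter (e + d) i j g"
  by (induction d) (auto simp: algebra_simps)

lemma incl_right_iter_incl_left_iter:
  assumes "i \<le> j"
  shows "(incl_right ^^ e) (incl_left_iter d i j g) = incl_left_iter d i (j + int e) ((incl_right ^^ e) g)"
proof (induction e)
  case (Suc e)
  have "incl_right (incl_left_iter d i (j + int e) x) = incl_left_iter d i (j + int e + 1) (incl_right x)" for x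
    using assms by (induction d) (auto simp: incl_right_incl_left)
  with Suc show ?case by (simp add: algebra_simps)
qed auto

lemma incl_hom:
  assumes "p \<in> intervals" "interval_le p q"
  shows "incl p q \<in> hom (case_prod W p) (case_prod W q)"
proof -
  obtain i j i' j' where pq: "p = (i, j)" "q = (i', j')" by (metis surj_pair)
  have ij: "i \<le> j" "i' \<le> i" "j \<le> j'" using assms by (auto simp: pq intervals_def interval_le_def)
  have "incl_left_iter (nat (i - i')) i j' \<circ> (incl_right ^^ nat (j' - j)) \<in> hom (W i j) (W i' j')"
    using hom_compose[OF incl_right_iter_hom incl_left_iter_hom, of i j "nat (j' - j)" "nat (i - i')"] ij by simp
  then show ?thesis by (simp add: pq incl_def comp_def)
qed

lemma incl_incl:
  assumes "p \<in> intervals" "interval_le p q" "interval_le q r"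
  shows "incl q r (incl p q x) = incl p r x"
proof -
  obtain i j i' j' i'' j'' where pq: "p = (i, j)" "q = (i', j')" "r = (i'', j'')" by (metis surj_pair)
  have ij: "i \<le> j" "i' \<le> i" "j \<le> j'" "i'' \<le> i'" "j' \<le> j''" using assms by (auto simp: pq intervals_def interval_le_def)
  have 1: "(incl_right ^^ nat (j'' - j')) ((incl_right ^^ nat (j' - j)) x) = (incl_right ^^ nat (j'' - j)) x"
    using ij by (simp flip: funpow_add[THEN fun_cong, unfolded comp_def] nat_add_distrib)
  show ?thesis
    using ij incl_left_iter_add[of "nat (i' - i'')" i "nat (i - i')"]
    by (simp add: pq incl_def incl_right_iter_incl_left_iter 1 flip: nat_add_distrib)
qed

text \<open>With injective structure maps an element of the limit is trivial only if its
  representative already is, so the word problem can be settled in one group.\<close>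

lemma inj_incl: "inj (incl p q)"
proof -
  have 1: "inj (incl_left_iter d i j)" for d i j
    by (induction d) (auto intro!: injI dest: injD[OF inj_incl_left] injD)
  have "inj incl_right" by (auto simp: incl_right_inj intro: injI)
  then have 2: "inj (incl_right ^^ d)" for d by (rule inj_fn)
  show ?thesis by (cases p; cases q) (auto simp: incl_def intro!: inj_compose[OF 1 2, unfolded comp_def])
qed

subsection \<open>Direct limits of directed systems\<close>

locale directed_system =
  fixes I :: "'i set" and R :: "'i \<Rightarrow> 'i \<Rightarrow> bool"
    and G :: "'i \<Rightarrow> ('a, 'm) monoid_scheme" and h :: "'i \<Rightarrow> 'i \<Rightarrow> 'a \<Rightarrow> 'a"
  assumes groups: "\<And>i. i \<in> I \<Longrightarrow> group (G i)"
    and nonempty: "I \<noteq> {}"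
    and trans: "\<And>i j k. R i j \<Longrightarrow> R j k \<Longrightarrow> R i k"
    and directed: "\<And>i j. i \<in> I \<Longrightarrow> j \<in> I \<Longrightarrow> \<exists>k\<in>I. R i k \<and> R j k"
    and hom: "\<And>i j. i \<in> I \<Longrightarrow> j \<in> I \<Longrightarrow> R i j \<Longrightarrow> h i j \<in> hom (G i) (G j)"
    and comp: "\<And>i j k x. i \<in> I \<Longrightarrow> j \<in> I \<Longrightarrow> k \<in> I \<Longrightarrow> R i j \<Longrightarrow> R j k \<Longrightarrow> x \<in> carrier (G i) \<Longrightarrow>
                 h j k (h i j x) = h i k x"
begin

abbreviation "rel \<equiv> limit_rel I R G h"
abbreviation "dlim \<equiv> direct_limit I R G h"
definition "cl i x = rel `` {(i, x)}"

lemma rel_iff: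
  "((i, x), (j, y)) \<in> rel \<longleftrightarrow> i \<in> I \<and> j \<in> I \<and> x \<in> carrier (G i) \<and> y \<in> carrier (G j) \<and>
        (\<exists>k\<in>I. R i k \<and> R j k \<and> h i k x = h j k y)"
  by (auto simp: limit_rel_def)

lemma upper2:
  assumes "i \<in> I" "j \<in> I" "k \<in> I" "l \<in> I"
  obtains m where "m \<in> I" "R i m" "R j m" "R k m" "R l m"
proof -
  obtain a b where "a \<in> I" "R i a" "R j a" "b \<in> I" "R k b" "R l b"
    using directed assms by meson
  moreover obtain m where "m \<in> I" "R a m" "R b m" using directed calculation by meson
  ultimately show ?thesis using that[of m] trans[of i a m] trans[of j a m] trans[of k b m] trans[of l b m] by simp
qed

lemma rel_up:
  assumes "i \<in> I" "j \<in> I" "k \<in> I" "m \<in> I" "x \<in> carrier (G i)" "y \<in> carrier (G j)"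
    "R i k" "R j k" "h i k x = h j k y" "R k m"
  shows "h i m x = h j m y"
  using comp[of i k m x] comp[of j k m y] assms by simp

lemma equiv_rel: "equiv (SIGMA i:I. carrier (G i)) rel"
proof (rule equivI)
  show "rel \<subseteq> (SIGMA i:I. carrier (G i)) \<times> (SIGMA i:I. carrier (G i))"
    by (auto simp: limit_rel_def)
  show "refl_on (SIGMA i:I. carrier (G i)) rel"
    using directed by (fastforce simp: refl_on_def rel_iff)
  show "sym rel" by (rule symI) (fastforce simp: limit_rel_def)
  show "trans rel"
  proof (rule transI, clarify)
    fix i x j y k z
    assume 1: "((i, x), (j, y)) \<in> rel" and 2: "((j, y), (k, z)) \<in> rel"
    obtain a where a: "a \<in> I" "R i a" "R j a" "h i a x = h j a y" using 1 by (auto simp: rel_iff)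
    obtain b where b: "b \<in> I" "R j b" "R k b" "h j b y = h k b z" using 2 by (auto simp: rel_iff)
    obtain m where m: "m \<in> I" "R a m" "R b m" using directed a b by meson
    have "h i m x = h j m y" by (rule rel_up[where k = a]) (use 1 a m in \<open>auto simp: rel_iff\<close>)
    also have "\<dots> = h k m z" by (rule rel_up[where k = b]) (use 2 b m in \<open>auto simp: rel_iff\<close>)
    finally have "h i m x = h k m z" .
    moreover have "R i m" "R k m" using trans a b m by blast+
    ultimately show "((i, x), (k, z)) \<in> rel" using 1 2 m(1) unfolding rel_iff by blast
  qed
qed

lemma carrier_lim: "carrier dlim = {cl i x | i x. i \<in> I \<and> x \<in> carrier (G i)}"
  by (auto simp: direct_limit_def cl_def quotient_def)

lemma cl_in_carrier: "i \<in> I \<Longrightarrow> x \<in> carrier (G i) \<Longrightarrow> cl i x \<in> carrier dlim"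
  by (auto simp: carrier_lim)

lemma cl_eq_iff:
  "i \<in> I \<Longrightarrow> j \<in> I \<Longrightarrow> x \<in> carrier (G i) \<Longrightarrow> y \<in> carrier (G j) \<Longrightarrow>
    cl i x = cl j y \<longleftrightarrow> (\<exists>k\<in>I. R i k \<and> R j k \<and> h i k x = h j k y)"
  using eq_equiv_class_iff[OF equiv_rel, of "(i, x)" "(j, y)"] by (simp add: cl_def rel_iff)

lemma cl_up:
  assumes "i \<in> I" "j \<in> I" "R i j" "x \<in> carrier (G i)"
  shows "cl j (h i j x) = cl i x"
proof -
  have c: "h i j x \<in> carrier (G j)" using hom[of i j] assms by (auto simp: hom_def)
  obtain k where k: "k \<in> I" "R j k" using directed assms by meson
  have "h j k (h i j x) = h i k x" using comp[of i j k x] assms k by simp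
  then show ?thesis using assms c k trans by (subst cl_eq_iff) auto
qed

text \<open>Product and unit of \<open>direct_limit\<close> are images of sets of representatives;
  this reduces their evaluation to showing that all these representatives have the same
  class.\<close>

lemma Union_cl:
  assumes "P \<noteq> {}" "\<And>p. p \<in> P \<Longrightarrow> rel `` {p} = C"
  shows "rel `` P = C"
  using assms by blast

lemma mult_lim:
  assumes "k \<in> I" "x \<in> carrier (G k)" "y \<in> carrier (G k)"
  shows "cl k x \<otimes>\<^bsub>dlim\<^esub> cl k y = cl k (x \<otimes>\<^bsub>G k\<^esub> y)"
proof -
  let ?P = "{(l, u \<otimes>\<^bsub>G l\<^esub> v) | l u v. (l, u) \<in> cl k x \<and> (l, v) \<in> cl k y}"
  have self: "(k, x) \<in> cl k x" "(k, y) \<in> cl k y"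
    using equiv_class_self[OF equiv_rel] assms by (auto simp: cl_def)
  have "rel `` ?P = cl k (x \<otimes>\<^bsub>G k\<^esub> y)"
  proof (rule Union_cl)
    show "?P \<noteq> {}" using self by blast
    fix p assume "p \<in> ?P"
    then obtain l u v where p: "p = (l, u \<otimes>\<^bsub>G l\<^esub> v)" "((k, x), (l, u)) \<in> rel" "((k, y), (l, v)) \<in> rel"
      by (auto simp: cl_def)
    obtain a where a: "a \<in> I" "R k a" "R l a" "h k a x = h l a u" using p by (auto simp: rel_iff)
    obtain b where b: "b \<in> I" "R k b" "R l b" "h k b y = h l b v" using p by (auto simp: rel_iff)
    obtain m where m: "m \<in> I" "R a m" "R b m" using directed a b by meson
    have c: "l \<in> I" "u \<in> carrier (G l)" "v \<in> carrier (G l)" using p by (auto simp: rel_iff)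
    have km: "R k m" "R l m" using a m trans by blast+
    have u: "h k m x = h l m u" by (rule rel_up[where k = a]) (use c assms a m in auto)
    have v: "h k m y = h l m v" by (rule rel_up[where k = b]) (use c assms b m in auto)
    have "h k m (x \<otimes>\<^bsub>G k\<^esub> y) = h l m (u \<otimes>\<^bsub>G l\<^esub> v)"
      using hom_mult[OF hom[of k m]] hom_mult[OF hom[of l m]] c m km assms u v by simp
    moreover have "x \<otimes>\<^bsub>G k\<^esub> y \<in> carrier (G k)" "u \<otimes>\<^bsub>G l\<^esub> v \<in> carrier (G l)"
      using groups assms c by (auto intro!: monoid.m_closed group.is_monoid)
    ultimately have "cl l (u \<otimes>\<^bsub>G l\<^esub> v) = cl k (x \<otimes>\<^bsub>G k\<^esub> y)"
      using c assms m km by (subst cl_eq_iff) (auto intro!: bexI[of _ m])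
    then show "rel `` {p} = cl k (x \<otimes>\<^bsub>G k\<^esub> y)" by (simp add: p cl_def)
  qed
  then show ?thesis by (simp add: direct_limit_def)
qed

lemma one_lim:
  assumes "k \<in> I"
  shows "\<one>\<^bsub>dlim\<^esub> = cl k \<one>\<^bsub>G k\<^esub>"
proof -
  have "rel `` {(k, \<one>\<^bsub>G k\<^esub>) | k. k \<in> I} = cl k \<one>\<^bsub>G k\<^esub>"
  proof (rule Union_cl)
    show "{(k, \<one>\<^bsub>G k\<^esub>) | k. k \<in> I} \<noteq> {}" using assms by blast
    fix p assume "p \<in> {(k, \<one>\<^bsub>G k\<^esub>) | k. k \<in> I}"
    then obtain l where l: "l \<in> I" "p = (l, \<one>\<^bsub>G l\<^esub>)" by blast
    obtain m where m: "m \<in> I" "R k m" "R l m" using directed l assms by meson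
    have "h k m \<one>\<^bsub>G k\<^esub> = \<one>\<^bsub>G m\<^esub>" "h l m \<one>\<^bsub>G l\<^esub> = \<one>\<^bsub>G m\<^esub>"
      using m assms l groups hom by (auto intro!: hom_one)
    then have "cl l \<one>\<^bsub>G l\<^esub> = cl k \<one>\<^bsub>G k\<^esub>"
      using m assms l groups[THEN group.is_monoid] by (subst cl_eq_iff) (auto intro!: bexI[of _ m] monoid.one_closed)
    then show "rel `` {p} = cl k \<one>\<^bsub>G k\<^esub>" by (simp add: l cl_def)
  qed
  then show ?thesis by (simp add: direct_limit_def)
qed

text \<open>The group axioms involve at most three elements, so moving these to one index reduces
  each axiom to a single group \<open>G k\<close>.\<close>

lemma common:
  assumes "C \<in> carrier dlim" "D \<in> carrier dlim" "E \<in> carrier dlim"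
  obtains k x y z where "k \<in> I" "x \<in> carrier (G k)" "y \<in> carrier (G k)" "z \<in> carrier (G k)"
    "C = cl k x" "D = cl k y" "E = cl k z"
proof -
  obtain i1 x1 i2 x2 i3 x3 where *: "C = cl i1 x1" "D = cl i2 x2" "E = cl i3 x3"
    "i1 \<in> I" "i2 \<in> I" "i3 \<in> I" "x1 \<in> carrier (G i1)" "x2 \<in> carrier (G i2)" "x3 \<in> carrier (G i3)"
    using assms by (auto simp: carrier_lim)
  obtain k where k: "k \<in> I" "R i1 k" "R i2 k" "R i3 k" using upper2[of i1 i2 i3 i3] * by metis
  show ?thesis
    by (rule that[of k "h i1 k x1" "h i2 k x2" "h i3 k x3"])
      (use * k hom in \<open>auto simp: cl_up hom_def\<close>)
qed

lemma group_lim: "group dlim"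
proof (rule groupI)
  fix C D assume C: "C \<in> carrier dlim" and D: "D \<in> carrier dlim"
  show "C \<otimes>\<^bsub>dlim\<^esub> D \<in> carrier dlim"
    by (rule common[OF C D D])
      (auto simp: mult_lim intro!: cl_in_carrier monoid.m_closed groups[THEN group.is_monoid])
next
  obtain k where "k \<in> I" using nonempty by blast
  then show "\<one>\<^bsub>dlim\<^esub> \<in> carrier dlim"
    by (auto simp: one_lim[of k] intro!: cl_in_carrier monoid.one_closed groups[THEN group.is_monoid])
next
  fix C D E assume "C \<in> carrier dlim" "D \<in> carrier dlim" "E \<in> carrier dlim"
  then show "C \<otimes>\<^bsub>dlim\<^esub> D \<otimes>\<^bsub>dlim\<^esub> E = C \<otimes>\<^bsub>dlim\<^esub> (D \<otimes>\<^bsub>dlim\<^esub> E)"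
    by (rule common)
      (simp add: mult_lim monoid.m_closed[OF groups[THEN group.is_monoid]] monoid.m_assoc[OF groups[THEN group.is_monoid]])
next
  fix C assume C: "C \<in> carrier dlim"
  obtain k x where k: "k \<in> I" "x \<in> carrier (G k)" "C = cl k x"
    by (rule common[OF C C C]) blast
  note * = groups[OF k(1)] groups[OF k(1), THEN group.is_monoid]
  show "\<one>\<^bsub>dlim\<^esub> \<otimes>\<^bsub>dlim\<^esub> C = C"
    using k * by (simp add: one_lim[of k] mult_lim monoid.one_closed monoid.l_one)
  show "\<exists>D\<in>carrier dlim. D \<otimes>\<^bsub>dlim\<^esub> C = \<one>\<^bsub>dlim\<^esub>"
    using k * by (intro bexI[of _ "cl k (inv\<^bsub>G k\<^esub> x)"])
      (simp_all add: one_lim[of k] mult_lim group.l_inv cl_in_carrier group.inv_closed)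
qed

end

subsection \<open>The Navas-Brin group\<close>

text \<open>
  Steps and first-return decompositions of paths. The type is used twice: a nonnegative word is
  a \<open>bool blk list\<close>, where \<open>BN b\<close> is a letter \<open>a\<close> or its inverse and \<open>BU u\<close> is the word
  \<open>u\<close> conjugated by \<open>t\<close>; a nonnegative path of exponents of \<open>a\<close> is a \<open>bool blk list blk list\<close>,
  where \<open>BN u\<close> is a syllable above the lowest level.
\<close>

datatype 'x step = Neu 'x | Upp | Dwn

datatype 'x blk = BN 'x | BU "'x blk list"

fun flat :: "'x blk list \<Rightarrow> 'x step list" where
  "flat [] = []"
| "flat (BN x # bs) = Neu x # flat bs"
| "flat (BU u # bs) = Upp # flat u @ Dwn # flat bs"

lemma flat_append: "flat (u @ v) = flat u @ flat v"
  by (induction u rule: flat.induct) auto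

primrec delta :: "'x step \<Rightarrow> int" where
  "delta (Neu x) = 0"
| "delta Upp = 1"
| "delta Dwn = - 1"

definition height :: "'x step list \<Rightarrow> int" where
  "height w = (\<Sum>s\<leftarrow>w. delta s)"

lemma height_simps [simp]:
  "height [] = 0" "height (s # w) = delta s + height w" "height (v @ w) = height v + height w"
  by (auto simp: height_def)

section \<open>The direct limit of the groups \<open>W i j\<close> and its shift\<close>

lemma intervals_iff: "(i, j) \<in> intervals \<longleftrightarrow> i \<le> j"
  by (simp add: intervals_def)

lemma interval_le_iff: "interval_le (i, j) (i', j') \<longleftrightarrow> i' \<le> i \<and> j \<le> j'"
  by (simp add: interval_le_def)

interpretation Winf: directed_system intervals interval_le "case_prod W" incl
proof (rule directed_system.intro)
  show "\<exists>k\<in>intervals. interval_le p k \<and> interval_le q k" if "p \<in> intervals" "q \<in> intervals" for p q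
    using that by (intro bexI[of _ "(min (fst p) (fst q), max (snd p) (snd q))"])
      (auto simp: intervals_def interval_le_def)
qed (use incl_hom incl_incl in \<open>auto simp: intervals_def interval_le_def group_W\<close>)

abbreviation Wcl :: "int \<times> int \<Rightarrow> wtree \<Rightarrow> ((int \<times> int) \<times> wtree) set" where
  "Wcl \<equiv> Winf.cl"

lemmas Wcl_rules = Winf.mult_lim[folded W_inf_def] Winf.one_lim[folded W_inf_def]
  Winf.cl_in_carrier[folded W_inf_def]

lemma group_W_inf: "group W_inf"
  using Winf.group_lim by (simp add: W_inf_def)

lemma incl_shift:
  "incl (i + k, j + k) (i' + k, j' + k) = incl (i, j) (i', j')"
proof -
  have "incl_left (i + k) (j + k) = incl_left i j" for i j
    by (simp add: incl_left_def W_shift fun_eq_iff)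
  then have "incl_left_iter d (i + k) (j + k) g = incl_left_iter d i j g" for d i j g
    by (induction d) (auto simp: algebra_simps, metis add.commute add_diff_eq diff_add_eq)
  then show ?thesis by (simp add: incl_def fun_eq_iff)
qed

lemma rel_shift:
  assumes "(((i, j), x), ((i', j'), y)) \<in> W_inf_rel"
  shows "(((i + k, j + k), x), ((i' + k, j' + k), y)) \<in> W_inf_rel"
proof -
  from assms obtain a b where *: "i \<le> j" "i' \<le> j'" "x \<in> carrier (W i j)" "y \<in> carrier (W i' j')"
     "a \<le> i" "j \<le> b" "a \<le> i'" "j' \<le> b" "incl (i, j) (a, b) x = incl (i', j') (a, b) y"
    unfolding Winf.rel_iff by (auto simp: intervals_iff interval_le_iff)
  then show ?thesis
    unfolding Winf.rel_iff by (auto simp: intervals_iff interval_le_iff W_shift incl_shift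
          intro!: bexI[of _ "(a + k, b + k)"])
qed

lemma shift_inf_Wcl: "shift_inf k (Wcl (i, j) x) = Wcl (i + k, j + k) x"
proof (intro equalityI subsetI)
  fix z assume "z \<in> shift_inf k (Wcl (i, j) x)"
  then show "z \<in> Wcl (i + k, j + k) x"
    using rel_shift by (auto simp: shift_inf_def Winf.cl_def)
next
  fix z assume z: "z \<in> Wcl (i + k, j + k) x"
  obtain i' j' y where z_def: "z = ((i', j'), y)" by (metis surj_pair)
  have "(((i, j), x), ((i' - k, j' - k), y)) \<in> W_inf_rel"
    using rel_shift[of "i + k" "j + k" x i' j' y "- k"] z by (simp add: z_def Winf.cl_def)
  then have "((i' - k, j' - k), y) \<in> Wcl (i, j) x" by (simp add: Winf.cl_def)
  then show "z \<in> shift_inf k (Wcl (i, j) x)"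
    unfolding shift_inf_def by (rule rev_image_eqI) (simp add: z_def)
qed

lemma W_inf_cases:
  assumes "C \<in> carrier W_inf"
  obtains i j x where "i \<le> j" "x \<in> carrier (W i j)" "C = Wcl (i, j) x"
  using assms by (auto simp: W_inf_def Winf.carrier_lim) (auto simp: intervals_def)

lemma shift_inf_hom: "shift_inf k \<in> hom W_inf W_inf"
proof (rule homI)
  fix C assume "C \<in> carrier W_inf"
  then show "shift_inf k C \<in> carrier W_inf"
    by (elim W_inf_cases) (auto simp: shift_inf_Wcl W_shift intervals_iff intro!: Wcl_rules)
next
  fix C D assume C: "C \<in> carrier W_inf" and D: "D \<in> carrier W_inf"
  obtain p x y where *: "p \<in> intervals" "x \<in> carrier (case_prod W p)" "y \<in> carrier (case_prod W p)"
    "C = Wcl p x" "D = Wcl p y"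
    by (rule Winf.common[OF C[unfolded W_inf_def] D[unfolded W_inf_def] D[unfolded W_inf_def]])
  then show "shift_inf k (C \<otimes>\<^bsub>W_inf\<^esub> D) = shift_inf k C \<otimes>\<^bsub>W_inf\<^esub> shift_inf k D"
    by (cases p) (auto simp: Wcl_rules shift_inf_Wcl W_shift intervals_iff)
qed

lemma group_navas_brin: "group navas_brin"
  unfolding navas_brin_def
proof (rule group_semidirect[OF group_W_inf group_integer_group shift_inf_hom])
  fix h k :: int and C
  show "shift_inf (h \<otimes>\<^bsub>integer_group\<^esub> k) C = shift_inf h (shift_inf k C)"
    by (force simp: shift_inf_def image_image algebra_simps case_prod_unfold)
  show "shift_inf \<one>\<^bsub>integer_group\<^esub> C = C"
    by (simp add: shift_inf_def case_prod_unfold)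
qed

lemmas navas_brin_simps =
  semidirect_simps[of W_inf integer_group shift_inf, folded navas_brin_def, simplified]

section \<open>Values of words\<close>

definition sgn_int :: "bool \<Rightarrow> int" where
  "sgn_int b = (if b then 1 else - 1)"

lemma Leaf_carrier: "Leaf k \<in> carrier (W i i)" by (simp add: carrier_W_Leaf)

lemma nb_a_eq: "nb_a = (Wcl (0, 0) (Leaf 1), 0)"
  by (simp add: nb_a_def gen_inf_def Winf.cl_def wgen.simps)

lemma inv_nb_a: "inv\<^bsub>navas_brin\<^esub> nb_a = (Wcl (0, 0) (Leaf (- 1)), 0)"
proof (rule group.inv_equality[OF group_navas_brin])
  have "\<one>\<^bsub>W 0 0\<^esub> = Leaf 0" by (subst one_W) simp
  then show "(Wcl (0, 0) (Leaf (- 1)), 0) \<otimes>\<^bsub>navas_brin\<^esub> nb_a = \<one>\<^bsub>navas_brin\<^esub>"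
    by (simp add: nb_a_eq navas_brin_simps shift_inf_Wcl Wcl_rules(1) Wcl_rules(2)[of "(0,0)"]
         intervals_iff Leaf_carrier mult_W_Leaf)
qed (auto simp: nb_a_eq navas_brin_simps intervals_iff Leaf_carrier intro!: Wcl_rules)

lemma one_W_inf: "i \<le> j \<Longrightarrow> \<one>\<^bsub>W_inf\<^esub> = Wcl (i, j) \<one>\<^bsub>W i j\<^esub>"
  using Wcl_rules(2)[of "(i, j)"] by (simp add: intervals_iff)

lemma shift_inf_one: "shift_inf k \<one>\<^bsub>W_inf\<^esub> = \<one>\<^bsub>W_inf\<^esub>"
  by (rule hom_one[OF shift_inf_hom group_W_inf group_W_inf])

lemma W_inf_one_closed: "\<one>\<^bsub>W_inf\<^esub> \<in> carrier W_inf"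
  using group_W_inf by (simp add: group.is_monoid monoid.one_closed)

lemma inv_nb_t: "inv\<^bsub>navas_brin\<^esub> nb_t = (\<one>\<^bsub>W_inf\<^esub>, - 1)"
  by (rule group.inv_equality[OF group_navas_brin])
    (auto simp: nb_t_def navas_brin_simps shift_inf_one W_inf_one_closed group_W_inf group.is_monoid monoid.l_one)

primrec step_letter :: "bool step \<Rightarrow> letter" where
  "step_letter (Neu b) = (if b then letter_a else letter_a_inv)"
| "step_letter Upp = letter_t"
| "step_letter Dwn = letter_t_inv"

definition wval :: "bool step list \<Rightarrow> ((int \<times> int) \<times> wtree) set \<times> int" where
  "wval w = word_value (map step_letter w)"

lemma letter_value_step:
  "letter_value (step_letter (Neu b)) = (Wcl (0, 0) (Leaf (sgn_int b)), 0)"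
  "letter_value (step_letter Upp) = (\<one>\<^bsub>W_inf\<^esub>, 1)"
  "letter_value (step_letter Dwn) = (\<one>\<^bsub>W_inf\<^esub>, - 1)"
  by (auto simp: sgn_int_def nb_a_eq inv_nb_a[unfolded nb_a_eq] inv_nb_t) (simp add: nb_t_def)

lemma letter_value_closed: "letter_value (step_letter s) \<in> carrier navas_brin"
  by (cases s) (auto simp: letter_value_step simp del: step_letter.simps,
    auto simp: navas_brin_simps W_inf_one_closed intervals_iff Leaf_carrier intro!: Wcl_rules)

interpretation NB: group navas_brin by (rule group_navas_brin)

lemma wval_simps: "wval [] = \<one>\<^bsub>navas_brin\<^esub>"
  "wval (s # w) = letter_value (step_letter s) \<otimes>\<^bsub>navas_brin\<^esub> wval w"
  by (auto simp: wval_def)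

lemma wval_closed: "wval w \<in> carrier navas_brin"
  by (induction w) (auto simp: wval_simps letter_value_closed)

lemma wval_append: "wval (v @ w) = wval v \<otimes>\<^bsub>navas_brin\<^esub> wval w"
  by (induction v) (auto simp: wval_simps letter_value_closed wval_closed NB.m_assoc)

lemma snd_wval: "snd (wval w) = height w"
proof (induction w)
  case (Cons s w)
  then show ?case
    by (cases s; cases "wval w") (auto simp: wval_simps letter_value_step navas_brin_simps simp del: step_letter.simps)
qed (auto simp: wval_simps navas_brin_simps)

definition trivial_word :: "bool step list \<Rightarrow> bool" where
  "trivial_word w \<longleftrightarrow> wval w = \<one>\<^bsub>navas_brin\<^esub>"

lemma trivial_word_height: "trivial_word w \<Longrightarrow> height w = 0"
  using snd_wval[of w] by (simp add: trivial_word_def navas_brin_simps)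

lemma trivial_word_commute: "trivial_word (v @ w) \<longleftrightarrow> trivial_word (w @ v)"
proof -
  have "trivial_word (w @ v)" if "trivial_word (v @ w)" for v w
    using that NB.inv_comm[of "wval v" "wval w"] by (simp add: trivial_word_def wval_append wval_closed)
  then show ?thesis by blast
qed

subsection \<open>Nonnegative words\<close>

text \<open>A nonnegative word involves generators of index at least 0 only. Shifting
  \<open>W 1 (1 + int d)\<close> back to \<open>V d\<close> turns the descent through the levels
  into induction on a natural number.\<close>

definition V :: "nat \<Rightarrow> wtree monoid" where
  "V d = W 0 (int d)"

definition WV :: "nat \<Rightarrow> wtree \<Rightarrow> ((int \<times> int) \<times> wtree) set" where
  "WV d = Wcl (0, int d)"

lemma W_1_Suc: "W 1 (1 + int d) = V d"
  using W_shift[of 0 1 "int d"] by (simp add: add.commute V_def)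

lemma W_0_Suc: "W 0 (1 + int d) = V (Suc d)"
  by (simp add: V_def)

lemma one_V_Suc: "\<one>\<^bsub>V (Suc d)\<^esub> = Node (\<lambda>_. \<one>\<^bsub>V d\<^esub>) 0"
  unfolding V_def[of "Suc d"] by (subst one_W) (simp add: W_1_Suc)

lemma one_V_0: "\<one>\<^bsub>V 0\<^esub> = Leaf 0"
  unfolding V_def by (subst one_W) simp

lemma carrier_V_Node:
  "Node f k \<in> carrier (V (Suc d)) \<longleftrightarrow> (\<forall>m. f m \<in> carrier (V d)) \<and> finite {m. f m \<noteq> \<one>\<^bsub>V d\<^esub>}"
  using carrier_W_Node[of 0 "int (Suc d)" f k] by (simp add: W_1_Suc W_0_Suc)

lemma mult_V_Node:
  "Node f k \<in> carrier (V (Suc d)) \<Longrightarrow> Node g l \<in> carrier (V (Suc d)) \<Longrightarrow>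
    Node f k \<otimes>\<^bsub>V (Suc d)\<^esub> Node g l = Node (\<lambda>m. f m \<otimes>\<^bsub>V d\<^esub> g (m - k)) (k + l)"
  using mult_W_Node[of 0 "int (Suc d)" f k g l] by (simp add: W_1_Suc W_0_Suc)

text \<open>The \<open>k\<close>-th power of the lowest generator, which acts in the outermost
  wreath product as soon as \<open>d\<close> is positive.\<close>

primrec top_gen :: "nat \<Rightarrow> int \<Rightarrow> wtree" where
  "top_gen 0 k = Leaf k"
| "top_gen (Suc d) k = Node (\<lambda>_. \<one>\<^bsub>V d\<^esub>) k"

text \<open>Conjugation by \<open>t\<close> on representatives: the shift moves \<open>V d\<close>
  to \<open>W 1 (1 + int d)\<close>, which lies in \<open>V (Suc d)\<close> as the copy at index 0
  (\<open>Wcl_sub_copy\<close>).\<close>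

definition sub_copy :: "nat \<Rightarrow> wtree \<Rightarrow> wtree" where
  "sub_copy d g = Node (\<lambda>m. if m = 0 then g else \<one>\<^bsub>V d\<^esub>) 0"

interpretation V: group "V d" for d unfolding V_def by (rule group_W)

lemma top_gen_closed: "top_gen d k \<in> carrier (V d)"
  by (cases d) (auto simp: Leaf_carrier carrier_V_Node, simp add: V_def Leaf_carrier)

lemma sub_copy_closed: "g \<in> carrier (V d) \<Longrightarrow> sub_copy d g \<in> carrier (V (Suc d))"
  by (auto simp: sub_copy_def carrier_V_Node)

fun depth :: "bool blk list \<Rightarrow> nat" where
  "depth [] = 0"
| "depth (BN b # ts) = depth ts"
| "depth (BU u # ts) = max (Suc (depth u)) (depth ts)"

text \<open>The value \<open>undefined\<close> is not reached for \<open>depth ts \<le> d\<close>.\<close>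

fun tree_val :: "nat \<Rightarrow> bool blk list \<Rightarrow> wtree" where
  "tree_val d [] = \<one>\<^bsub>V d\<^esub>"
| "tree_val d (BN b # ts) = top_gen d (sgn_int b) \<otimes>\<^bsub>V d\<^esub> tree_val d ts"
| "tree_val 0 (BU u # ts) = undefined"
| "tree_val (Suc d) (BU u # ts) = sub_copy d (tree_val d u) \<otimes>\<^bsub>V (Suc d)\<^esub> tree_val (Suc d) ts"

lemma tree_val_closed: "depth ts \<le> d \<Longrightarrow> tree_val d ts \<in> carrier (V d)"
  by (induction d ts rule: tree_val.induct)
    (auto simp: top_gen_closed sub_copy_closed)

lemma depth_append [simp]: "depth (us @ vs) = max (depth us) (depth vs)"
  by (induction us rule: depth.induct) auto

lemma tree_val_append:
  "depth us \<le> d \<Longrightarrow> depth vs \<le> d \<Longrightarrow>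
    tree_val d (us @ vs) = tree_val d us \<otimes>\<^bsub>V d\<^esub> tree_val d vs"
  by (induction d us rule: tree_val.induct)
    (auto simp: top_gen_closed sub_copy_closed tree_val_closed V.m_assoc)

fun net :: "bool blk list \<Rightarrow> int" where
  "net [] = 0"
| "net (BN b # ts) = sgn_int b + net ts"
| "net (BU u # ts) = net ts"

text \<open>The factors of the base of the wreath product that lie in the copy at index \<open>m\<close>.\<close>

fun contents :: "int \<Rightarrow> bool blk list \<Rightarrow> bool blk list" where
  "contents m [] = []"
| "contents m (BN b # ts) = contents (m - sgn_int b) ts"
| "contents m (BU u # ts) = (if m = 0 then u else []) @ contents m ts"

lemma depth_contents: "depth ts \<le> Suc d \<Longrightarrow> depth (contents m ts) \<le> d"
  by (induction m ts rule: contents.induct) auto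

text \<open>The product in a wreath product shifts the base function of the right factor by the
  exponent of the left one; \<open>contents\<close> makes the same change of index at every
  letter.\<close>

lemma tree_val_Suc:
  "depth ts \<le> Suc d \<Longrightarrow> tree_val (Suc d) ts = Node (\<lambda>m. tree_val d (contents m ts)) (net ts)"
proof (induction ts rule: depth.induct)
  case 1
  then show ?case by (simp add: one_V_Suc)
next
  case (2 b ts)
  have *: "Node (\<lambda>m. tree_val d (contents m ts)) (net ts) \<in> carrier (V (Suc d))"
    "Node (\<lambda>_. \<one>\<^bsub>V d\<^esub>) (sgn_int b) \<in> carrier (V (Suc d))"
    using 2 tree_val_closed[of ts "Suc d"] top_gen_closed[of "Suc d"] by (auto)
  have "depth (contents m ts) \<le> d" for m using 2 depth_contents by simp
  then show ?case using 2 by (simp add: mult_V_Node[OF *(2,1)] tree_val_closed)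
next
  case (3 u ts)
  have d: "depth u \<le> d" "depth (contents m ts) \<le> d" for m using 3 depth_contents by auto
  have *: "Node (\<lambda>m. tree_val d (contents m ts)) (net ts) \<in> carrier (V (Suc d))"
    "sub_copy d (tree_val d u) \<in> carrier (V (Suc d))"
    using 3 tree_val_closed[of ts "Suc d"] sub_copy_closed tree_val_closed[of u d] by (auto)
  show ?case using 3 d
    by (auto simp: mult_V_Node[OF *(2)[unfolded sub_copy_def] *(1)] sub_copy_def tree_val_append tree_val_closed fun_eq_iff)
qed

lemma Wcl_up:
  assumes "i \<le> j" "i' \<le> i" "j \<le> j'" "x \<in> carrier (W i j)"
  shows "Wcl (i', j') (incl (i, j) (i', j') x) = Wcl (i, j) x"
  using Winf.cl_up[of "(i, j)" "(i', j')" x] assms by (simp add: intervals_iff interval_le_iff)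

lemma Wcl_top_gen: "WV d (top_gen d k) = Wcl (0, 0) (Leaf k)"
proof -
  have *: "(incl_right ^^ d) (Leaf k) = top_gen d k"
  proof (induction d)
    case (Suc d)
    then show ?case
    proof (cases d)
      case 0
      then show ?thesis by (simp add: one_V_0)
    next
      case d: (Suc e)
      then show ?thesis using Suc incl_right_one[of 0 "int e"] by (simp add: add.commute V_def)
    qed
  qed auto
  then show ?thesis using Wcl_up[of 0 0 0 "int d" "Leaf k"] * by (simp add: Leaf_carrier incl_def WV_def)
qed

lemma Wcl_sub_copy:
  assumes "g \<in> carrier (V d)"
  shows "WV (Suc d) (sub_copy d g) = shift_inf 1 (WV d g)"
proof -
  have "incl (1, 1 + int d) (0, 1 + int d) g = sub_copy d g"
    by (auto simp: incl_def incl_left_def sub_copy_def W_1_Suc)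
  then show ?thesis using Wcl_up[of 1 "1 + int d" 0 "1 + int d" g] assms
    by (simp add: W_1_Suc shift_inf_Wcl add.commute WV_def)
qed

lemma Wcl_mult_V:
  "x \<in> carrier (V d) \<Longrightarrow> y \<in> carrier (V d) \<Longrightarrow>
    WV d x \<otimes>\<^bsub>W_inf\<^esub> WV d y = WV d (x \<otimes>\<^bsub>V d\<^esub> y)"
  using Wcl_rules(1)[of "(0, int d)" x y] by (simp add: intervals_iff V_def WV_def)

lemma WV_closed: "x \<in> carrier (V d) \<Longrightarrow> WV d x \<in> carrier W_inf"
  by (auto simp: intervals_iff WV_def V_def intro!: Wcl_rules)

lemma WV_one: "WV d \<one>\<^bsub>V d\<^esub> = \<one>\<^bsub>W_inf\<^esub>"
  by (simp add: one_W_inf[of 0 "int d"] WV_def V_def)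

lemma shift_inf_closed: "C \<in> carrier W_inf \<Longrightarrow> shift_inf k C \<in> carrier W_inf"
  using shift_inf_hom by (auto simp: hom_def)

lemma shift_inf_0: "shift_inf 0 C = C"
  by (simp add: shift_inf_def case_prod_unfold)

lemma shift_inf_shift: "shift_inf h (shift_inf k C) = shift_inf (h + k) C"
  by (force simp: shift_inf_def image_image algebra_simps case_prod_unfold)

lemmas shift_inf_mult = hom_mult[OF shift_inf_hom]

interpretation WI: group W_inf by (rule group_W_inf)

lemma wval_flat:
  "depth ts \<le> d \<Longrightarrow> wval (flat ts) = (WV d (tree_val d ts), 0)"
proof (induction d ts rule: tree_val.induct)
  case (1 d)
  then show ?case by (simp add: wval_simps navas_brin_simps WV_one)
next
  case (2 d b ts)
  then show ?case
    by (simp add: wval_simps letter_value_step navas_brin_simps shift_inf_0 Wcl_mult_V top_gen_closed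
        tree_val_closed flip: Wcl_top_gen[of d] del: step_letter.simps)
next
  case (3 u ts)
  then show ?case by simp
next
  case (4 d u ts)
  have d: "tree_val d u \<in> carrier (V d)" "tree_val (Suc d) ts \<in> carrier (V (Suc d))"
    using 4 by (auto simp: tree_val_closed)
  show ?case using 4 d
    by (simp add: wval_append wval_simps letter_value_step navas_brin_simps shift_inf_0
       shift_inf_shift shift_inf_mult shift_inf_one shift_inf_closed WV_closed sub_copy_closed Wcl_mult_V 
        flip: Wcl_sub_copy del: step_letter.simps)
qed

definition trivial_nonneg :: "bool blk list \<Rightarrow> bool" where
  "trivial_nonneg ts \<longleftrightarrow> trivial_word (flat ts)"

lemma trivial_nonneg_tree_val:
  assumes "depth ts \<le> d"
  shows "trivial_nonneg ts \<longleftrightarrow> tree_val d ts = \<one>\<^bsub>V d\<^esub>"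
proof -
  have "trivial_nonneg ts \<longleftrightarrow> WV d (tree_val d ts) = WV d \<one>\<^bsub>V d\<^esub>"
    using wval_flat[OF assms] by (simp add: trivial_nonneg_def trivial_word_def navas_brin_simps WV_one)
  \<comment> \<open>Equal classes agree in some larger group, and \<open>inj_incl\<close> takes the
    equation back to \<open>V d\<close>.\<close>
  also have "\<dots> \<longleftrightarrow> tree_val d ts = \<one>\<^bsub>V d\<^esub>"
    using tree_val_closed[OF assms]
    unfolding WV_def V_def
    by (subst Winf.cl_eq_iff)
      (auto simp: intervals_iff interval_le_iff inj_eq[OF inj_incl] intro!: bexI[of _ "(0, int d)"] monoid.one_closed monoid_W)
  finally show ?thesis .
qed

lemma trivial_nonneg_iff:
  "trivial_nonneg ts \<longleftrightarrow> net ts = 0 \<and> (\<forall>m. trivial_nonneg (contents m ts))"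
proof -
  define d where "d = depth ts"
  have d: "depth (contents m ts) \<le> d" for m by (rule depth_contents) (simp add: d_def)
  \<comment> \<open>Evaluation at \<open>Suc d\<close> instead of \<open>d\<close> gives a
    \<open>Node\<close> even for words of depth 0, so that \<open>tree_val_Suc\<close>
    applies.\<close>
  have "trivial_nonneg ts \<longleftrightarrow> tree_val (Suc d) ts = \<one>\<^bsub>V (Suc d)\<^esub>"
    by (rule trivial_nonneg_tree_val) (simp add: d_def)
  also have "\<dots> \<longleftrightarrow> net ts = 0 \<and> (\<forall>m. trivial_nonneg (contents m ts))"
    by (subst tree_val_Suc)
      (auto simp: d_def[symmetric] one_V_Suc fun_eq_iff trivial_nonneg_tree_val[OF d])
  finally show ?thesis .
qed

lemma trivial_nonneg_commute: "trivial_nonneg (u @ v) \<longleftrightarrow> trivial_nonneg (v @ u)"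
  using trivial_word_commute[of "flat u"] by (simp add: trivial_nonneg_def flat_append)

section \<open>Counting\<close>

subsection \<open>Dyck paths\<close>

fun dyck :: "nat \<Rightarrow> 'x step list \<Rightarrow> bool" where
  "dyck h [] \<longleftrightarrow> h = 0"
| "dyck h (Neu x # w) \<longleftrightarrow> dyck h w"
| "dyck h (Upp # w) \<longleftrightarrow> dyck (Suc h) w"
| "dyck 0 (Dwn # w) \<longleftrightarrow> False"
| "dyck (Suc h) (Dwn # w) \<longleftrightarrow> dyck h w"

text \<open>
  A path from height \<open>h\<close> to \<open>0\<close> is cut at the last visits to the heights \<open>h, \<dots>, 1\<close> into
  \<open>h + 1\<close> closed paths.
\<close>

fun parse :: "'x step list \<Rightarrow> 'x blk list list" where
  "parse [] = [[]]"
| "parse (Neu x # w) = (let p = parse w in (BN x # hd p) # tl p)"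
| "parse (Upp # w) = (let p = parse w in (BU (hd p) # hd (tl p)) # tl (tl p))"
| "parse (Dwn # w) = [] # parse w"

text \<open>The arbitrary continuation \<open>w\<close> is what the induction needs inside an
  excursion, where the rest begins with \<open>Dwn\<close>. For empty \<open>w\<close>,
  \<open>parse\<close> is a left inverse of \<open>flat\<close>.\<close>

lemma parse_flat: "parse (flat ts @ w) = (ts @ hd (parse w)) # tl (parse w)"
proof (induction ts arbitrary: w rule: flat.induct)
  case 1
  have "parse w \<noteq> []" by (induction w rule: parse.induct) (auto simp: Let_def)
  then show ?case by simp
qed (auto simp: Let_def)

lemma inj_flat: "inj flat"
proof (rule injI)
  fix u v :: "'x blk list"
  assume "flat u = flat v"
  then show "u = v" using parse_flat[of u "[]"] parse_flat[of v "[]"] by simp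
qed

lemma dyck_flat: "dyck h (flat ts @ w) \<longleftrightarrow> dyck h w"
  by (induction ts arbitrary: h w rule: flat.induct) auto

lemma dyck_parse:
  "dyck h w \<Longrightarrow> \<exists>l ls. parse w = l # ls \<and> length ls = h \<and> w = flat l @ concat (map (\<lambda>l. Dwn # flat l) ls)"
proof (induction h w rule: dyck.induct)
  case (3 h w)
  then obtain l ls where "parse w = l # ls" "length ls = Suc h"
    "w = flat l @ concat (map (\<lambda>l. Dwn # flat l) ls)" by auto
  then show ?case by (cases ls) auto
qed auto

lemma dyck_0_iff: "dyck 0 w \<longleftrightarrow> w \<in> range flat"
proof
  assume "dyck 0 w"
  then show "w \<in> range flat" using dyck_parse[of 0 w] by auto
next
  assume "w \<in> range flat"
  then show "dyck 0 w" using dyck_flat[of 0 _ "[]"] by auto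
qed

lemma all_prefixes_Cons:
  "(\<forall>u v. s # w = u @ v \<longrightarrow> P u) \<longleftrightarrow> P [] \<and> (\<forall>u v. w = u @ v \<longrightarrow> P (s # u))"
proof (intro iffI conjI allI impI)
  fix u v assume "P [] \<and> (\<forall>u v. w = u @ v \<longrightarrow> P (s # u))" "s # w = u @ v"
  then show "P u" by (cases u) auto
qed auto

lemma dyck_iff:
  "dyck h w \<longleftrightarrow> int h + height w = 0 \<and> (\<forall>u v. w = u @ v \<longrightarrow> int h + height u \<ge> 0)"
proof (induction h w rule: dyck.induct)
  case (2 h x w)
  show ?case unfolding all_prefixes_Cons dyck.simps 2 by simp
next
  case (3 h w)
  show ?case unfolding all_prefixes_Cons dyck.simps 3 by (simp add: add.assoc add.left_commute)
next
  case (4 w)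
  have "\<exists>u v. Dwn # w = u @ v \<and> height u < 0" by (rule exI[of _ "[Dwn]"]) auto
  then show ?case unfolding dyck.simps by force
next
  case (5 h w)
  show ?case unfolding all_prefixes_Cons dyck.simps 5 by simp
qed simp

lemma height_flat [simp]: "height (flat ts) = 0"
  by (induction ts rule: flat.induct) auto

text \<open>Since the total height is 0, rotation by \<open>i\<close> lowers all heights by
  \<open>height (take i w)\<close>. The result is nonnegative iff that height is the least
  one.\<close>

lemma dyck_rotate_iff:
  assumes "i < length w" "height w = 0"
  shows "dyck 0 (rotate i w) \<longleftrightarrow> (\<forall>u v. w = u @ v \<longrightarrow> height (take i w) \<le> height u)"
proof -
  define a b where "a = take i w" and "b = drop i w"
  have w: "w = a @ b" by (simp add: a_def b_def)
  have ab: "height a + height b = 0" using assms(2) w by simp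
  have "dyck 0 (rotate i w) \<longleftrightarrow> (\<forall>u v. b @ a = u @ v \<longrightarrow> 0 \<le> height u)"
    using assms ab by (simp add: rotate_drop_take dyck_iff a_def b_def)
  also have "\<dots> \<longleftrightarrow> (\<forall>u v. w = u @ v \<longrightarrow> height a \<le> height u)"
  proof (intro iffI allI impI)
    fix u v assume *: "\<forall>u v. b @ a = u @ v \<longrightarrow> 0 \<le> height u" and "w = u @ v"
    then consider c where "a = u @ c" | c where "u = a @ c" "b = c @ v"
      by (auto simp: w append_eq_append_conv2)
    then show "height a \<le> height u"
    proof cases
      case 1
      then have "0 \<le> height (b @ u)" using * by (metis append.assoc)
      then show ?thesis using ab by simp
    next
      case 2
      then have "0 \<le> height c" using * by (metis append.assoc)
      then show ?thesis using 2 by simp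
    qed
  next
    fix u v assume *: "\<forall>u v. w = u @ v \<longrightarrow> height a \<le> height u" and "b @ a = u @ v"
    then consider c where "b = u @ c" | c where "u = b @ c" "a = c @ v"
      by (auto simp: append_eq_append_conv2)
    then show "0 \<le> height u"
    proof cases
      case 1
      then have "height a \<le> height (a @ u)" using * w by (metis append.assoc)
      then show ?thesis by simp
    next
      case 2
      then have "height a \<le> height c" using * w by (metis append.assoc)
      then show ?thesis using 2 ab by simp
    qed
  qed
  finally show ?thesis by (simp add: a_def)
qed

lemma height_prefix_flat:
  assumes "flat ts = u @ v"
  shows "0 \<le> height u"
proof -
  have "dyck 0 (u @ v)" using assms[symmetric] by (simp add: dyck_0_iff)
  then show ?thesis unfolding dyck_iff by simp
qed

section \<open>Positions of minimal height and rotations\<close>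

text \<open>The end of the path is left out, because on a closed path it coincides with the
  start.\<close>

definition minima :: "'x step list \<Rightarrow> nat set" where
  "minima w = {i. i < length w \<and> dyck 0 (rotate i w)}"

lemma minima_flat_eq: "minima (flat ts) = {i. i < length (flat ts) \<and> height (take i (flat ts)) = 0}"
proof -
  note * = height_prefix_flat[of ts]
  have "dyck 0 (rotate i (flat ts)) \<longleftrightarrow> height (take i (flat ts)) = 0" if "i < length (flat ts)" for i
  proof -
    have "0 \<le> height (take i (flat ts))" using *[of "take i (flat ts)" "drop i (flat ts)"] by simp
    then show ?thesis using * dyck_rotate_iff[OF that height_flat] by (metis append_Nil height_simps(1) order_antisym)
  qed
  then show ?thesis by (auto simp: minima_def)
qed

lemma zeros_append:
  assumes "height v = 0"
  shows "{i. i < length (v @ w) \<and> height (take i (v @ w)) = 0} =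
    {i. i < length v \<and> height (take i v) = 0} \<union> (+) (length v) ` {i. i < length w \<and> height (take i w) = 0}"
    (is "?L = ?R")
proof (intro equalityI subsetI)
  fix i assume i: "i \<in> ?L"
  show "i \<in> ?R"
  proof (cases "i < length v")
    case False
    then show ?thesis using i assms by (intro UnI2 image_eqI[of _ _ "i - length v"]) auto
  qed (use i in auto)
qed (use assms in auto)

text \<open>A block starts at height 0 and is strictly above 0 in its interior, so the minima are
  the starting positions of the blocks.\<close>

lemma card_minima_flat: "card (minima (flat ts)) = length ts"
  unfolding minima_flat_eq
proof (induction ts)
  case (Cons b ts)
  have *: "{i. i < length (flat [b]) \<and> height (take i (flat [b])) = 0} = {0}"
  proof (cases b)
    case (BU u)
    have "0 \<le> height (take j (flat u))" for j
      by (rule height_prefix_flat[of u _ "drop j (flat u)"]) simp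
    then have "height (take i (flat [b])) \<noteq> 0" if "0 < i" "i < length (flat [b])" for i
      using that BU by (cases i) (auto simp: add_nonneg_eq_0_iff)
    then show ?thesis using BU by auto
  qed auto
  have f: "flat (b # ts) = flat [b] @ flat ts" using flat_append[of "[b]" ts] by simp
  show ?case unfolding f zeros_append[OF height_flat] * using Cons.IH
    by (subst card_Un_disjoint) (auto simp: card_image, cases b, auto)
qed auto

lemma minima_nonempty:
  assumes "w \<noteq> []" "height w = 0"
  shows "minima w \<noteq> {}"
proof -
  obtain i where i: "i < length w" "\<And>j. j < length w \<Longrightarrow> height (take i w) \<le> height (take j w)"
    using arg_min_if_finite[of "{..<length w}" "\<lambda>i. height (take i w)"] assms(1)
    by (meson finite_lessThan lessThan_empty_iff lessThan_iff length_0_conv linorder_not_less)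
  have "height (take i w) \<le> height u" if "w = u @ v" for u v
    using i(2)[of "length u"] i(2)[of 0] that assms by (cases v) auto
  then show ?thesis using dyck_rotate_iff[OF i(1) assms(2)] i(1) by (auto simp: minima_def)
qed

lemma card_minima_rotate: "card (minima (rotate k w)) = card (minima w)"
proof (induction k)
  case (Suc k)
  have "card (minima (rotate1 w)) = card (minima w)" for w :: "'a step list"
  proof (cases "w = []")
    case False
    let ?f = "\<lambda>i. Suc i mod length w"
    have "rotate i (rotate1 w) = rotate (Suc i) w" for i
      by (simp add: rotate1_rotate_swap)
    then have r: "rotate i (rotate1 w) = rotate (?f i) w" for i
      using rotate_conv_mod[of "Suc i" w] by simp
    have "bij_betw ?f (minima (rotate1 w)) (minima w)"
    \<comment> \<open>The inverse subtracts 1 modulo the length; adding \<open>length w - 1\<close>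
      avoids truncation at 0.\<close>
    proof (rule bij_betwI[where g = "\<lambda>i. (i + (length w - 1)) mod length w"], goal_cases)
      case 1
      then show ?case using False by (auto simp: minima_def r)
    next
      case 2
      have "Suc ((i + (length w - 1)) mod length w) mod length w = i" if "i < length w" for i
        using that False by (simp add: mod_Suc_eq)
      then show ?case using False by (auto simp: minima_def r)
    next
      case (3 i)
      then have "i < length w" by (simp add: minima_def)
      moreover from this have "Suc (i + length w - Suc 0) = i + length w" by simp
      ultimately show ?case by (cases "Suc i = length w") auto
    next
      case (4 i)
      then show ?case using False by (simp add: minima_def mod_Suc_eq)
    qed
    then show ?thesis by (rule bij_betw_same_card)
  qed simp
  then show ?case using Suc by simp
qed simp

text \<open>Double counting of the pairs of a path in \<open>S\<close> and a position of minimal height.\<close>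

lemma card_minima_double_count:
  assumes fin: "finite S" and len: "\<And>w. w \<in> S \<Longrightarrow> length w = n"
    and rot: "\<And>w. w \<in> S \<Longrightarrow> rotate1 w \<in> S"
  shows "card {w \<in> S. card (minima w) = z} * z = n * card {w \<in> S. dyck 0 w \<and> card (minima w) = z}"
proof -
  define M where "M = {w \<in> S. card (minima w) = z}"
  have finM: "finite M" using fin by (simp add: M_def)
  have rotM: "rotate i w \<in> M" if "w \<in> M" for i w
  proof -
    have "rotate i w \<in> S" using that rot by (induction i) (auto simp: M_def)
    then show ?thesis using that by (simp add: M_def card_minima_rotate)
  qed
  have inj: "inj (rotate i :: 'a step list \<Rightarrow> _)" for i
    unfolding rotate_def by (intro inj_fn) (auto intro: injI simp: rotate1_fixpoint_card inj_rotate1[THEN inj_eq])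
  \<comment> \<open>An injective map of a finite set into itself is onto. After exchanging the sums,
    each position \<open>i\<close> therefore contributes the same number of nonnegative
    paths.\<close>
  have surj: "rotate i ` M = M" for i
    using finM rotM inj by (intro endo_inj_surj) (auto intro: inj_on_subset)
  have "card M * z = (\<Sum>w\<in>M. card (minima w))" by (simp add: M_def)
  also have "\<dots> = (\<Sum>w\<in>M. \<Sum>i<n. if dyck 0 (rotate i w) then 1 else 0)"
  proof (intro sum.cong refl)
    fix w assume "w \<in> M"
    then have "minima w = {i \<in> {..<n}. dyck 0 (rotate i w)}" using len by (auto simp: minima_def M_def)
    then show "card (minima w) = (\<Sum>i<n. if dyck 0 (rotate i w) then 1 else 0)"
      by (simp flip: sum.inter_filter)
  qed
  also have "\<dots> = (\<Sum>i<n. \<Sum>w\<in>M. if dyck 0 (rotate i w) then 1 else 0)" by (rule sum.swap)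
  also have "\<dots> = (\<Sum>i<n. \<Sum>w\<in>rotate i ` M. if dyck 0 w then 1 else 0)"
    using inj by (subst sum.reindex) (auto intro: inj_on_subset)
  also have "\<dots> = n * card {w \<in> M. dyck 0 w}"
    using finM by (simp add: surj flip: sum.inter_filter)
  also have "{w \<in> M. dyck 0 w} = {w \<in> S. dyck 0 w \<and> card (minima w) = z}" by (auto simp: M_def)
  finally show ?thesis by (simp add: M_def)
qed

lemma card_minima_flat_double_count:
  assumes fin: "finite S" and len: "\<And>w. w \<in> S \<Longrightarrow> length w = n"
    and rot: "\<And>w. w \<in> S \<Longrightarrow> rotate1 w \<in> S"
  shows "card {w \<in> S. card (minima w) = z} * z = n * card {ts. length ts = z \<and> flat ts \<in> S}"
proof -
  have "bij_betw flat {ts. length ts = z \<and> flat ts \<in> S} {w \<in> S. dyck 0 w \<and> card (minima w) = z}"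
    unfolding bij_betw_def by (auto simp: dyck_0_iff card_minima_flat intro: inj_on_subset[OF inj_flat])
  then show ?thesis
    using card_minima_double_count[OF fin len rot, of z] by (simp add: bij_betw_same_card)
qed

text \<open>The paths are sorted by their number of minima \<open>z\<close>, which is positive for a
  nonempty closed path. The double count makes \<open>div\<close> exact for each
  \<open>z\<close>.\<close>

lemma card_rotation_invariant:
  assumes fin: "finite S" and len: "\<And>w. w \<in> S \<Longrightarrow> length w = n" and "n > 0"
    and rot: "\<And>w. w \<in> S \<Longrightarrow> rotate1 w \<in> S"
    and closed: "\<And>w. w \<in> S \<Longrightarrow> height w = 0"
  shows "card S = (\<Sum>z = 1..n. n * card {ts. length ts = z \<and> flat ts \<in> S} div z)"
proof -
  have range: "card (minima w) \<in> {1..n}" if "w \<in> S" for w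
  proof -
    have sub: "minima w \<subseteq> {..<n}" using len[OF that] by (auto simp: minima_def)
    have "minima w \<noteq> {}" using that len closed \<open>n > 0\<close> by (intro minima_nonempty) auto
    then show ?thesis using sub card_mono[OF _ sub] finite_subset[OF sub] by (auto simp: Suc_le_eq card_gt_0_iff)
  qed
  have "card S = card (\<Union>z\<in>{1..n}. {w \<in> S. card (minima w) = z})"
    using range by (intro arg_cong[of _ _ card]) auto
  also have "\<dots> = (\<Sum>z = 1..n. card {w \<in> S. card (minima w) = z})"
    using fin by (intro card_UN_disjoint) auto
  also have "\<dots> = (\<Sum>z = 1..n. n * card {ts. length ts = z \<and> flat ts \<in> S} div z)"
  proof (intro sum.cong refl)
    fix z assume z: "z \<in> {1..n}"
    have div_eq: "a * z = b \<Longrightarrow> a = b div z" for a b using z by auto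
    show "card {w \<in> S. card (minima w) = z} = n * card {ts. length ts = z \<and> flat ts \<in> S} div z"
      by (rule div_eq, rule card_minima_flat_double_count[OF fin len rot])
  qed
  finally show ?thesis .
qed

subsection \<open>Splitting and interleaving lists\<close>

lemma card_fibers:
  assumes "finite B" "\<And>x. x \<in> A \<Longrightarrow> f x \<in> B" "\<And>y. y \<in> B \<Longrightarrow> finite {x \<in> A. f x = y} \<and> card {x \<in> A. f x = y} = c"
  shows "card A = c * card B"
proof -
  have "card A = card (\<Union>y\<in>B. {x \<in> A. f x = y})" using assms(2) by (intro arg_cong[of _ _ card]) auto
  also have "\<dots> = (\<Sum>y\<in>B. card {x \<in> A. f x = y})" using assms by (intro card_UN_disjoint) auto
  finally show ?thesis using assms by (simp add: mult.commute)
qed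

text \<open>
  The number of ways of cutting a list of length \<open>s\<close> into \<open>k\<close> consecutive, possibly empty parts.
  For \<open>k = 0\<close> truncated subtraction gives the right values \<open>1\<close> at \<open>s = 0\<close> and \<open>0\<close> elsewhere.
\<close>

definition splits :: "nat \<Rightarrow> nat \<Rightarrow> nat" where
  "splits s k = (s + k - 1) choose s"

lemma finite_splits: "finite {us. length us = k \<and> concat us = ts}"
proof (rule finite_subset)
  let ?A = "{u. set u \<subseteq> set ts \<and> length u \<le> length ts}"
  show "finite {us. set us \<subseteq> ?A \<and> length us = k}"
    by (intro finite_lists_length_eq finite_lists_length_le finite_set)
  have "length u \<le> length (concat us)" if "u \<in> set us" for u and us :: "'a list list"
    using that by (induction us) auto
  then show "{us. length us = k \<and> concat us = ts} \<subseteq> {us. set us \<subseteq> ?A \<and> length us = k}"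
    by fastforce
qed

text \<open>The length of the first part can be anything from 0 to the whole length. The resulting
  sum over \<open>splits i k\<close> is the hockey-stick identity.\<close>

lemma card_splits: "card {us. length us = k \<and> concat us = ts} = splits (length ts) k"
proof (induction k arbitrary: ts)
  case 0
  have "{us. length us = 0 \<and> concat us = ts} = (if ts = [] then {[]} else {})" by auto
  then show ?case by (simp add: splits_def)
next
  case (Suc k)
  let ?A = "\<lambda>ts. {us. length us = k \<and> concat us = ts}"
  have "{us. length us = Suc k \<and> concat us = ts} = (\<Union>i\<le>length ts. (#) (take i ts) ` ?A (drop i ts))"
  proof (intro equalityI subsetI)
    fix us assume "us \<in> {us. length us = Suc k \<and> concat us = ts}"
    then show "us \<in> (\<Union>i\<le>length ts. (#) (take i ts) ` ?A (drop i ts))"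
      by (cases us) (auto intro!: bexI[of _ "length (hd us)"])
  qed auto
  also have "card \<dots> = (\<Sum>i\<le>length ts. card ((#) (take i ts) ` ?A (drop i ts)))"
  proof (rule card_UN_disjoint)
    show "\<forall>i\<in>{..length ts}. \<forall>j\<in>{..length ts}. i \<noteq> j \<longrightarrow>
      (#) (take i ts) ` ?A (drop i ts) \<inter> (#) (take j ts) ` ?A (drop j ts) = {}"
    proof (intro ballI impI)
      fix i j assume "i \<in> {..length ts}" "j \<in> {..length ts}" "i \<noteq> j"
      then have "length (take i ts) \<noteq> length (take j ts)" by auto
      then have "take i ts \<noteq> take j ts" by metis
      then show "(#) (take i ts) ` ?A (drop i ts) \<inter> (#) (take j ts) ` ?A (drop j ts) = {}" by auto
    qed
  qed (use finite_splits in auto)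
  also have "\<dots> = (\<Sum>i\<le>length ts. splits (length ts - i) k)"
    by (intro sum.cong refl) (simp add: card_image Suc)
  also have "\<dots> = (\<Sum>i\<le>length ts. splits i k)"
    using sum.nat_diff_reindex[of "\<lambda>i. splits i k" "Suc (length ts)"] by (simp add: lessThan_Suc_atMost)
  also have "\<dots> = splits (length ts) (Suc k)"
  proof (cases k)
    case 0
    have "(\<Sum>i\<le>length ts. splits i 0) = (\<Sum>i\<le>length ts. if i = 0 then 1 else 0)"
      by (intro sum.cong refl) (auto simp: splits_def)
    then show ?thesis by (simp add: 0 splits_def)
  next
    case (Suc k')
    have "(\<Sum>i\<le>length ts. splits i k) = (\<Sum>i\<le>length ts. (k' + i) choose k')"
      by (intro sum.cong refl) (simp add: splits_def Suc binomial_symmetric[of k'] add.commute)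
    also have "\<dots> = (k' + length ts + 1) choose (k' + 1)" by (rule choose_rising_sum)
    also have "\<dots> = (k' + length ts + 1) choose length ts"
      using binomial_symmetric[of "k' + 1" "k' + length ts + 1"] by simp
    also have "\<dots> = splits (length ts) (Suc k)"
      by (simp add: splits_def Suc add.commute del: binomial_Suc_Suc)
    finally show ?thesis .
  qed
  finally show ?case .
qed

lemma card_concat:
  assumes "finite {ts. length ts = s \<and> P ts}"
  shows "card {us. length us = k \<and> length (concat us) = s \<and> P (concat us)} =
           splits s k * card {ts. length ts = s \<and> P ts}"
proof (rule card_fibers[where f = concat])
  fix ts assume "ts \<in> {ts. length ts = s \<and> P ts}"
  then have "{us \<in> {us. length us = k \<and> length (concat us) = s \<and> P (concat us)}. concat us = ts} =
      {us. length us = k \<and> concat us = ts}" "length ts = s" by auto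
  then show "finite {us \<in> {us. length us = k \<and> length (concat us) = s \<and> P (concat us)}. concat us = ts} \<and>
    card {us \<in> {us. length us = k \<and> length (concat us) = s \<and> P (concat us)}. concat us = ts} = splits s k"
    using finite_splits card_splits by metis
qed (use assms in auto)

section \<open>Interleaving of neutral blocks and excursions\<close>

fun neutrals :: "'x blk list \<Rightarrow> 'x list" where
  "neutrals [] = []"
| "neutrals (BN x # bs) = x # neutrals bs"
| "neutrals (BU u # bs) = neutrals bs"

fun inners :: "'x blk list \<Rightarrow> 'x blk list list" where
  "inners [] = []"
| "inners (BN x # bs) = inners bs"
| "inners (BU u # bs) = u # inners bs"

lemma length_neutrals_inners: "length (neutrals bs) + length (inners bs) = length bs"
  by (induction bs rule: neutrals.induct) auto

lemma neutrals_Nil_iff: "neutrals bs = [] \<and> inners bs = vs \<longleftrightarrow> bs = map BU vs"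
proof
  assume "neutrals bs = [] \<and> inners bs = vs"
  then show "bs = map BU vs" by (induction bs arbitrary: vs rule: neutrals.induct) auto
next
  assume "bs = map BU vs"
  moreover have "neutrals (map BU vs) = []" "inners (map BU vs) = vs" by (induction vs) auto
  ultimately show "neutrals bs = [] \<and> inners bs = vs" by simp
qed

lemma inners_Nil_iff: "neutrals bs = us \<and> inners bs = [] \<longleftrightarrow> bs = map BN us"
proof
  assume "neutrals bs = us \<and> inners bs = []"
  then show "bs = map BN us" by (induction bs arbitrary: us rule: neutrals.induct) auto
next
  assume "bs = map BN us"
  moreover have "inners (map BN us) = []" "neutrals (map BN us) = us" by (induction us) auto
  ultimately show "neutrals bs = us \<and> inners bs = []" by simp
qed

text \<open>The first block comes from one list or from the other, which is Pascal's rule.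
  Finiteness is carried along for the cardinality of the disjoint union.\<close>

lemma interleave:
  "finite {bs. neutrals bs = us \<and> inners bs = vs} \<and>
   card {bs. neutrals bs = us \<and> inners bs = vs} = (length us + length vs) choose length us"
proof (induction us arbitrary: vs)
  case Nil
  then show ?case by (simp add: neutrals_Nil_iff)
next
  case (Cons u us)
  note outer = Cons.IH
  show ?case
  proof (induction vs)
    case Nil
    then show ?case unfolding inners_Nil_iff by simp
  next
    case (Cons v vs)
    have "{bs. neutrals bs = u # us \<and> inners bs = v # vs} =
       (#) (BN u) ` {bs. neutrals bs = us \<and> inners bs = v # vs} \<union>
       (#) (BU v) ` {bs. neutrals bs = u # us \<and> inners bs = vs}" (is "?L = ?R")
    proof (intro equalityI subsetI)
      fix bs assume "bs \<in> ?L"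
      then show "bs \<in> ?R" by (cases bs rule: neutrals.cases) auto
    qed auto
    moreover have "card ?R = card {bs. neutrals bs = us \<and> inners bs = v # vs} +
        card {bs. neutrals bs = u # us \<and> inners bs = vs}"
      using Cons outer[of "v # vs"] by (subst card_Un_disjoint) (auto simp: card_image)
    ultimately show ?case using Cons outer[of "v # vs"] by simp
  qed
qed

subsection \<open>Counting trivial words\<close>

lemma UNIV_bool_step: "(UNIV :: bool step set) = {Neu True, Neu False, Upp, Dwn}"
proof -
  have "x \<in> {Neu True, Neu False, Upp, Dwn}" for x :: "bool step"
    by (cases x) (metis (full_types) insertCI, auto)
  then show ?thesis by auto
qed

lemma finite_UNIV_bool_step: "finite (UNIV :: bool step set)"
  by (simp add: UNIV_bool_step)

lemma card_UNIV_bool_step: "card (UNIV :: bool step set) = 4"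
  by (simp add: UNIV_bool_step)

lemma finite_words: "finite {w :: bool step list. length w = n}"
  using finite_lists_length_eq[OF finite_UNIV_bool_step, of n] by simp

lemma card_words: "card {w :: bool step list. length w = n} = 4 ^ n"
  using card_lists_length_eq[OF finite_UNIV_bool_step, of n] by (simp add: card_UNIV_bool_step)

definition wt :: "bool blk list \<Rightarrow> nat" where
  "wt ts = length (flat ts)"

lemma wt_simps [simp]:
  "wt [] = 0" "wt (BN b # ts) = Suc (wt ts)" "wt (BU u # ts) = wt u + wt ts + 2"
  "wt (us @ vs) = wt us + wt vs"
  by (auto simp: wt_def flat_append)

lemma length_le_wt: "length ts \<le> wt ts"
  by (induction ts rule: flat.induct) auto

definition nonneg_words :: "nat \<Rightarrow> nat \<Rightarrow> bool blk list set" where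
  "nonneg_words n s = {ts. length ts = s \<and> wt ts = n \<and> trivial_nonneg ts}"

lemma finite_wt: "finite {ts. wt ts = n}"
  using finite_vimageI[OF finite_words[of n] inj_flat] by (simp add: wt_def vimage_def)

lemma finite_nonneg_words: "finite (nonneg_words n s)"
  by (rule finite_subset[OF _ finite_wt[of n]]) (auto simp: nonneg_words_def)

lemma card_nonneg_words_le: "card (nonneg_words n s) \<le> 4 ^ n"
proof -
  have "card (flat ` nonneg_words n s) \<le> card {w :: bool step list. length w = n}"
    by (rule card_mono[OF finite_words]) (auto simp: nonneg_words_def wt_def)
  then show ?thesis by (simp add: card_words card_image[OF inj_on_subset[OF inj_flat]])
qed

lemma nonneg_words_empty: "n < s \<Longrightarrow> nonneg_words n s = {}"
  by (auto simp: nonneg_words_def) (metis length_le_wt linorder_not_le)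

lemma trivial_Nil [simp]: "trivial_nonneg []"
  by (simp add: trivial_nonneg_def trivial_word_def wval_simps)

lemma nonneg_words_0: "nonneg_words n 0 = (if n = 0 then {[]} else {})"
  by (auto simp: nonneg_words_def)

lemma bij_step_letter: "bij step_letter"
proof (rule bijI)
  show "inj step_letter"
  proof (rule injI)
    fix x y :: "bool step" assume "step_letter x = step_letter y"
    then show "x = y" by (cases x; cases y) (auto split: if_splits)
  qed
  have "x \<in> range step_letter" for x
    using rangeI[of step_letter "Neu True"] rangeI[of step_letter "Neu False"]
      rangeI[of step_letter Upp] rangeI[of step_letter Dwn] by (cases x) auto
  then show "surj step_letter" by blast
qed

lemma cogrowth_eq: "fps_nth cogrowth_series n = card {w. length w = n \<and> trivial_word w}"
proof -
  have "bij_betw (map step_letter) {w. length w = n \<and> trivial_word w}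
     {w. length w = n \<and> word_value w = \<one>\<^bsub>navas_brin\<^esub>}"
  proof (rule bij_betw_imageI)
    show "inj_on (map step_letter) {w. length w = n \<and> trivial_word w}"
      using bij_step_letter by (auto simp: bij_def intro: inj_on_subset)
    show "map step_letter ` {w. length w = n \<and> trivial_word w} =
        {w. length w = n \<and> word_value w = \<one>\<^bsub>navas_brin\<^esub>}"
    proof (intro equalityI subsetI)
      fix w assume w: "w \<in> {w. length w = n \<and> word_value w = \<one>\<^bsub>navas_brin\<^esub>}"
      have "w = map step_letter (map (inv_into UNIV step_letter) w)"
        using bij_step_letter by (simp add: map_idI bij_def surj_f_inv_f)
      then obtain v where "w = map step_letter v" by blast
      then show "w \<in> map step_letter ` {w. length w = n \<and> trivial_word w}"
        using w by (simp add: trivial_word_def wval_def)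
    qed (auto simp: trivial_word_def wval_def)
  qed
  then show ?thesis by (simp add: cogrowth_series_def bij_betw_same_card)
qed

lemma rotate1_split: "w \<noteq> [] \<Longrightarrow> \<exists>u v. w = u @ v \<and> rotate1 w = v @ u"
  by (cases w) (auto intro: exI[of _ "[hd w]"])

text \<open>Double counting for the exponent of \<open>t\<close>. The divisibility is recorded
  separately, because the final formula carries out the division by \<open>s\<close> in a different
  order.\<close>

lemma cogrowth_nonneg_words:
  assumes "n > 0"
  shows "fps_nth cogrowth_series n = (\<Sum>s = 1..n. n * card (nonneg_words n s) div s)"
    and "s dvd n * card (nonneg_words n s)"
proof -
  let ?S = "{w. length w = n \<and> trivial_word w}"
  have fin: "finite ?S" using finite_words[of n] by simp
  have rot: "rotate1 w \<in> ?S" if "w \<in> ?S" for w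
    using that rotate1_split[of w] assms trivial_word_commute by (cases "w = []") auto
  have eq: "{ts. length ts = s \<and> flat ts \<in> ?S} = nonneg_words n s" for s
    by (auto simp: nonneg_words_def trivial_nonneg_def wt_def)
  have "card ?S = (\<Sum>s = 1..n. n * card {ts. length ts = s \<and> flat ts \<in> ?S} div s)"
    by (rule card_rotation_invariant[OF fin _ assms rot]) (auto simp: trivial_word_height)
  then show "fps_nth cogrowth_series n = (\<Sum>s = 1..n. n * card (nonneg_words n s) div s)"
    unfolding eq cogrowth_eq .
  show "s dvd n * card (nonneg_words n s)"
  proof -
    have dvd: "a * s = b \<Longrightarrow> s dvd b" for a b by auto
    have len: "length w = n" if "w \<in> ?S" for w using that by simp
    show ?thesis
      unfolding eq[symmetric] by (rule dvd, rule card_minima_flat_double_count[OF fin len rot])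
  qed
qed

text \<open>
  A nonnegative word as a path for the exponent of the lowest generator: the blocks above
  the lowest level are neutral.
\<close>

fun blk_step :: "bool blk \<Rightarrow> bool blk list step" where
  "blk_step (BN b) = (if b then Upp else Dwn)"
| "blk_step (BU u) = Neu u"

fun step_blk :: "bool blk list step \<Rightarrow> bool blk" where
  "step_blk (Neu u) = BU u"
| "step_blk Upp = BN True"
| "step_blk Dwn = BN False"

lemma blk_step_inverse [simp]: "step_blk (blk_step b) = b" "blk_step (step_blk s) = s"
  by (cases b rule: blk_step.cases, auto) (cases s, auto)

abbreviation unsteps :: "bool blk list step list \<Rightarrow> bool blk list" where
  "unsteps w \<equiv> map step_blk w"

lemma inj_unsteps: "inj (map step_blk)"
  by (rule inj_mapI) (metis blk_step_inverse(2) injI)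

lemma net_unsteps [simp]: "net (unsteps w) = height w"
proof (induction w)
  case (Cons s w)
  then show ?case by (cases s) (auto simp: sgn_int_def)
qed auto

lemma contents_append: "contents m (us @ vs) = contents m us @ contents (m - net us) vs"
  by (induction m us rule: contents.induct) (auto simp: algebra_simps)

lemma contents_flat_neg: "m < 0 \<Longrightarrow> contents m (unsteps (flat bs)) = []"
  by (induction bs arbitrary: m rule: flat.induct)
    (auto simp: sgn_int_def contents_append )

lemma contents_flat_0: "contents 0 (unsteps (flat bs)) = concat (neutrals bs)"
  by (induction bs rule: neutrals.induct)
    (auto simp: sgn_int_def contents_append contents_flat_neg)

text \<open>What is read above height 0 lies in the excursions, each of which begins and ends at
  height 1. Joining their interiors and lowering them by 1 keeps the order in which each height is
  visited.\<close>

lemma contents_flat_pos: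
  "m \<ge> 0 \<Longrightarrow> contents (m + 1) (unsteps (flat bs)) = contents m (unsteps (flat (concat (inners bs))))"
  by (induction bs rule: neutrals.induct)
    (auto simp: sgn_int_def contents_append flat_append)

definition trivial_onesided :: "bool blk list blk list \<Rightarrow> bool" where
  "trivial_onesided bs \<longleftrightarrow> trivial_nonneg (unsteps (flat bs))"

text \<open>The condition at exponent 0 concerns the neutral blocks alone, and the conditions at
  positive exponents have the original form for the joined excursions. Hence the recursion closes
  up.\<close>

lemma trivial_onesided_iff:
  "trivial_onesided bs \<longleftrightarrow> trivial_nonneg (concat (neutrals bs)) \<and> trivial_onesided (concat (inners bs))"
proof -
  have *: "trivial_onesided bs' \<longleftrightarrow> (\<forall>m\<ge>0. trivial_nonneg (contents m (unsteps (flat bs'))))" for bs'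
    unfolding trivial_onesided_def trivial_nonneg_iff[of "unsteps (flat bs')"]
    using contents_flat_neg[of _ bs'] by (auto, metis linorder_not_le trivial_Nil)
  have split: "(\<forall>m\<ge>0. P m) \<longleftrightarrow> P 0 \<and> (\<forall>m\<ge>0. P (m + 1))" for P :: "int \<Rightarrow> bool"
  proof (intro iffI conjI allI impI)
    fix m :: int assume "P 0 \<and> (\<forall>m\<ge>0. P (m + 1))" "m \<ge> 0"
    then show "P m" by (cases "m = 0") (auto dest: spec[of _ "m - 1"])
  qed auto
  show ?thesis unfolding *[of bs] *[of "concat (inners bs)"] split[of "\<lambda>m. trivial_nonneg (contents m (unsteps (flat bs)))"]
    by (simp add: contents_flat_0 contents_flat_pos)
qed

definition swt :: "bool blk list blk list \<Rightarrow> nat" where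
  "swt bs = wt (unsteps (flat bs))"

definition onesided_words :: "nat \<Rightarrow> nat \<Rightarrow> nat \<Rightarrow> bool blk list blk list set" where
  "onesided_words n s z =
     {bs. length bs = z \<and> length (flat bs) = s \<and> swt bs = n \<and> trivial_onesided bs}"

lemma onesided_words_sub: "(unsteps \<circ> flat) ` onesided_words n s z \<subseteq> nonneg_words n s"
  by (auto simp: onesided_words_def nonneg_words_def swt_def trivial_onesided_def)

lemma inj_unsteps_flat: "inj (unsteps \<circ> flat)"
  using inj_compose[OF inj_unsteps inj_flat] .

lemma finite_onesided_words: "finite (onesided_words n s z)"
  using finite_subset[OF onesided_words_sub finite_nonneg_words] inj_unsteps_flat
  by (metis finite_imageD inj_on_subset subset_UNIV)

lemma card_onesided_words_le: "card (onesided_words n s z) \<le> 4 ^ n"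
proof -
  have "card (onesided_words n s z) = card ((unsteps \<circ> flat) ` onesided_words n s z)"
    using inj_unsteps_flat by (metis card_image inj_on_subset subset_UNIV)
  also have "\<dots> \<le> card (nonneg_words n s)"
    by (rule card_mono[OF finite_nonneg_words onesided_words_sub])
  finally show ?thesis using card_nonneg_words_le[of n s] by simp
qed

lemma length_le_length_flat: "length bs \<le> length (flat bs)"
  by (induction bs rule: flat.induct) auto

lemma onesided_words_empty: "s < z \<or> n < s \<Longrightarrow> onesided_words n s z = {}"
  using onesided_words_sub[of n s z] nonneg_words_empty[of n s]
  by (auto simp: onesided_words_def) (metis length_le_length_flat linorder_not_le)

lemma onesided_words_0: "onesided_words n s 0 = (if n = 0 \<and> s = 0 then {[]} else {})"
  by (auto simp: onesided_words_def swt_def trivial_onesided_def)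

text \<open>The same double count, now for the exponent of \<open>a\<close>. The case
  \<open>s = 0\<close> is excluded because the empty path has no minimum.\<close>

lemma nonneg_words_onesided_words:
  assumes "s > 0"
  shows "card (nonneg_words n s) = (\<Sum>z = 1..s. s * card (onesided_words n s z) div z)"
proof -
  let ?S = "{w. length w = s \<and> wt (unsteps w) = n \<and> trivial_nonneg (unsteps w)}"
  have bij: "bij_betw (map step_blk) ?S (nonneg_words n s)"
    by (rule bij_betwI[where g = "map blk_step"]) (auto simp: nonneg_words_def map_idI comp_def)
  have "card ?S = (\<Sum>z = 1..s. s * card {bs. length bs = z \<and> flat bs \<in> ?S} div z)"
  proof (rule card_rotation_invariant)
    show "finite ?S" using bij finite_nonneg_words by (simp add: bij_betw_finite)
    show "rotate1 w \<in> ?S" if "w \<in> ?S" for w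
    proof -
      obtain u v where "w = u @ v" "rotate1 w = v @ u" using rotate1_split[of w] that assms by (cases "w = []") auto
      then show ?thesis using that trivial_nonneg_commute[of "unsteps u" "unsteps v"] by auto
    qed
    show "height w = 0" if "w \<in> ?S" for w
      using that trivial_nonneg_iff[of "unsteps w"] by auto
  qed (auto simp: assms)
  moreover have "{bs. length bs = z \<and> flat bs \<in> ?S} = onesided_words n s z" for z
    by (auto simp: onesided_words_def swt_def trivial_onesided_def)
  ultimately show ?thesis using bij_betw_same_card[OF bij] by simp
qed

section \<open>The recursion for the number of one-sided words\<close>

lemma length_flat_eq:
  "length (flat bs) = length (neutrals bs) + 2 * length (inners bs) + length (flat (concat (inners bs)))"
  by (induction bs rule: neutrals.induct) (auto simp: flat_append)

text \<open>Every block costs two letters: a neutral block is conjugated by \<open>t\<close>, and an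
  excursion is enclosed by \<open>a\<close> and its inverse. This is the decrease on which the
  recursion rests.\<close>

lemma swt_eq: "swt bs = 2 * length bs + wt (concat (neutrals bs)) + swt (concat (inners bs))"
  by (induction bs rule: neutrals.induct) (auto simp: flat_append swt_def)

text \<open>Only the concatenation is constrained, so a list of \<open>e\<close> words amounts to
  one trivial word and a way of cutting it between syllables.\<close>

lemma card_concat_nonneg_words:
  "card {us. length us = e \<and> wt (concat us) = n \<and> trivial_nonneg (concat us)} =
     (\<Sum>s\<le>n. splits s e * card (nonneg_words n s))"
proof -
  let ?U = "\<lambda>s. {us. length us = e \<and> length (concat us) = s \<and> wt (concat us) = n \<and> trivial_nonneg (concat us)}"
  have fin: "finite {ts. length ts = s \<and> wt ts = n \<and> trivial_nonneg ts}" for s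
    using finite_nonneg_words[of n s] by (simp add: nonneg_words_def)
  have finU: "finite (?U s)" for s
  proof (rule finite_subset)
    show "?U s \<subseteq> (\<Union>ts\<in>nonneg_words n s. {us. length us = e \<and> concat us = ts})"
      by (auto simp: nonneg_words_def)
  qed (use finite_splits finite_nonneg_words in auto)
  have "{us. length us = e \<and> wt (concat us) = n \<and> trivial_nonneg (concat us)} = (\<Union>s\<le>n. ?U s)"
    by (auto simp del: length_concat intro: length_le_wt)
  also have "card \<dots> = (\<Sum>s\<le>n. card (?U s))"
    using finU by (intro card_UN_disjoint) auto
  also have "\<dots> = (\<Sum>s\<le>n. splits s e * card (nonneg_words n s))"
    using card_concat[OF fin] by (simp add: nonneg_words_def)
  finally show ?thesis .
qed

lemma card_concat_onesided_words:
  "card {vs. length vs = j \<and> length (flat (concat vs)) = s \<and> swt (concat vs) = n \<and> trivial_onesided (concat vs)} =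
     (\<Sum>z\<le>s. splits z j * card (onesided_words n s z))"
proof -
  let ?V = "\<lambda>z. {vs. length vs = j \<and> length (concat vs) = z \<and> length (flat (concat vs)) = s
      \<and> swt (concat vs) = n \<and> trivial_onesided (concat vs)}"
  have fin: "finite {bs. length bs = z \<and> length (flat bs) = s \<and> swt bs = n \<and> trivial_onesided bs}" for z
    using finite_onesided_words[of n s z] by (simp add: onesided_words_def)
  have finV: "finite (?V z)" for z
  proof (rule finite_subset)
    show "?V z \<subseteq> (\<Union>bs\<in>onesided_words n s z. {vs. length vs = j \<and> concat vs = bs})"
      by (auto simp: onesided_words_def)
  qed (use finite_splits finite_onesided_words in auto)
  have "{vs. length vs = j \<and> length (flat (concat vs)) = s \<and> swt (concat vs) = n \<and> trivial_onesided (concat vs)}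
      = (\<Union>z\<le>s. ?V z)"
    by (auto simp del: length_concat intro: length_le_length_flat)
  also have "card \<dots> = (\<Sum>z\<le>s. card (?V z))"
    using finV by (intro card_UN_disjoint) auto
  also have "\<dots> = (\<Sum>z\<le>s. splits z j * card (onesided_words n s z))"
    using card_concat[OF fin] by (simp add: onesided_words_def)
  finally show ?thesis .
qed

text \<open>For a fixed number \<open>e\<close> of neutral blocks and a fixed weight
  \<open>n'\<close> in them, the pairs of both lists form a product set, and each pair arises from
  \<open>z choose e\<close> interleavings.\<close>

lemma card_onesided_words:
  "card (onesided_words n s z) =
     (\<Sum>e\<le>z. \<Sum>n'\<le>n. if n' + 2 * z \<le> n \<and> e + 2 * (z - e) \<le> s then
        (z choose e) * ((\<Sum>s'\<le>n'. splits s' e * card (nonneg_words n' s')) *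
        (\<Sum>z'\<le>s - (e + 2 * (z - e)). splits z' (z - e) *
           card (onesided_words (n - (n' + 2 * z)) (s - (e + 2 * (z - e))) z'))) else 0)"
proof -
  let ?P = "\<lambda>e n'. {bs \<in> onesided_words n s z. length (neutrals bs) = e \<and> wt (concat (neutrals bs)) = n'}"
  let ?F = "\<lambda>e n'. {us. length us = e \<and> wt (concat us) = n' \<and> trivial_nonneg (concat us)}"
  let ?G = "\<lambda>j s n. {vs. length vs = j \<and> length (flat (concat vs)) = s \<and> swt (concat vs) = n \<and> trivial_onesided (concat vs)}"
  have fin: "finite (?P e n')" for e n' using finite_onesided_words by simp
  have "onesided_words n s z = (\<Union>e\<le>z. \<Union>n'\<le>n. ?P e n')"
  proof (intro equalityI subsetI)
    fix bs assume bs: "bs \<in> onesided_words n s z"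
    then have "length (neutrals bs) \<le> z" "wt (concat (neutrals bs)) \<le> n"
      using length_neutrals_inners[of bs] swt_eq[of bs] by (auto simp: onesided_words_def)
    then show "bs \<in> (\<Union>e\<le>z. \<Union>n'\<le>n. ?P e n')" using bs by auto
  qed auto
  also have "card \<dots> = (\<Sum>e\<le>z. card (\<Union>n'\<le>n. ?P e n'))"
    using fin by (intro card_UN_disjoint) auto
  also have "\<dots> = (\<Sum>e\<le>z. \<Sum>n'\<le>n. card (?P e n'))"
    using fin by (intro sum.cong refl card_UN_disjoint) auto
  also have "card (?P e n') = (if n' + 2 * z \<le> n \<and> e + 2 * (z - e) \<le> s then
        (z choose e) * (card (?F e n') * card (?G (z - e) (s - (e + 2 * (z - e))) (n - (n' + 2 * z)))) else 0)"
      (is "_ = (if ?c then _ else 0)") if "e \<le> z" for e n'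
  proof (cases ?c)
    \<comment> \<open>The condition \<open>?c\<close> says that the remaining lengths are not
      truncated differences. If it fails, no path has these parameters.\<close>
    case False
    have "bs \<notin> ?P e n'" for bs
      using False length_neutrals_inners[of bs] swt_eq[of bs] length_flat_eq[of bs] that
      by (auto simp: onesided_words_def)
    then have "?P e n' = {}" by blast
    then show ?thesis using False by (simp only: card.empty if_False)
  next
    case True
    let ?B = "?F e n' \<times> ?G (z - e) (s - (e + 2 * (z - e))) (n - (n' + 2 * z))"
    have iff: "neutrals bs = us \<and> inners bs = vs \<and> bs \<in> ?P e n' \<longleftrightarrow>
        neutrals bs = us \<and> inners bs = vs \<and> (us, vs) \<in> ?B" for bs us vs
      using True that length_neutrals_inners[of bs] swt_eq[of bs] length_flat_eq[of bs] trivial_onesided_iff[of bs]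
      by (auto simp: onesided_words_def)
    \<comment> \<open>Every pair in \<open>?B\<close> has some interleaving, as the binomial
      coefficient is positive; so \<open>?B\<close> is an image of part of a finite set.\<close>
    have finB: "finite ?B"
    proof (rule finite_subset)
      show "?B \<subseteq> (\<lambda>bs. (neutrals bs, inners bs)) ` ?P e n'"
      proof
        fix p assume p: "p \<in> ?B"
        obtain us vs where [simp]: "p = (us, vs)" by (metis surj_pair)
        have "{bs. neutrals bs = us \<and> inners bs = vs} \<noteq> {}"
          using interleave[of us vs] by (metis binomial_eq_0_iff card.empty le_add1 linorder_not_le)
        then show "p \<in> (\<lambda>bs. (neutrals bs, inners bs)) ` ?P e n'" using iff[of _ us vs] p by fastforce
      qed
    qed (use fin in auto)
    have "card (?P e n') = (z choose e) * card ?B"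
    proof (rule card_fibers[OF finB, where f = "\<lambda>bs. (neutrals bs, inners bs)"])
      fix bs assume "bs \<in> ?P e n'"
      then show "(neutrals bs, inners bs) \<in> ?B" using iff[of bs] by blast
    next
      fix p assume p: "p \<in> ?B"
      obtain us vs where uv: "p = (us, vs)" by (metis surj_pair)
      have "length us = e" "length us + length vs = z" using p that by (auto simp: uv)
      moreover have "{bs \<in> ?P e n'. (neutrals bs, inners bs) = p} = {bs. neutrals bs = us \<and> inners bs = vs}"
        using iff[of _ us vs] p unfolding uv by blast
      ultimately show "finite {bs \<in> ?P e n'. (neutrals bs, inners bs) = p} \<and>
          card {bs \<in> ?P e n'. (neutrals bs, inners bs) = p} = (z choose e)"
        using interleave[of us vs] by simp
    qed
    then show ?thesis using True by (simp only: card_cartesian_product simp_thms if_True)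
  qed
  ultimately show ?thesis
    unfolding card_concat_nonneg_words card_concat_onesided_words by simp
qed

subsection \<open>The recursion with uniform ranges\<close>

definition q :: "nat \<Rightarrow> nat \<Rightarrow> nat \<Rightarrow> nat" where
  "q l s z = card (onesided_words l s z)"

text \<open>
  The contribution of \<open>x = q l s z\<close> to the number of nonnegative words with \<open>s\<close> syllables. The
  second term accounts for the empty word; \<open>z = 0\<close> contributes \<open>0\<close> to the first one.
\<close>

definition nu :: "nat \<Rightarrow> nat \<Rightarrow> nat \<Rightarrow> nat" where
  "nu s z x = s * x div z + (1 - s) * x"

lemma sum_extend:
  fixes f :: "nat \<Rightarrow> nat"
  assumes "b < B" "\<And>i. b < i \<Longrightarrow> i < B \<Longrightarrow> f i = 0"
  shows "(\<Sum>i\<le>b. f i) = (\<Sum>i<B. f i)"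
  using assms by (intro sum.mono_neutral_left) auto

lemma sum_nu:
  assumes "s < B"
  shows "(\<Sum>z<B. nu s z (q l s z)) = card (nonneg_words l s)"
proof (cases "s = 0")
  case True
  have "(\<Sum>z<B. nu s z (q l s z)) = (\<Sum>z<B. if z = 0 then q l 0 0 else 0)"
    using True by (intro sum.cong refl) (auto simp: nu_def q_def onesided_words_empty)
  also have "\<dots> = card (nonneg_words l s)"
    using assms True by (simp add: q_def onesided_words_0 nonneg_words_0)
  finally show ?thesis .
next
  case False
  have "(\<Sum>z<B. nu s z (q l s z)) = (\<Sum>z<B. s * card (onesided_words l s z) div z)"
    using False by (intro sum.cong refl) (simp add: nu_def q_def)
  also have "\<dots> = (\<Sum>z = 1..s. s * card (onesided_words l s z) div z)"
    using assms by (intro sum.mono_neutral_right) (auto simp: onesided_words_empty not_le Suc_le_eq)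
  finally show ?thesis using False by (simp add: nonneg_words_onesided_words)
qed

text \<open>The guard \<open>1 \<le> z\<close> prevents a circle: for \<open>z = 0\<close> the
  right-hand side would contain \<open>q l s 0\<close> itself. Under the guard
  \<open>e + (z - e)\<close> is \<open>z\<close>, in the form that \<open>choose_expr\<close>
  evaluates.\<close>

definition summand :: "(nat \<Rightarrow> nat \<Rightarrow> nat \<Rightarrow> nat) \<Rightarrow> nat \<Rightarrow> nat \<Rightarrow> nat \<Rightarrow> nat \<Rightarrow> nat \<Rightarrow> nat \<Rightarrow> nat \<Rightarrow> nat \<Rightarrow> nat" where
  "summand t l s z e n' s' y z' =
     (if 1 \<le> z \<and> e \<le> z \<and> n' + 2 * z \<le> l \<and> e + 2 * (z - e) \<le> s then
        ((e + (z - e)) choose e) * (splits s' e * nu s' y (t n' s' y) *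
          (splits z' (z - e) * t (l - (n' + 2 * z)) (s - (e + 2 * (z - e))) z')) else 0)"

text \<open>The counts vanish outside their natural ranges, so one bound \<open>B\<close> serves all
  sums. The numbers of nonnegative words are expanded by \<open>sum_nu\<close> into a sum over
  \<open>y\<close>, which leaves \<open>q\<close> as the only function to be tabulated.\<close>

lemma q_recursion:
  assumes "l < B" "s < B" "z < B"
  shows "(if l = 0 \<and> s = 0 \<and> z = 0 then 1 else 0) +
     (\<Sum>e<B. \<Sum>n'<B. \<Sum>s'<B. \<Sum>y<B. \<Sum>z'<B. summand q l s z e n' s' y z') = q l s z"
proof (cases "z = 0")
  case True
  then show ?thesis by (simp add: summand_def q_def onesided_words_0)
next
  case False
  let ?c = "\<lambda>e n'. n' + 2 * z \<le> l \<and> e + 2 * (z - e) \<le> s"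
  let ?N = "\<lambda>e n'. \<Sum>s'\<le>n'. splits s' e * card (nonneg_words n' s')"
  let ?Q = "\<lambda>e n'. \<Sum>z'\<le>s - (e + 2 * (z - e)). splits z' (z - e) *
           card (onesided_words (l - (n' + 2 * z)) (s - (e + 2 * (z - e))) z')"
  have N: "?N e n' = (\<Sum>s'<B. \<Sum>y<B. splits s' e * nu s' y (q n' s' y))" if "n' < B" for e n'
  proof -
    have "?N e n' = (\<Sum>s'<B. splits s' e * card (nonneg_words n' s'))"
      using that by (intro sum_extend) (auto simp: nonneg_words_empty)
    also have "\<dots> = (\<Sum>s'<B. \<Sum>y<B. splits s' e * nu s' y (q n' s' y))"
      by (intro sum.cong refl) (simp add: sum_nu flip: sum_distrib_left)
    finally show ?thesis .
  qed
  have Q: "?Q e n' = (\<Sum>z'<B. splits z' (z - e) * q (l - (n' + 2 * z)) (s - (e + 2 * (z - e))) z')" for e n'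
    unfolding q_def using assms by (intro sum_extend) (auto simp: onesided_words_empty)
  have "q l s z = (\<Sum>e\<le>z. \<Sum>n'\<le>l. if ?c e n' then (z choose e) * (?N e n' * ?Q e n') else 0)"
    unfolding q_def by (rule card_onesided_words)
  also have "\<dots> = (\<Sum>e\<le>z. \<Sum>n'<B. if ?c e n' then (z choose e) * (?N e n' * ?Q e n') else 0)"
    using assms by (intro sum.cong refl sum_extend) auto
  also have "\<dots> = (\<Sum>e<B. \<Sum>n'<B. if e \<le> z \<and> ?c e n' then (z choose e) * (?N e n' * ?Q e n') else 0)"
    using assms by (subst sum_extend[of z B "\<lambda>e. \<Sum>n'<B. if e \<le> z \<and> ?c e n' then (z choose e) * (?N e n' * ?Q e n') else 0", symmetric]) auto
  also have "\<dots> = (\<Sum>e<B. \<Sum>n'<B. \<Sum>s'<B. \<Sum>y<B. \<Sum>z'<B. summand q l s z e n' s' y z')"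
  proof (intro sum.cong refl)
    fix e n' assume "e \<in> {..<B}" "n' \<in> {..<B}"
    then show "(if e \<le> z \<and> ?c e n' then (z choose e) * (?N e n' * ?Q e n') else 0) =
        (\<Sum>s'<B. \<Sum>y<B. \<Sum>z'<B. summand q l s z e n' s' y z')"
    proof (cases "e \<le> z \<and> ?c e n'")
      case True
      have "?N e n' * ?Q e n' = (\<Sum>s'<B. \<Sum>y<B. \<Sum>z'<B. splits s' e * nu s' y (q n' s' y) *
          (splits z' (z - e) * q (l - (n' + 2 * z)) (s - (e + 2 * (z - e))) z'))"
        unfolding N[OF \<open>n' \<in> {..<B}\<close>[unfolded lessThan_iff]] Q sum_distrib_right
        by (simp only: sum_distrib_left)
      then show ?thesis using True False by (simp add: summand_def sum_distrib_left Suc_le_eq)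
    qed (auto simp: summand_def)
  qed
  finally show ?thesis using False by simp
qed

text \<open>Divisibility by \<open>s\<close> is available for the sum over \<open>z\<close>, not for
  its terms. The weight \<open>fact n div s\<close> is integral for positive
  \<open>s \<le> n\<close> and postpones the division; at \<open>s = 0\<close> it is 0.\<close>

lemma sum_nu_fact:
  assumes "0 < k" "k \<le> n"
  shows "(\<Sum>s<Suc n. \<Sum>z<Suc n. k * nu s z (q k s z) * (fact n div s)) = fps_nth cogrowth_series k * fact n"
proof -
  have "(\<Sum>s<Suc n. \<Sum>z<Suc n. k * nu s z (q k s z) * (fact n div s)) =
     (\<Sum>s<Suc n. k * card (nonneg_words k s) * (fact n div s))"
    by (intro sum.cong refl)
      (simp add: sum_nu del: sum.lessThan_Suc flip: sum_distrib_left sum_distrib_right)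
  also have "\<dots> = (\<Sum>s = 1..k. k * card (nonneg_words k s) * (fact n div s))"
    using assms by (intro sum.mono_neutral_right) (auto simp: nonneg_words_empty not_le Suc_le_eq)
  also have "\<dots> = (\<Sum>s = 1..k. (k * card (nonneg_words k s) div s) * fact n)"
  proof (intro sum.cong refl)
    fix s assume s: "s \<in> {1..k}"
    have "s dvd k * card (nonneg_words k s)" using assms by (intro cogrowth_nonneg_words) auto
    moreover have "s dvd fact n" using s assms by (intro dvd_fact) auto
    ultimately show "k * card (nonneg_words k s) * (fact n div s) = (k * card (nonneg_words k s) div s) * fact n"
      by (simp add: div_mult_swap dvd_div_mult)
  qed
  also have "\<dots> = fps_nth cogrowth_series k * fact n"
    using cogrowth_nonneg_words(1)[of k] assms by (simp add: sum_distrib_right)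
  finally show ?thesis .
qed

text \<open>For \<open>k = 0\<close> the sum vanishes, and \<open>1 - k\<close> supplies the empty
  word.\<close>

lemma cogrowth_q:
  assumes "k \<le> n"
  shows "(\<Sum>s<Suc n. \<Sum>z<Suc n. k * nu s z (q k s z) * (fact n div s)) div fact n + (1 - k)
     = fps_nth cogrowth_series k"
proof (cases "k = 0")
  case True
  have "{w. length w = 0 \<and> trivial_word w} = {[]}"
    by (auto simp: trivial_word_def wval_simps)
  then show ?thesis using True by (simp add: cogrowth_eq)
qed (use sum_nu_fact[OF _ assms] in simp)

lemma cogrowth_q_le:
  assumes "k \<le> n"
  shows "(\<Sum>s<Suc n. \<Sum>z<Suc n. k * nu s z (q k s z) * (fact n div s)) \<le> 4 ^ n * fact n"
proof (cases "k = 0")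
  case False
  have "card {w. length w = k \<and> trivial_word w} \<le> card {w :: bool step list. length w = k}"
    by (rule card_mono[OF finite_words]) auto
  also have "\<dots> \<le> 4 ^ n" using assms by (simp add: card_words power_increasing)
  finally show ?thesis using False assms by (subst sum_nu_fact) (auto simp: cogrowth_eq)
qed simp

section \<open>Multi-indices as digit strings\<close>

lemma sum_digits:
  fixes f :: "nat \<Rightarrow> nat \<Rightarrow> nat"
  assumes "0 < B"
  shows "(\<Sum>j<B * M. f (j mod B) (j div B)) = (\<Sum>x<B. \<Sum>y<M. f x y)"
proof -
  have "(\<Sum>j<B * M. f (j mod B) (j div B)) = (\<Sum>(x, y)\<in>{..<B} \<times> {..<M}. f x y)"
  proof (rule sum.reindex_bij_witness[where j = "\<lambda>j. (j mod B, j div B)" and i = "\<lambda>(x, y). x + B * y"])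
    fix p assume p: "p \<in> {..<B} \<times> {..<M}"
    then show "(case p of (x, y) \<Rightarrow> x + B * y) \<in> {..<B * M}"
    proof (cases p)
      case (Pair x y)
      then have "x + B * y < B * Suc y" "Suc y \<le> M" using p by auto
      then show ?thesis using Pair mult_le_mono2[of "Suc y" M B] by simp
    qed
  qed (use assms in \<open>auto simp: less_mult_imp_div_less mult.commute\<close>)
  then show ?thesis by (simp add: sum.cartesian_product)
qed

lemma sum_digits5:
  fixes f :: "nat \<Rightarrow> nat \<Rightarrow> nat \<Rightarrow> nat \<Rightarrow> nat \<Rightarrow> nat"
  assumes B: "0 < B"
  shows "(\<Sum>j<B ^ 5. f (j mod B) (j div B mod B) (j div B div B mod B) (j div B div B div B mod B)
      (j div B div B div B div B)) = (\<Sum>x<B. \<Sum>y<B. \<Sum>z<B. \<Sum>u<B. \<Sum>v<B. f x y z u v)"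
proof -
  have 2: "(\<Sum>j<B * B. g (j mod B) (j div B)) = (\<Sum>u<B. \<Sum>v<B. g u v)" for g :: "nat \<Rightarrow> nat \<Rightarrow> nat"
    by (rule sum_digits[OF B])
  have 3: "(\<Sum>j<B * (B * B). g (j mod B) (j div B mod B) (j div B div B)) = (\<Sum>z<B. \<Sum>u<B. \<Sum>v<B. g z u v)"
    for g :: "nat \<Rightarrow> nat \<Rightarrow> nat \<Rightarrow> nat"
    using sum_digits[OF B, of "\<lambda>x y. g x (y mod B) (y div B)" "B * B"] unfolding 2[of "g x" for x] .
  have 4: "(\<Sum>j<B * (B * (B * B)). g (j mod B) (j div B mod B) (j div B div B mod B) (j div B div B div B)) =
      (\<Sum>y<B. \<Sum>z<B. \<Sum>u<B. \<Sum>v<B. g y z u v)" for g :: "nat \<Rightarrow> nat \<Rightarrow> nat \<Rightarrow> nat \<Rightarrow> nat"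
    using sum_digits[OF B, of "\<lambda>x y. g x (y mod B) (y div B mod B) (y div B div B)" "B * (B * B)"]
    unfolding 3[of "g x" for x] .
  have "B ^ 5 = B * (B * (B * (B * B)))" by (simp add: eval_nat_numeral)
  then show ?thesis
    using sum_digits[OF B, of "\<lambda>x y. f x (y mod B) (y div B mod B) (y div B div B mod B) (y div B div B div B)" "B * (B * (B * B))"]
    unfolding 4[of "f x" for x] by simp
qed

definition qtab :: "nat \<Rightarrow> nat \<Rightarrow> nat" where
  "qtab B i = q (i div B div B) (i div B mod B) (i mod B)"

text \<open>The length \<open>l\<close> is the leading digit. The recursion refers to smaller
  lengths, hence to smaller indices, and the table can be filled in increasing order.\<close>

definition entry :: "nat \<Rightarrow> nat \<Rightarrow> nat \<Rightarrow> nat \<Rightarrow> nat" where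
  "entry B l s z = (l * B + s) * B + z"

lemma qtab_entry: "s < B \<Longrightarrow> z < B \<Longrightarrow> qtab B (entry B l s z) = q l s z"
  by (simp add: qtab_def entry_def)

lemma entry_less:
  assumes "l < i div B div B" "s < B" "z < B"
  shows "entry B l s z < i"
proof -
  have "entry B l s z div B div B < i div B div B" using assms by (simp add: entry_def)
  then show ?thesis by (metis div_le_mono linorder_not_le)
qed

text \<open>
  Both the table index \<open>i\<close> and the summation index \<open>j\<close> are read as digit strings in base \<open>B\<close>, so
  that two nested loops suffice.
\<close>

definition flat_summand :: "nat \<Rightarrow> (nat \<Rightarrow> nat) \<Rightarrow> nat \<Rightarrow> nat \<Rightarrow> nat" where
  "flat_summand B t i j = summand (\<lambda>l s z. t (entry B l s z)) (i div B div B) (i div B mod B) (i mod B)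
     (j mod B) (j div B mod B) (j div B div B mod B) (j div B div B div B mod B) (j div B div B div B div B)"

text \<open>The table cut off at \<open>i\<close> is the one present when entry \<open>i\<close> is
  computed. Wherever the guard of \<open>summand\<close> holds, both lookups have a smaller leading
  digit than \<open>i\<close>. The term \<open>1 - i\<close> is the initial value, index 0 being the
  entry with \<open>l = s = z = 0\<close>.\<close>

lemma qtab_recursion:
  assumes i: "i < B ^ 3" and B: "0 < B"
  shows "(1 - i) + (\<Sum>j<B ^ 5. flat_summand B (\<lambda>k. if k < i then qtab B k else 0) i j) = qtab B i"
proof -
  define l s z where lsz: "l = i div B div B" "s = i div B mod B" "z = i mod B"
  have lt: "l < B" "s < B" "z < B"
    using i B by (auto simp: lsz less_mult_imp_div_less power3_eq_cube)
  have i_eq: "i = entry B l s z" by (simp add: entry_def lsz)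
  have "i = 0 \<longleftrightarrow> l = 0 \<and> s = 0 \<and> z = 0" using B by (auto simp: i_eq entry_def)
  then have one: "1 - i = (if l = 0 \<and> s = 0 \<and> z = 0 then 1 else 0)" by auto
  let ?t = "\<lambda>k. if k < i then qtab B k else 0"
  have "(\<Sum>j<B ^ 5. flat_summand B ?t i j) =
      (\<Sum>e<B. \<Sum>n'<B. \<Sum>s'<B. \<Sum>y<B. \<Sum>z'<B. summand (\<lambda>l s z. ?t (entry B l s z)) l s z e n' s' y z')"
    unfolding flat_summand_def lsz[symmetric] by (rule sum_digits5[OF B])
  also have "\<dots> = (\<Sum>e<B. \<Sum>n'<B. \<Sum>s'<B. \<Sum>y<B. \<Sum>z'<B. summand q l s z e n' s' y z')"
  proof (intro sum.cong refl)
    fix e n' s' y z'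
    assume *: "s' \<in> {..<B}" "y \<in> {..<B}" "z' \<in> {..<B}"
    show "summand (\<lambda>l s z. ?t (entry B l s z)) l s z e n' s' y z' = summand q l s z e n' s' y z'"
    proof (cases "1 \<le> z \<and> n' + 2 * z \<le> l")
      case True
      then have "n' < i div B div B" "l - (n' + 2 * z) < i div B div B" by (auto simp flip: lsz)
      then have "?t (entry B n' s' y) = q n' s' y"
        "?t (entry B (l - (n' + 2 * z)) (s - (e + 2 * (z - e))) z') = q (l - (n' + 2 * z)) (s - (e + 2 * (z - e))) z'"
        using * lt by (simp_all add: entry_less qtab_entry)
      then show ?thesis by (simp add: summand_def)
    qed (auto simp: summand_def)
  qed
  finally have "(\<Sum>j<B ^ 5. flat_summand B ?t i j) =
      (\<Sum>e<B. \<Sum>n'<B. \<Sum>s'<B. \<Sum>y<B. \<Sum>z'<B. summand q l s z e n' s' y z')" .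
  moreover have "qtab B i = q l s z" by (simp add: qtab_def lsz)
  ultimately show ?thesis using q_recursion[OF lt] one by (simp only:)
qed

section \<open>The machine\<close>

subsection \<open>Cost of expressions\<close>

primrec expr_size :: "ram_expr \<Rightarrow> nat" where
  "expr_size (Lit k) = 1"
| "expr_size (Load e) = Suc (expr_size e)"
| "expr_size (Op b e e') = Suc (expr_size e + expr_size e')"

primrec lits_le :: "nat \<Rightarrow> ram_expr \<Rightarrow> bool" where
  "lits_le c (Lit k) \<longleftrightarrow> k \<le> c"
| "lits_le c (Load e) \<longleftrightarrow> lits_le c e"
| "lits_le c (Op b e e') \<longleftrightarrow> lits_le c e \<and> lits_le c e'"

definition bounded_mem :: "nat \<Rightarrow> (nat \<Rightarrow> nat) \<Rightarrow> bool" where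
  "bounded_mem L m \<longleftrightarrow> (\<forall>x. m x \<le> 2 ^ L)"

text \<open>Registers have about \<open>L\<close> bits, but a product of several registers has
  several times as many. Each of the \<open>expr_size e\<close> nodes is charged with the bound for
  the whole expression.\<close>

definition expr_time :: "nat \<Rightarrow> ram_expr \<Rightarrow> nat" where
  "expr_time L e = expr_size e * Suc (L * expr_size e)"

lemma expr_size_pos: "0 < expr_size e"
  by (induction e) auto

lemma op_val_le:
  assumes "x \<le> 2 ^ a" "y \<le> 2 ^ b" "0 < a" "0 < b"
  shows "op_val f x y \<le> 2 ^ (a + b)"
proof (cases f)
  case Add
  \<comment> \<open>Both powers are at least 2, and for such numbers the sum is at most the
    product.\<close>
  have "(2::nat) ^ a + 2 ^ b \<le> 2 ^ a * 2 ^ b"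
    using assms(3,4) self_le_power[of "2::nat" a] self_le_power[of "2::nat" b]
      mult_le_mono1[of 2 "2 ^ a" "2 ^ b"] mult_le_mono2[of 2 "2 ^ b" "2 ^ a"] by linarith
  then show ?thesis using Add assms by (simp add: power_add)
next
  case Sub
  have "x - y \<le> 2 ^ a * 1" using assms(1) by simp
  also have "\<dots> \<le> 2 ^ a * 2 ^ b" by (intro mult_le_mono) auto
  finally show ?thesis using Sub by (simp add: power_add)
next
  case Mul
  then show ?thesis using mult_le_mono[OF assms(1,2)] by (simp add: power_add)
next
  case Div
  have "x div y \<le> 2 ^ a * 1" using order_trans[OF div_le_dividend assms(1)] by simp
  also have "\<dots> \<le> 2 ^ a * 2 ^ b" by (intro mult_le_mono) auto
  finally show ?thesis using Div by (simp add: power_add)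
qed

lemma expr_val_le:
  assumes "bounded_mem L m" "lits_le (2 ^ L) e" "0 < L"
  shows "expr_val m e \<le> 2 ^ (L * expr_size e)"
  using assms(2)
proof (induction e)
  case (Load e)
  have "expr_val m (Load e) \<le> 2 ^ L" using assms(1) by (simp add: bounded_mem_def)
  also have "\<dots> \<le> 2 ^ (L * expr_size (Load e))" by (intro power_increasing) auto
  finally show ?case .
next
  case (Op b e e')
  have "op_val b (expr_val m e) (expr_val m e') \<le> 2 ^ (L * expr_size e + L * expr_size e')"
    using Op assms(3) by (intro op_val_le) (auto simp: expr_size_pos)
  also have "\<dots> \<le> 2 ^ (L * expr_size (Op b e e'))"
    by (intro power_increasing) (auto simp: algebra_simps)
  finally show ?case by simp
qed auto

lemma num_size_le: "k \<le> 2 ^ L \<Longrightarrow> num_size k \<le> Suc L"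
  using floor_log_mono[THEN monoD, of k "2 ^ L"] by (simp add: num_size_def floor_log_power)

lemma expr_cost_le:
  assumes "bounded_mem L m" "lits_le (2 ^ L) e" "0 < L"
  shows "expr_cost m e \<le> expr_time L e"
proof -
  have sub: "num_size (expr_val m e') \<le> Suc (L * expr_size e)"
    if "lits_le (2 ^ L) e'" "expr_size e' \<le> expr_size e" for e'
    using expr_val_le[OF assms(1) that(1) assms(3)] num_size_le[of "expr_val m e'" "L * expr_size e'"]
      mult_le_mono2[OF that(2), of L] by linarith
  \<comment> \<open>The number of digits is bounded uniformly by that of the whole \<open>e\<close>,
    so that the costs of subexpressions simply add up.\<close>
  have "expr_cost m e' \<le> expr_size e' * Suc (L * expr_size e)"
    if "lits_le (2 ^ L) e'" "expr_size e' \<le> expr_size e" for e'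
    using that
  proof (induction e')
    case (Lit k)
    then show ?case using sub[of "Lit k"] by simp
  next
    case (Load e')
    then show ?case using sub[of "Load e'"] by simp
  next
    case (Op b e1 e2)
    then show ?case using sub[of "Op b e1 e2"] by (simp add: algebra_simps)
  qed
  then show ?thesis using assms(2) by (simp add: expr_time_def)
qed

subsection \<open>Timed Hoare triples\<close>

text \<open>Total correctness with a time bound. The bound on the registers is built in as an
  invariant, since it controls the logarithmic cost.\<close>

definition triple ::
  "nat \<Rightarrow> ((nat \<Rightarrow> nat) \<Rightarrow> nat list \<Rightarrow> bool) \<Rightarrow> ram_prog \<Rightarrow> nat \<Rightarrow> ((nat \<Rightarrow> nat) \<Rightarrow> nat list \<Rightarrow> bool) \<Rightarrow> bool" where
  "triple L P c T Q \<longleftrightarrow> (\<forall>m out. P m out \<longrightarrow> bounded_mem L m \<longrightarrow>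
     (\<exists>t m' out'. ram_exec c (m, out) t (m', out') \<and> t \<le> T \<and> bounded_mem L m' \<and> Q m' out'))"

lemma triple_seq:
  assumes "triple L P c T Q" "triple L Q c' T' R"
  shows "triple L P (Seq c c') (T + T') R"
  unfolding triple_def
proof (intro allI impI)
  fix m out assume "P m out" "bounded_mem L m"
  then obtain t m' out' where 1: "ram_exec c (m, out) t (m', out')" "t \<le> T" "bounded_mem L m'" "Q m' out'"
    using assms(1) unfolding triple_def by blast
  then obtain t' m'' out'' where 2: "ram_exec c' (m', out') t' (m'', out'')" "t' \<le> T'" "bounded_mem L m''" "R m'' out''"
    using assms(2) unfolding triple_def by blast
  show "\<exists>t m' out'. ram_exec (Seq c c') (m, out) t (m', out') \<and> t \<le> T + T' \<and> bounded_mem L m' \<and> R m' out'"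
    using ram_exec.Seq[OF 1(1) 2(1)] 1 2 add_le_mono by blast
qed

lemma triple_store:
  assumes "lits_le (2 ^ L) e" "lits_le (2 ^ L) e'" "0 < L"
    and "\<And>m out. P m out \<Longrightarrow> expr_val m e' \<le> 2 ^ L \<and> Q (m(expr_val m e := expr_val m e')) out"
  shows "triple L P (Store e e') (expr_time L e + expr_time L e') Q"
  unfolding triple_def
proof (intro allI impI)
  fix m out assume *: "P m out" "bounded_mem L m"
  have "bounded_mem L (m(expr_val m e := expr_val m e'))"
    using * assms(4) by (simp add: bounded_mem_def)
  moreover have "expr_cost m e + expr_cost m e' \<le> expr_time L e + expr_time L e'"
    using expr_cost_le[OF *(2) _ assms(3)] assms by (intro add_le_mono) auto
  ultimately show "\<exists>t m' out'. ram_exec (Store e e') (m, out) t (m', out') \<and>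
      t \<le> expr_time L e + expr_time L e' \<and> bounded_mem L m' \<and> Q m' out'"
    using ram_exec.Store assms(4)[OF *(1)] by blast
qed

lemma triple_print:
  assumes "lits_le (2 ^ L) e" "0 < L"
    and "\<And>m out. P m out \<Longrightarrow> Q m (out @ [expr_val m e])"
  shows "triple L P (Print e) (expr_time L e) Q"
  unfolding triple_def
proof (intro allI impI)
  fix m out assume *: "P m out" "bounded_mem L m"
  show "\<exists>t m' out'. ram_exec (Print e) (m, out) t (m', out') \<and> t \<le> expr_time L e \<and> bounded_mem L m' \<and> Q m' out'"
    using ram_exec.Print expr_cost_le[OF *(2) assms(1,2)] assms(3)[OF *(1)] *(2) by blast
qed

abbreviation reg :: "nat \<Rightarrow> ram_expr" where
  "reg r \<equiv> Load (Lit r)"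

text \<open>Truncated subtraction makes the loop test nonzero exactly while the counter is below
  \<open>e\<close>.\<close>

definition for_loop :: "nat \<Rightarrow> ram_expr \<Rightarrow> ram_prog \<Rightarrow> ram_prog" where
  "for_loop r e c = Seq (Store (Lit r) (Lit 0))
     (Loop (Op Sub e (reg r)) (Seq c (Store (Lit r) (Op Add (reg r) (Lit 1)))))"

text \<open>The factor \<open>Suc N\<close> charges the last, failing test as a full round.\<close>

definition for_time :: "nat \<Rightarrow> nat \<Rightarrow> ram_expr \<Rightarrow> nat \<Rightarrow> nat \<Rightarrow> nat" where
  "for_time L r e N T = expr_time L (Lit r) + expr_time L (Lit 0) +
     Suc N * (expr_time L (Op Sub e (reg r)) + (T + (expr_time L (Lit r) + expr_time L (Op Add (reg r) (Lit 1)))))"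

text \<open>The bound \<open>e\<close> is evaluated afresh in every round, whence the assumption
  \<open>val\<close>.\<close>

lemma triple_for_loop:
  assumes lits: "lits_le (2 ^ L) e" "r \<le> 2 ^ L" and L: "0 < L" and N: "N \<le> 2 ^ L"
    and init: "\<And>m out. P m out \<Longrightarrow> Inv 0 (m(r := 0)) out"
    and step: "\<And>i. i < N \<Longrightarrow> triple L (\<lambda>m out. Inv i m out \<and> m r = i) c T
                 (\<lambda>m out. m r = i \<and> Inv (Suc i) (m(r := Suc i)) out)"
    and val: "\<And>i m out. i \<le> N \<Longrightarrow> Inv i m out \<Longrightarrow> m r = i \<Longrightarrow> expr_val m e = N"
    and final: "\<And>m out. Inv N m out \<Longrightarrow> m r = N \<Longrightarrow> Inv_end m out"
  shows "triple L P (for_loop r e c) (for_time L r e N T) Inv_end"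
proof -
  let ?c = "Seq c (Store (Lit r) (Op Add (reg r) (Lit 1)))"
  let ?C = "expr_time L (Op Sub e (reg r)) + (T + (expr_time L (Lit r) + expr_time L (Op Add (reg r) (Lit 1))))"
  have lits': "lits_le (2 ^ L) (Op Sub e (reg r))" using lits by simp
  have step': "triple L (\<lambda>m out. Inv i m out \<and> m r = i) ?c
      (T + (expr_time L (Lit r) + expr_time L (Op Add (reg r) (Lit 1)))) (\<lambda>m out. Inv (Suc i) m out \<and> m r = Suc i)"
    if "i < N" for i
    by (rule triple_seq[OF step[OF that]], rule triple_store) (use lits L N that in auto)
  have loop: "triple L (\<lambda>m out. Inv i m out \<and> m r = i) (Loop (Op Sub e (reg r)) ?c) (Suc (N - i) * ?C) Inv_end"
    if "i \<le> N" for i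
    using that
  proof (induction "N - i" arbitrary: i)
    case 0
    show ?case unfolding triple_def
    proof (intro allI impI)
      fix m out assume *: "Inv i m out \<and> m r = i" "bounded_mem L m"
      have "i = N" using 0 by simp
      have "ram_exec (Loop (Op Sub e (reg r)) ?c) (m, out) (expr_cost m (Op Sub e (reg r))) (m, out)"
        using ram_exec.Loop_false[of "(m, out)" "Op Sub e (reg r)" ?c] val[of i m out] * 0 by simp
      moreover have "expr_cost m (Op Sub e (reg r)) \<le> Suc (N - i) * ?C"
        using expr_cost_le[OF *(2) lits' L] by (simp add: \<open>i = N\<close> del: expr_cost.simps)
      ultimately show "\<exists>t m' out'. ram_exec (Loop (Op Sub e (reg r)) ?c) (m, out) t (m', out') \<and>
          t \<le> Suc (N - i) * ?C \<and> bounded_mem L m' \<and> Inv_end m' out'"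
        using * final \<open>i = N\<close> by blast
    qed
  next
    case (Suc d)
    show ?case unfolding triple_def
    proof (intro allI impI)
      fix m out assume *: "Inv i m out \<and> m r = i" "bounded_mem L m"
      have i: "i < N" using Suc by simp
      obtain t m' out' where 1: "ram_exec ?c (m, out) t (m', out')" "bounded_mem L m'"
        "t \<le> T + (expr_time L (Lit r) + expr_time L (Op Add (reg r) (Lit 1)))" "Inv (Suc i) m' out' \<and> m' r = Suc i"
        using step'[OF i] * unfolding triple_def by blast
      have "triple L (\<lambda>m out. Inv (Suc i) m out \<and> m r = Suc i) (Loop (Op Sub e (reg r)) ?c) (Suc (N - Suc i) * ?C) Inv_end"
        using Suc by (intro Suc.hyps(1)) auto
      then obtain t' m'' out'' where 2: "ram_exec (Loop (Op Sub e (reg r)) ?c) (m', out') t' (m'', out'')"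
        "bounded_mem L m''" "t' \<le> Suc (N - Suc i) * ?C" "Inv_end m'' out''"
        using 1 unfolding triple_def by blast
      have "expr_val m (Op Sub e (reg r)) \<noteq> 0" using val[of i m out] * i by simp
      then have "ram_exec (Loop (Op Sub e (reg r)) ?c) (m, out) (expr_cost m (Op Sub e (reg r)) + t + t') (m'', out'')"
        using ram_exec.Loop_true[of "(m, out)" "Op Sub e (reg r)", OF _ 1(1) 2(1)] by simp
      moreover have "expr_cost m (Op Sub e (reg r)) + t + t' \<le> ?C + Suc (N - Suc i) * ?C"
        using expr_cost_le[OF *(2) lits' L] 1(3) 2(3) by linarith
      moreover have "?C + Suc (N - Suc i) * ?C = Suc (N - i) * ?C"
        using i by (simp add: Suc_diff_Suc[symmetric] del: Suc_diff_Suc)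
      ultimately show "\<exists>t m' out'. ram_exec (Loop (Op Sub e (reg r)) ?c) (m, out) t (m', out') \<and>
          t \<le> Suc (N - i) * ?C \<and> bounded_mem L m' \<and> Inv_end m' out'"
        using 2 by metis
    qed
  qed
  have "triple L P (Store (Lit r) (Lit 0)) (expr_time L (Lit r) + expr_time L (Lit 0)) (\<lambda>m out. Inv 0 m out \<and> m r = 0)"
    by (rule triple_store) (use lits L init in auto)
  from triple_seq[OF this loop[of 0]] show ?thesis by (simp add: for_loop_def for_time_def)
qed

text \<open>Partial sums of natural numbers stay below the total, so a bound for the total keeps the
  accumulator small in every round.\<close>

lemma triple_sum_loop:
  assumes lits: "lits_le (2 ^ L) e" "lits_le (2 ^ L) f" "r \<le> 2 ^ L" "acc \<le> 2 ^ L" "r \<noteq> acc" and L: "0 < L"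
    and N: "N \<le> 2 ^ L" and total: "a + (\<Sum>j<N. g j) \<le> 2 ^ L"
    and frame: "\<And>m out x. P m out \<Longrightarrow> P (m(r := x)) out" "\<And>m out x. P m out \<Longrightarrow> P (m(acc := x)) out"
    and val: "\<And>m out. P m out \<Longrightarrow> expr_val m e = N"
    and summand: "\<And>m out j. P m out \<Longrightarrow> m r = j \<Longrightarrow> j < N \<Longrightarrow> expr_val m f = g j"
  shows "triple L (\<lambda>m out. P m out \<and> m acc = a) (for_loop r e (Store (Lit acc) (Op Add (reg acc) f)))
     (for_time L r e N (expr_time L (Lit acc) + expr_time L (Op Add (reg acc) f)))
     (\<lambda>m out. P m out \<and> m acc = a + (\<Sum>j<N. g j))"
proof (rule triple_for_loop[where Inv = "\<lambda>i m out. P m out \<and> m acc = a + (\<Sum>j<i. g j)"])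
  fix i assume i: "i < N"
  show "triple L (\<lambda>m out. (P m out \<and> m acc = a + (\<Sum>j<i. g j)) \<and> m r = i) (Store (Lit acc) (Op Add (reg acc) f))
     (expr_time L (Lit acc) + expr_time L (Op Add (reg acc) f))
     (\<lambda>m out. m r = i \<and> P (m(r := Suc i)) out \<and> (m(r := Suc i)) acc = a + (\<Sum>j<Suc i. g j))"
  proof (rule triple_store)
    fix m out assume *: "(P m out \<and> m acc = a + (\<Sum>j<i. g j)) \<and> m r = i"
    have "(\<Sum>j<Suc i. g j) \<le> (\<Sum>j<N. g j)" using i by (intro sum_mono2) auto
    then have "a + (\<Sum>j<Suc i. g j) \<le> 2 ^ L" using total by linarith
    then show "expr_val m (Op Add (reg acc) f) \<le> 2 ^ L \<and>
      (m(expr_val m (Lit acc) := expr_val m (Op Add (reg acc) f))) r = i \<and>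
      P ((m(expr_val m (Lit acc) := expr_val m (Op Add (reg acc) f)))(r := Suc i)) out \<and>
      ((m(expr_val m (Lit acc) := expr_val m (Op Add (reg acc) f)))(r := Suc i)) acc = a + (\<Sum>j<Suc i. g j)"
      using * lits(5) summand[of m out i] i frame by (auto simp: add.assoc)
  qed (use lits L in auto)
qed (use lits L N val frame in auto)

subsection \<open>Polynomially bounded functions\<close>

definition poly_bounded :: "(nat \<Rightarrow> nat) \<Rightarrow> bool" where
  "poly_bounded f \<longleftrightarrow> (\<exists>p :: nat poly. \<forall>n. f n \<le> poly p n)"

lemma poly_bounded_const: "poly_bounded (\<lambda>_. c)"
  unfolding poly_bounded_def by (rule exI[of _ "[:c:]"]) simp

lemma poly_bounded_id: "poly_bounded (\<lambda>n. n)"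
  unfolding poly_bounded_def by (rule exI[of _ "[:0, 1:]"]) simp

lemma poly_bounded_add: "poly_bounded f \<Longrightarrow> poly_bounded g \<Longrightarrow> poly_bounded (\<lambda>n. f n + g n)"
  unfolding poly_bounded_def
proof (elim exE)
  fix p q :: "nat poly" assume "\<forall>n. f n \<le> poly p n" "\<forall>n. g n \<le> poly q n"
  then show "\<exists>p. \<forall>n. f n + g n \<le> poly p n" by (intro exI[of _ "p + q"]) (simp add: add_le_mono)
qed

lemma poly_bounded_mult: "poly_bounded f \<Longrightarrow> poly_bounded g \<Longrightarrow> poly_bounded (\<lambda>n. f n * g n)"
  unfolding poly_bounded_def
proof (elim exE)
  fix p q :: "nat poly" assume "\<forall>n. f n \<le> poly p n" "\<forall>n. g n \<le> poly q n"
  then show "\<exists>p. \<forall>n. f n * g n \<le> poly p n" by (intro exI[of _ "p * q"]) (simp add: mult_le_mono)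
qed

lemma poly_bounded_Suc: "poly_bounded f \<Longrightarrow> poly_bounded (\<lambda>n. Suc (f n))"
  using poly_bounded_add[OF _ poly_bounded_const[of 1], of f] by simp

lemma poly_bounded_power: "poly_bounded f \<Longrightarrow> poly_bounded (\<lambda>n. f n ^ k)"
  by (induction k) (auto intro: poly_bounded_const poly_bounded_mult)

lemma poly_bounded_expr_time: "poly_bounded L \<Longrightarrow> poly_bounded (\<lambda>n. expr_time (L n) e)"
  unfolding expr_time_def by (intro poly_bounded_mult poly_bounded_const poly_bounded_Suc)

lemma poly_bounded_for_time:
  "poly_bounded L \<Longrightarrow> poly_bounded N \<Longrightarrow> poly_bounded T \<Longrightarrow> poly_bounded (\<lambda>n. for_time (L n) r e (N n) (T n))"
  unfolding for_time_def
  by (intro poly_bounded_mult poly_bounded_const poly_bounded_Suc poly_bounded_add poly_bounded_expr_time)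

subsection \<open>The program\<close>

text \<open>Comparison as a number 0 or 1, by truncated subtraction. Guards become factors, and a
  summand is one expression without branching.\<close>

definition le_expr :: "ram_expr \<Rightarrow> ram_expr \<Rightarrow> ram_expr" where
  "le_expr x y = Op Sub (Lit 1) (Op Sub x y)"

definition mod_expr :: "ram_expr \<Rightarrow> ram_expr \<Rightarrow> ram_expr" where
  "mod_expr x y = Op Sub x (Op Mul (Op Div x y) y)"

definition fact_expr :: "ram_expr \<Rightarrow> ram_expr" where
  "fact_expr k = Load (Op Add (Lit 10) (Op Mul (Lit 2) k))"

definition choose_expr :: "ram_expr \<Rightarrow> ram_expr \<Rightarrow> ram_expr" where
  "choose_expr a b = Op Div (fact_expr (Op Add a b)) (Op Mul (fact_expr a) (fact_expr b))"

text \<open>The last factor is 1 for positive \<open>k\<close>. For \<open>k = 0\<close> the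
  binomial coefficient evaluates to 1, and this factor corrects it to 0 unless
  \<open>s = 0\<close>.\<close>

definition splits_expr :: "ram_expr \<Rightarrow> ram_expr \<Rightarrow> ram_expr" where
  "splits_expr s k = Op Mul (choose_expr s (Op Sub k (Lit 1))) (le_expr s (Op Mul k s))"

definition nu_expr :: "ram_expr \<Rightarrow> ram_expr \<Rightarrow> ram_expr \<Rightarrow> ram_expr" where
  "nu_expr s z x = Op Add (Op Div (Op Mul s x) z) (Op Mul (Op Sub (Lit 1) s) x)"

definition table_expr :: "ram_expr \<Rightarrow> ram_expr" where
  "table_expr k = Load (Op Add (Lit 11) (Op Mul (Lit 2) k))"

definition entry_expr :: "ram_expr \<Rightarrow> ram_expr \<Rightarrow> ram_expr \<Rightarrow> ram_expr" where
  "entry_expr l s z = Op Add (Op Mul (Op Add (Op Mul l (reg 1)) s) (reg 1)) z"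

text \<open>If a guard fails, the lookups may read meaningless addresses; all operations are total,
  and the product with 0 is the right value.\<close>

definition summand_expr ::
  "ram_expr \<Rightarrow> ram_expr \<Rightarrow> ram_expr \<Rightarrow> ram_expr \<Rightarrow> ram_expr \<Rightarrow> ram_expr \<Rightarrow> ram_expr \<Rightarrow> ram_expr \<Rightarrow> ram_expr" where
  "summand_expr l s z e n' s' y z' =
     (let letters = Op Add n' (Op Mul (Lit 2) z);
          tokens = Op Add e (Op Mul (Lit 2) (Op Sub z e)) in
      Op Mul (Op Mul (Op Mul (le_expr (Lit 1) z) (le_expr e z)) (Op Mul (le_expr letters l) (le_expr tokens s)))
       (Op Mul (choose_expr e (Op Sub z e))
         (Op Mul (Op Mul (splits_expr s' e) (nu_expr s' y (table_expr (entry_expr n' s' y))))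
           (Op Mul (splits_expr z' (Op Sub z e))
             (table_expr (entry_expr (Op Sub l letters) (Op Sub s tokens) z'))))))"

definition flat_summand_expr :: ram_expr where
  "flat_summand_expr =
     (let b = reg 1; i = reg 2; j = reg 3 in
      summand_expr (Op Div (Op Div i b) b) (mod_expr (Op Div i b) b) (mod_expr i b)
        (mod_expr j b) (mod_expr (Op Div j b) b) (mod_expr (Op Div (Op Div j b) b) b)
        (mod_expr (Op Div (Op Div (Op Div j b) b) b) b) (Op Div (Op Div (Op Div (Op Div j b) b) b) b))"

definition output_summand_expr :: ram_expr where
  "output_summand_expr =
     (let b = reg 1; i = reg 2; j = reg 3 in
      Op Mul (Op Mul i (nu_expr (mod_expr j b) (Op Div j b) (table_expr (entry_expr i (mod_expr j b) (Op Div j b)))))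
        (Op Div (fact_expr (reg 0)) (mod_expr j b)))"

text \<open>The upper arguments of the binomial coefficients are sums of two numbers at most
  \<open>n\<close>, which a table up to \<open>2 * Suc n\<close> covers.\<close>

definition fact_prog :: ram_prog where
  "fact_prog = Seq (Store (Lit 1) (Op Add (reg 0) (Lit 1))) (Seq (Store (Lit 10) (Lit 1))
     (for_loop 2 (Op Mul (Lit 2) (reg 1))
       (Store (Op Add (Lit 10) (Op Mul (Lit 2) (Op Add (reg 2) (Lit 1))))
          (Op Mul (fact_expr (reg 2)) (Op Add (reg 2) (Lit 1))))))"

definition cube_expr :: ram_expr where
  "cube_expr = Op Mul (Op Mul (reg 1) (reg 1)) (reg 1)"

definition table_prog :: ram_prog where
  "table_prog = for_loop 2 cube_expr
     (Seq (Store (Lit 4) (Op Sub (Lit 1) (reg 2)))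
       (Seq (for_loop 3 (Op Mul cube_expr (Op Mul (reg 1) (reg 1))) (Store (Lit 4) (Op Add (reg 4) flat_summand_expr)))
         (Store (Op Add (Lit 11) (Op Mul (Lit 2) (reg 2))) (reg 4))))"

definition output_prog :: ram_prog where
  "output_prog = for_loop 2 (reg 1)
     (Seq (Store (Lit 4) (Lit 0))
       (Seq (for_loop 3 (Op Mul (reg 1) (reg 1)) (Store (Lit 4) (Op Add (reg 4) output_summand_expr)))
         (Print (Op Add (Op Div (reg 4) (fact_expr (reg 0))) (Op Sub (Lit 1) (reg 2))))))"

section \<open>Evaluation of the expressions on the tables\<close>

lemma lits_le_exprs [simp]:
  "lits_le c (le_expr x y) \<longleftrightarrow> 1 \<le> c \<and> lits_le c x \<and> lits_le c y"
  "lits_le c (mod_expr x y) \<longleftrightarrow> lits_le c x \<and> lits_le c y"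
  "lits_le c (fact_expr x) \<longleftrightarrow> 10 \<le> c \<and> lits_le c x"
  "lits_le c (choose_expr x y) \<longleftrightarrow> 10 \<le> c \<and> lits_le c x \<and> lits_le c y"
  "lits_le c (splits_expr x y) \<longleftrightarrow> 10 \<le> c \<and> lits_le c x \<and> lits_le c y"
  "lits_le c (nu_expr x y z) \<longleftrightarrow> 1 \<le> c \<and> lits_le c x \<and> lits_le c y \<and> lits_le c z"
  "lits_le c (table_expr x) \<longleftrightarrow> 11 \<le> c \<and> lits_le c x"
  "lits_le c (entry_expr x y z) \<longleftrightarrow> 1 \<le> c \<and> lits_le c x \<and> lits_le c y \<and> lits_le c z"
  by (auto simp: le_expr_def mod_expr_def fact_expr_def choose_expr_def splits_expr_def nu_expr_def
      table_expr_def entry_expr_def)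

lemma lits_le_program [simp]:
  assumes "11 \<le> c"
  shows "lits_le c flat_summand_expr" "lits_le c output_summand_expr" "lits_le c cube_expr"
  using assms by (auto simp: flat_summand_expr_def output_summand_expr_def summand_expr_def cube_expr_def Let_def)

text \<open>
  Register \<open>0\<close> holds the input \<open>n\<close>, register \<open>1\<close> the base \<open>n + 1\<close> of the index digits; registers
  \<open>2, 3, 4\<close> are the loop counters and the accumulator. Factorials are stored at even addresses from
  \<open>10\<close>, the table of \<open>q\<close> at odd addresses from \<open>11\<close>.
\<close>

definition tables :: "nat \<Rightarrow> (nat \<Rightarrow> nat) \<Rightarrow> (nat \<Rightarrow> nat) \<Rightarrow> bool" where
  "tables n t m \<longleftrightarrow> m 0 = n \<and> m 1 = Suc n \<and> (\<forall>k\<le>2 * Suc n. m (10 + 2 * k) = fact k) \<and> (\<forall>k. m (11 + 2 * k) = t k)"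

lemma tables_upd: "tables n t m \<Longrightarrow> r \<in> {2, 3, 4} \<Longrightarrow> tables n t (m(r := x))"
  by (auto simp: tables_def)

lemma val_exprs [simp]:
  "expr_val m (le_expr x y) = (if expr_val m x \<le> expr_val m y then 1 else 0)"
  "expr_val m (mod_expr x y) = expr_val m x mod expr_val m y"
  "expr_val m (nu_expr x y z) = nu (expr_val m x) (expr_val m y) (expr_val m z)"
  by (auto simp: le_expr_def mod_expr_def nu_expr_def nu_def minus_div_mult_eq_mod)

lemma val_table_exprs:
  assumes "tables n t m"
  shows "expr_val m (table_expr k) = t (expr_val m k)"
    and "expr_val m (entry_expr l s z) = entry (Suc n) (expr_val m l) (expr_val m s) (expr_val m z)"
    and "expr_val m k \<le> 2 * Suc n \<Longrightarrow> expr_val m (fact_expr k) = fact (expr_val m k)"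
  using assms by (auto simp: tables_def table_expr_def entry_expr_def entry_def fact_expr_def)

lemma val_choose_expr:
  assumes "tables n t m" "expr_val m a + expr_val m b \<le> 2 * Suc n"
  shows "expr_val m (choose_expr a b) = (expr_val m a + expr_val m b) choose expr_val m a"
  using assms by (simp add: choose_expr_def val_table_exprs(3)[OF assms(1)] binomial_fact')

lemma val_splits_expr:
  assumes "tables n t m" "expr_val m s + expr_val m k \<le> 2 * Suc n"
  shows "expr_val m (splits_expr s k) = splits (expr_val m s) (expr_val m k)"
  using assms by (cases "expr_val m k") (auto simp: splits_expr_def val_choose_expr splits_def)

lemma val_summand_expr:
  assumes t: "tables n t m"
    and "expr_val m z \<le> n" "expr_val m e \<le> n" "expr_val m s' \<le> n" "expr_val m z' \<le> n"
  shows "expr_val m (summand_expr l s z e n' s' y z') =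
    summand (\<lambda>l s z. t (entry (Suc n) l s z)) (expr_val m l) (expr_val m s) (expr_val m z) (expr_val m e)
      (expr_val m n') (expr_val m s') (expr_val m y) (expr_val m z')"
  using assms(2-)
  by (simp add: summand_expr_def Let_def summand_def val_table_exprs[OF t] val_choose_expr[OF t] val_splits_expr[OF t])

lemma val_flat_summand_expr:
  assumes t: "tables n t m" and "m 2 = i" "m 3 = j" "j < Suc n ^ 5"
  shows "expr_val m flat_summand_expr = flat_summand (Suc n) t i j"
proof -
  have "m 1 = Suc n" using t by (simp add: tables_def)
  \<comment> \<open>The leading digit is taken without \<open>mod\<close>; the bound on
    \<open>j\<close> makes it at most \<open>n\<close>.\<close>
  moreover have "j div Suc n div Suc n div Suc n div Suc n < Suc n"
    using assms(4) by (simp add: less_mult_imp_div_less eval_nat_numeral mult.assoc del: mult_Suc mult_Suc_right)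
  moreover have "x mod Suc n \<le> n" for x by (simp add: less_Suc_eq_le[symmetric])
  ultimately show ?thesis using assms(2,3)
    by (simp add: flat_summand_expr_def Let_def val_summand_expr[OF t] flat_summand_def less_Suc_eq_le)
qed

section \<open>Sizes of the numbers that occur\<close>

lemma qtab_le: "i < Suc n ^ 3 \<Longrightarrow> qtab (Suc n) i \<le> 4 ^ n"
proof -
  assume "i < Suc n ^ 3"
  then have "i div Suc n div Suc n \<le> n"
    by (simp add: less_mult_imp_div_less power3_eq_cube less_Suc_eq_le[symmetric] del: mult_Suc mult_Suc_right)
  then have "(4::nat) ^ (i div Suc n div Suc n) \<le> 4 ^ n" by (intro power_increasing) auto
  moreover have "qtab (Suc n) i \<le> 4 ^ (i div Suc n div Suc n)"
    unfolding qtab_def q_def by (rule card_onesided_words_le)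
  ultimately show ?thesis by (rule order_trans[rotated])
qed

lemma fact_le: "fact (2 * Suc n) \<le> (2::nat) ^ (4 * (Suc n)\<^sup>2)"
proof -
  have "fact (2 * Suc n) \<le> (2 * Suc n) ^ (2 * Suc n)" using fact_le_power[of "2 * Suc n"] by (metis of_nat_id)
  also have "\<dots> \<le> (2 ^ (2 * Suc n)) ^ (2 * Suc n)" by (intro power_mono less_imp_le[OF less_exp]) auto
  also have "\<dots> = 2 ^ (2 * Suc n * (2 * Suc n))" by (simp only: power_mult)
  also have "2 * Suc n * (2 * Suc n) = 4 * (Suc n)\<^sup>2" by (simp add: power2_eq_square)
  finally show ?thesis .
qed

lemma Suc_n_power_le: "Suc n ^ k \<le> 2 ^ (k * Suc n)"
proof -
  have "Suc n ^ k \<le> (2 ^ Suc n) ^ k" by (intro power_mono less_imp_le[OF less_exp]) auto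
  also have "\<dots> = 2 ^ (k * Suc n)" by (simp only: power_mult[symmetric] mult.commute)
  finally show ?thesis .
qed

text \<open>The exponent \<open>4 * (Suc n)\<^sup>2\<close> covers the factorials up to
  \<open>2 * Suc n\<close>, a further \<open>2 * n\<close> the factor \<open>4 ^ n\<close>, and
  \<open>5 * Suc n\<close> the loop bound \<open>Suc n ^ 5\<close>. The constant 10 exceeds all of
  these.\<close>

definition word_size :: "nat \<Rightarrow> nat" where
  "word_size n = 10 * (Suc n)\<^sup>2"

lemma word_size_ge:
  "4 * (Suc n)\<^sup>2 + 2 * n \<le> word_size n" "5 * Suc n \<le> word_size n" "4 \<le> word_size n"
  by (auto simp: word_size_def power2_eq_square)

lemma pow_le_word: "k \<le> word_size n \<Longrightarrow> (2::nat) ^ k \<le> 2 ^ word_size n"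
  by (rule power_increasing) auto

lemma lits_le_word: "(c::nat) \<le> 16 \<Longrightarrow> c \<le> 2 ^ word_size n"
  using pow_le_word[OF word_size_ge(3), of n] by simp

lemma word_size_pos: "0 < word_size n" using word_size_ge(3)[of n] by simp

lemma small_le_word:
  "Suc n ^ 5 \<le> 2 ^ word_size n" "Suc n ^ 3 \<le> 2 ^ word_size n" "2 * Suc n \<le> 2 ^ word_size n"
  "Suc n * Suc n \<le> 2 ^ word_size n"
  "k \<le> 2 * Suc n \<Longrightarrow> fact k \<le> (2::nat) ^ word_size n"
  "k \<le> 4 ^ n * fact n \<Longrightarrow> k \<le> 2 ^ word_size n"
proof -
  have p: "Suc n ^ k \<le> 2 ^ word_size n" if "k \<le> 5" for k
    using order_trans[OF Suc_n_power_le pow_le_word, of k n n] that word_size_ge(2)[of n]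
      mult_le_mono1[OF that, of "Suc n"] by linarith
  show "Suc n ^ 5 \<le> 2 ^ word_size n" "Suc n ^ 3 \<le> 2 ^ word_size n" by (auto intro!: p simp del: power_Suc)
  show "Suc n * Suc n \<le> 2 ^ word_size n" using p[of 2] by (simp add: power2_eq_square)
  have f: "fact (2 * Suc n) \<le> (2::nat) ^ word_size n"
    using fact_le[of n] pow_le_word[of "4 * (Suc n)\<^sup>2" n] word_size_ge(1)[of n] by linarith
  show fk: "fact k \<le> (2::nat) ^ word_size n" if "k \<le> 2 * Suc n" for k
    using fact_mono[OF that, where 'a = nat] f by linarith
  show "2 * Suc n \<le> 2 ^ word_size n" using fact_ge_self[of "2 * Suc n"] f by linarith
  show "k \<le> 2 ^ word_size n" if "k \<le> 4 ^ n * fact n"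
  proof -
    have "fact n \<le> (2::nat) ^ (4 * (Suc n)\<^sup>2)"
      using fact_le[of n] fact_mono[of n "2 * Suc n", where 'a = nat] by simp
    then have "4 ^ n * fact n \<le> (2::nat) ^ (2 * n) * 2 ^ (4 * (Suc n)\<^sup>2)"
      by (simp add: power_mult)
    also have "\<dots> \<le> 2 ^ word_size n"
      using pow_le_word[OF word_size_ge(1)[of n]] by (simp add: power_add mult.commute)
    finally show ?thesis using that by simp
  qed
qed

lemma lits_le_mono: "lits_le c e \<Longrightarrow> c \<le> d \<Longrightarrow> lits_le d e"
  by (induction e) auto

lemma poly_bounded_word_size: "poly_bounded word_size"
  unfolding word_size_def[abs_def]
  by (intro poly_bounded_mult poly_bounded_const poly_bounded_power poly_bounded_Suc poly_bounded_id)

text \<open>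
  Triples for the input \<open>n\<close> and the values \<open>i\<close> of an outer loop counter with \<open>A n i\<close>; the time
  bound depends on \<open>n\<close> only.
\<close>

definition ptriple :: "(nat \<Rightarrow> nat \<Rightarrow> bool) \<Rightarrow> (nat \<Rightarrow> nat \<Rightarrow> (nat \<Rightarrow> nat) \<Rightarrow> nat list \<Rightarrow> bool) \<Rightarrow> ram_prog \<Rightarrow>
    (nat \<Rightarrow> nat \<Rightarrow> (nat \<Rightarrow> nat) \<Rightarrow> nat list \<Rightarrow> bool) \<Rightarrow> bool" where
  "ptriple A P c Q \<longleftrightarrow>
     (\<exists>T. poly_bounded T \<and> (\<forall>n i. A n i \<longrightarrow> triple (word_size n) (P n i) c (T n) (Q n i)))"

lemma ptripleI:
  "poly_bounded T \<Longrightarrow> (\<And>n i. A n i \<Longrightarrow> triple (word_size n) (P n i) c (T n) (Q n i)) \<Longrightarrow> ptriple A P c Q"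
  unfolding ptriple_def by blast

lemma ptriple_seq:
  assumes "ptriple A P c Q" "ptriple A Q c' R"
  shows "ptriple A P (Seq c c') R"
proof -
  obtain T T' where "poly_bounded T" "poly_bounded T'"
    "\<And>n i. A n i \<Longrightarrow> triple (word_size n) (P n i) c (T n) (Q n i)"
    "\<And>n i. A n i \<Longrightarrow> triple (word_size n) (Q n i) c' (T' n) (R n i)"
    using assms unfolding ptriple_def by blast
  then show ?thesis by (intro ptripleI[OF poly_bounded_add[of T T']] triple_seq)
qed

lemma ptriple_store:
  assumes "lits_le 16 e" "lits_le 16 e'"
    and "\<And>n i m out. A n i \<Longrightarrow> P n i m out \<Longrightarrow>
      expr_val m e' \<le> 2 ^ word_size n \<and> Q n i (m(expr_val m e := expr_val m e')) out"
  shows "ptriple A P (Store e e') Q"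
proof (rule ptripleI)
  show "poly_bounded (\<lambda>n. expr_time (word_size n) e + expr_time (word_size n) e')"
    by (intro poly_bounded_add poly_bounded_expr_time poly_bounded_word_size)
qed (use assms lits_le_mono[OF _ lits_le_word] in \<open>auto intro!: triple_store word_size_pos\<close>)

lemma ptriple_print:
  assumes "lits_le 16 e" and "\<And>n i m out. A n i \<Longrightarrow> P n i m out \<Longrightarrow> Q n i m (out @ [expr_val m e])"
  shows "ptriple A P (Print e) Q"
proof (rule ptripleI)
  show "poly_bounded (\<lambda>n. expr_time (word_size n) e)"
    by (intro poly_bounded_expr_time poly_bounded_word_size)
qed (use assms lits_le_mono[OF _ lits_le_word] in \<open>auto intro!: triple_print word_size_pos\<close>)

text \<open>In \<open>step\<close> the second parameter is the counter of this loop, in the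
  conclusion that of the surrounding one. A time bound independent of the counter can be multiplied
  by the number of rounds.\<close>

lemma ptriple_for_loop:
  assumes step: "ptriple (\<lambda>n i. i < N n) (\<lambda>n i m out. Inv n i m out \<and> m r = i) c
      (\<lambda>n i m out. m r = i \<and> Inv n (Suc i) (m(r := Suc i)) out)"
    and lits: "lits_le 16 e" "r \<le> 16" and N: "poly_bounded N" "\<And>n. N n \<le> 2 ^ word_size n"
    and init: "\<And>n i m out. A n i \<Longrightarrow> P n i m out \<Longrightarrow> Inv n 0 (m(r := 0)) out"
    and val: "\<And>n i m out. i \<le> N n \<Longrightarrow> Inv n i m out \<Longrightarrow> m r = i \<Longrightarrow> expr_val m e = N n"
    and final: "\<And>n i m out. A n i \<Longrightarrow> Inv n (N n) m out \<Longrightarrow> m r = N n \<Longrightarrow> Q n i m out"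
  shows "ptriple A P (for_loop r e c) Q"
proof -
  obtain T where T: "poly_bounded T"
    "\<And>n i. i < N n \<Longrightarrow> triple (word_size n) (\<lambda>m out. Inv n i m out \<and> m r = i) c (T n)
      (\<lambda>m out. m r = i \<and> Inv n (Suc i) (m(r := Suc i)) out)"
    using step unfolding ptriple_def by blast
  show ?thesis
  proof (rule ptripleI)
    show "poly_bounded (\<lambda>n. for_time (word_size n) r e (N n) (T n))"
      by (intro poly_bounded_for_time poly_bounded_word_size N T)
    show "triple (word_size n) (P n i) (for_loop r e c) (for_time (word_size n) r e (N n) (T n)) (Q n i)" if "A n i" for n i
      by (rule triple_for_loop[where Inv = "Inv n"])
        (use lits that T(2) N(2) init val final lits_le_mono[OF _ lits_le_word] in \<open>auto intro!: lits_le_word word_size_pos\<close>)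
  qed
qed

lemma ptriple_sum_loop:
  assumes lits: "lits_le 16 e" "lits_le 16 f" "r \<le> 16" "acc \<le> 16" "r \<noteq> acc"
    and N: "poly_bounded N" "\<And>n. N n \<le> 2 ^ word_size n"
    and total: "\<And>n i. A n i \<Longrightarrow> a n i + (\<Sum>j<N n. g n i j) \<le> 2 ^ word_size n"
    and frame: "\<And>n i m out x. P n i m out \<Longrightarrow> P n i (m(r := x)) out" "\<And>n i m out x. P n i m out \<Longrightarrow> P n i (m(acc := x)) out"
    and val: "\<And>n i m out. P n i m out \<Longrightarrow> expr_val m e = N n"
    and summand: "\<And>n i m out j. A n i \<Longrightarrow> P n i m out \<Longrightarrow> m r = j \<Longrightarrow> j < N n \<Longrightarrow> expr_val m f = g n i j"
  shows "ptriple A (\<lambda>n i m out. P n i m out \<and> m acc = a n i)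
     (for_loop r e (Store (Lit acc) (Op Add (reg acc) f)))
     (\<lambda>n i m out. P n i m out \<and> m acc = a n i + (\<Sum>j<N n. g n i j))"
proof (rule ptripleI)
  show "poly_bounded (\<lambda>n. for_time (word_size n) r e (N n)
      (expr_time (word_size n) (Lit acc) + expr_time (word_size n) (Op Add (reg acc) f)))"
    by (intro poly_bounded_for_time poly_bounded_word_size N poly_bounded_add poly_bounded_expr_time)
  fix n i assume A: "A n i"
  show "triple (word_size n) (\<lambda>m out. P n i m out \<and> m acc = a n i)
      (for_loop r e (Store (Lit acc) (Op Add (reg acc) f)))
      (for_time (word_size n) r e (N n)
        (expr_time (word_size n) (Lit acc) + expr_time (word_size n) (Op Add (reg acc) f)))
      (\<lambda>m out. P n i m out \<and> m acc = a n i + (\<Sum>j<N n. g n i j))"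
    by (rule triple_sum_loop)
      (use lits A N(2) total[OF A] frame val summand[OF A] lits_le_mono[OF _ lits_le_word] in
        \<open>auto intro!: lits_le_word word_size_pos\<close>)
qed

section \<open>Correctness of the three programs\<close>

abbreviation (input) coeff_list :: "nat \<Rightarrow> nat list" where
  "coeff_list k \<equiv> map (fps_nth cogrowth_series) [0..<k]"

text \<open>Unfilled entries are 0, as the registers are at the start; thus the empty table is
  present without initialization.\<close>

definition partial_table :: "nat \<Rightarrow> nat \<Rightarrow> nat \<Rightarrow> nat" where
  "partial_table n i k = (if k < i then qtab (Suc n) k else 0)"

lemma tables_regs: "tables n t m \<Longrightarrow> m 0 = n \<and> m (Suc 0) = Suc n"
  by (simp add: tables_def)

lemma even_odd_neq: "10 + 2 * k \<noteq> 11 + 2 * (l::nat)" "11 + 2 * l \<noteq> 10 + 2 * (k::nat)"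
  by presburger+

lemma Suc_le_word: "Suc n \<le> 2 ^ word_size n"
  using small_le_word(3)[of n] by simp

lemma one_minus_le_word: "Suc 0 - i \<le> 2 ^ word_size n"
  by (rule order_trans[OF diff_le_self]) simp

lemma fact_prog_correct:
  "ptriple (\<lambda>_ _. True) (\<lambda>n _ m out. m = (\<lambda>_. 0)(0 := n) \<and> out = []) fact_prog
     (\<lambda>n _ m out. tables n (partial_table n 0) m \<and> out = [])"
  unfolding fact_prog_def
proof (rule ptriple_seq)
  show "ptriple (\<lambda>_ _. True) (\<lambda>n _ m out. m = (\<lambda>_. 0)(0 := n) \<and> out = []) (Store (Lit 1) (Op Add (reg 0) (Lit 1)))
     (\<lambda>n _ m out. m = (\<lambda>_. 0)(0 := n, 1 := Suc n) \<and> out = [])"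
    by (rule ptriple_store) (auto simp: Suc_le_word)
next
  let ?Q = "\<lambda>n _ m out. m = (\<lambda>_. 0)(0 := n, 1 := Suc n, 10 := 1) \<and> out = []"
  show "ptriple (\<lambda>_ _. True) (\<lambda>n _ m out. m = (\<lambda>_. 0)(0 := n, 1 := Suc n) \<and> out = [])
    (Seq (Store (Lit 10) (Lit 1)) (for_loop 2 (Op Mul (Lit 2) (reg 1))
       (Store (Op Add (Lit 10) (Op Mul (Lit 2) (Op Add (reg 2) (Lit 1))))
          (Op Mul (fact_expr (reg 2)) (Op Add (reg 2) (Lit 1))))))
    (\<lambda>n _ m out. tables n (partial_table n 0) m \<and> out = [])"
  proof (rule ptriple_seq)
    show "ptriple (\<lambda>_ _. True) (\<lambda>n _ m out. m = (\<lambda>_. 0)(0 := n, 1 := Suc n) \<and> out = []) (Store (Lit 10) (Lit 1)) ?Q"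
      by (rule ptriple_store) auto
  next
    \<comment> \<open>The odd addresses must stay 0, because they form the empty table handed to
      \<open>table_prog\<close>.\<close>
    let ?Inv = "\<lambda>n i m out. m 0 = n \<and> m 1 = Suc n \<and> (\<forall>k\<le>i. m (10 + 2 * k) = fact k) \<and>
      (\<forall>k. m (11 + 2 * k) = 0) \<and> out = ([] :: nat list)"
    show "ptriple (\<lambda>_ _. True) ?Q (for_loop 2 (Op Mul (Lit 2) (reg 1))
       (Store (Op Add (Lit 10) (Op Mul (Lit 2) (Op Add (reg 2) (Lit 1))))
          (Op Mul (fact_expr (reg 2)) (Op Add (reg 2) (Lit 1)))))
       (\<lambda>n _ m out. tables n (partial_table n 0) m \<and> out = [])"
    proof (rule ptriple_for_loop[where N = "\<lambda>n. 2 * Suc n" and Inv = ?Inv])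
      show "ptriple (\<lambda>n i. i < 2 * Suc n) (\<lambda>n i m out. ?Inv n i m out \<and> m 2 = i)
        (Store (Op Add (Lit 10) (Op Mul (Lit 2) (Op Add (reg 2) (Lit 1))))
          (Op Mul (fact_expr (reg 2)) (Op Add (reg 2) (Lit 1))))
        (\<lambda>n i m out. m 2 = i \<and> ?Inv n (Suc i) (m(2 := Suc i)) out)"
      proof (rule ptriple_store)
        fix n i m out assume i: "i < 2 * Suc n" and *: "?Inv n i m out \<and> m 2 = i"
        have v: "expr_val m (Op Mul (fact_expr (reg 2)) (Op Add (reg 2) (Lit 1))) = fact (Suc i)"
          using * by (simp add: fact_expr_def algebra_simps)
        have "fact (Suc i) \<le> (2::nat) ^ word_size n" by (rule small_le_word(5)) (use i in simp)
        moreover have "(m(10 + 2 * Suc i := fact (Suc i), 2 := Suc i)) (10 + 2 * k) = fact k" if "k \<le> Suc i" for k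
          using that * by (cases "k = Suc i") auto
        moreover have "(m(10 + 2 * Suc i := fact (Suc i), 2 := Suc i)) (11 + 2 * k) = 0" for k
          using * even_odd_neq(2)[of k "Suc i"] by simp
        moreover have "expr_val m (Op Add (Lit 10) (Op Mul (Lit 2) (Op Add (reg 2) (Lit 1)))) = 10 + 2 * Suc i"
          using * by simp
        ultimately show "expr_val m (Op Mul (fact_expr (reg 2)) (Op Add (reg 2) (Lit 1))) \<le> 2 ^ word_size n \<and>
          (m(expr_val m (Op Add (Lit 10) (Op Mul (Lit 2) (Op Add (reg 2) (Lit 1)))) :=
             expr_val m (Op Mul (fact_expr (reg 2)) (Op Add (reg 2) (Lit 1))))) 2 = i \<and>
          ?Inv n (Suc i) ((m(expr_val m (Op Add (Lit 10) (Op Mul (Lit 2) (Op Add (reg 2) (Lit 1)))) :=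
             expr_val m (Op Mul (fact_expr (reg 2)) (Op Add (reg 2) (Lit 1)))))(2 := Suc i)) out"
          unfolding v using * by (simp del: fact_Suc fun_upd_apply) simp
      qed auto
      show "poly_bounded (\<lambda>n. 2 * Suc n)"
        by (intro poly_bounded_mult poly_bounded_const poly_bounded_Suc poly_bounded_id)
      show "2 * Suc n \<le> 2 ^ word_size n" for n by (rule small_le_word)
    qed (auto simp: tables_def partial_table_def)
  qed
qed

lemma cube_val: "tables n t m \<Longrightarrow> expr_val m cube_expr = Suc n ^ 3"
  by (simp add: cube_expr_def tables_regs power3_eq_cube)

lemma table_prog_correct:
  "ptriple (\<lambda>_ _. True) (\<lambda>n _ m out. tables n (partial_table n 0) m \<and> out = []) table_prog
     (\<lambda>n _ m out. tables n (partial_table n (Suc n ^ 3)) m \<and> out = [])"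
  unfolding table_prog_def
proof (rule ptriple_for_loop[where N = "\<lambda>n. Suc n ^ 3" and Inv = "\<lambda>n i m out. tables n (partial_table n i) m \<and> out = []"])
  let ?A = "\<lambda>n i. i < Suc n ^ 3"
  let ?P = "\<lambda>n i m out. (tables n (partial_table n i) m \<and> out = ([] :: nat list)) \<and> m 2 = i"
  let ?g = "\<lambda>n i j. flat_summand (Suc n) (partial_table n i) i j"
  have val: "1 - i + (\<Sum>j<Suc n ^ 5. ?g n i j) = qtab (Suc n) i" if "?A n i" for n i
    using qtab_recursion[OF that] unfolding partial_table_def by simp
  have le: "qtab (Suc n) i \<le> 2 ^ word_size n" if "?A n i" for n i
  proof (rule small_le_word(6))
    have "qtab (Suc n) i * 1 \<le> 4 ^ n * fact n" by (intro mult_le_mono qtab_le that) simp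
    then show "qtab (Suc n) i \<le> 4 ^ n * fact n" by simp
  qed
  show "ptriple ?A ?P
     (Seq (Store (Lit 4) (Op Sub (Lit 1) (reg 2)))
       (Seq (for_loop 3 (Op Mul cube_expr (Op Mul (reg 1) (reg 1))) (Store (Lit 4) (Op Add (reg 4) flat_summand_expr)))
         (Store (Op Add (Lit 11) (Op Mul (Lit 2) (reg 2))) (reg 4))))
     (\<lambda>n i m out. m 2 = i \<and> tables n (partial_table n (Suc i)) (m(2 := Suc i)) \<and> out = [])"
  proof (rule ptriple_seq[OF _ ptriple_seq])
    show "ptriple ?A ?P (Store (Lit 4) (Op Sub (Lit 1) (reg 2))) (\<lambda>n i m out. ?P n i m out \<and> m 4 = 1 - i)"
      by (rule ptriple_store) (auto intro!: tables_upd simp: one_minus_le_word)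
    show "ptriple ?A (\<lambda>n i m out. ?P n i m out \<and> m 4 = 1 - i)
       (for_loop 3 (Op Mul cube_expr (Op Mul (reg 1) (reg 1))) (Store (Lit 4) (Op Add (reg 4) flat_summand_expr)))
       (\<lambda>n i m out. ?P n i m out \<and> m 4 = 1 - i + (\<Sum>j<Suc n ^ 5. ?g n i j))"
    proof (rule ptriple_sum_loop)
      show "poly_bounded (\<lambda>n. Suc n ^ 5)" by (intro poly_bounded_power poly_bounded_Suc poly_bounded_id)
      show "Suc n ^ 5 \<le> 2 ^ word_size n" for n by (rule small_le_word)
      \<comment> \<open>The total is the finished entry, a cardinality of at most
        \<open>4 ^ n\<close>.\<close>
      show "1 - i + (\<Sum>j<Suc n ^ 5. ?g n i j) \<le> 2 ^ word_size n" if "?A n i" for n i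
        using val[OF that] le[OF that] by simp
      show "expr_val m (Op Mul cube_expr (Op Mul (reg 1) (reg 1))) = Suc n ^ 5" if "?P n i m out" for n i m out
    proof -
      have "expr_val m (Op Mul cube_expr (Op Mul (reg 1) (reg 1))) = Suc n ^ 3 * (Suc n) ^ 2"
        unfolding power2_eq_square using that cube_val[of n _ m] tables_regs[of n _ m] by auto
      then show ?thesis by (simp only: power_add[symmetric]) simp
    qed
      show "expr_val m flat_summand_expr = ?g n i j"
        if "?P n i m out" "m 3 = j" "j < Suc n ^ 5" for n i m out j
        using that by (intro val_flat_summand_expr) auto
    qed (auto intro!: tables_upd)
    show "ptriple ?A (\<lambda>n i m out. ?P n i m out \<and> m 4 = 1 - i + (\<Sum>j<Suc n ^ 5. ?g n i j))
       (Store (Op Add (Lit 11) (Op Mul (Lit 2) (reg 2))) (reg 4))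
       (\<lambda>n i m out. m 2 = i \<and> tables n (partial_table n (Suc i)) (m(2 := Suc i)) \<and> out = [])"
    proof (rule ptriple_store)
      fix n i m out assume i: "?A n i" and *: "?P n i m out \<and> m 4 = 1 - i + (\<Sum>j<Suc n ^ 5. ?g n i j)"
      have m4: "m 4 = qtab (Suc n) i" using * val[OF i] by simp
      have t: "tables n (partial_table n i) m" using * by simp
      have "(m(11 + 2 * i := qtab (Suc n) i)) (11 + 2 * k) = partial_table n (Suc i) k" for k
        using t by (auto simp: tables_def partial_table_def less_Suc_eq)
      moreover have "(m(11 + 2 * i := qtab (Suc n) i)) (10 + 2 * k) = fact k" if "k \<le> 2 * Suc n" for k
        using t that even_odd_neq(1)[of k i] by (simp add: tables_def)
      ultimately have "tables n (partial_table n (Suc i)) (m(11 + 2 * i := qtab (Suc n) i))"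
        using t by (simp add: tables_def)
      then show "expr_val m (reg 4) \<le> 2 ^ word_size n \<and>
         (m(expr_val m (Op Add (Lit 11) (Op Mul (Lit 2) (reg 2))) := expr_val m (reg 4))) 2 = i \<and>
         tables n (partial_table n (Suc i))
           ((m(expr_val m (Op Add (Lit 11) (Op Mul (Lit 2) (reg 2))) := expr_val m (reg 4)))(2 := Suc i)) \<and> out = []"
        using * m4 le[OF i] by (auto intro!: tables_upd)
    qed auto
  qed
  show "poly_bounded (\<lambda>n. Suc n ^ 3)" by (intro poly_bounded_power poly_bounded_Suc poly_bounded_id)
  show "Suc n ^ 3 \<le> 2 ^ word_size n" for n by (rule small_le_word)
qed (auto intro!: tables_upd simp: cube_val)

lemma entry_less_cube:
  assumes "l < B" "s < B" "z < B"
  shows "entry B l s z < B ^ 3"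
proof -
  have "l * B + s < Suc l * B" using assms by simp
  also have "\<dots> \<le> B * B" using assms by (intro mult_le_mono1) simp
  finally have "Suc (l * B + s) * B \<le> B * B * B" by (intro mult_le_mono1) simp
  then show ?thesis using assms by (simp add: entry_def power3_eq_cube)
qed

lemma val_output_summand_expr:
  assumes t: "tables n (partial_table n (Suc n ^ 3)) m" and "m 2 = i" "m 3 = j" "i < Suc n" "j < Suc n * Suc n"
  shows "expr_val m output_summand_expr =
    i * nu (j mod Suc n) (j div Suc n) (q i (j mod Suc n) (j div Suc n)) * (fact n div (j mod Suc n))"
proof -
  have j: "j mod Suc n < Suc n" "j div Suc n < Suc n"
    using assms(5) by (auto simp: less_mult_imp_div_less simp del: mult_Suc mult_Suc_right)
  have "partial_table n (Suc n ^ 3) (entry (Suc n) i (j mod Suc n) (j div Suc n)) = q i (j mod Suc n) (j div Suc n)"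
    unfolding partial_table_def using entry_less_cube[OF assms(4) j] j by (simp add: qtab_entry)
  then show ?thesis using assms(2,3) tables_regs[OF t]
    by (simp add: output_summand_expr_def Let_def val_table_exprs[OF t])
qed

lemma output_prog_correct:
  "ptriple (\<lambda>_ _. True) (\<lambda>n _ m out. tables n (partial_table n (Suc n ^ 3)) m \<and> out = []) output_prog
     (\<lambda>n _ m out. out = coeff_list (Suc n))"
  unfolding output_prog_def
proof (rule ptriple_for_loop[where N = Suc
      and Inv = "\<lambda>n i m out. tables n (partial_table n (Suc n ^ 3)) m \<and> out = coeff_list i"])
  let ?A = "\<lambda>n i. i < Suc n"
  let ?P = "\<lambda>n i m out. (tables n (partial_table n (Suc n ^ 3)) m \<and> out = coeff_list i) \<and> m 2 = i"
  let ?g = "\<lambda>n i j. i * nu (j mod Suc n) (j div Suc n) (q i (j mod Suc n) (j div Suc n)) * (fact n div (j mod Suc n))"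
  let ?S = "\<lambda>n i. \<Sum>j<Suc n * Suc n. ?g n i j"
  have val: "?S n i div fact n + (1 - i) = fps_nth cogrowth_series i"
    and exact: "?S n i \<le> 4 ^ n * fact n" if "?A n i" for n i
  proof -
    \<comment> \<open>The low digit of the counter is the number of syllables and the high digit the
      number of returns.\<close>
    have S: "?S n i = (\<Sum>s<Suc n. \<Sum>z<Suc n. i * nu s z (q i s z) * (fact n div s))"
      by (rule sum_digits) simp
    show "?S n i div fact n + (1 - i) = fps_nth cogrowth_series i"
      unfolding S using that by (intro cogrowth_q) simp
    show "?S n i \<le> 4 ^ n * fact n"
      unfolding S using that by (intro cogrowth_q_le) simp
  qed
  show "ptriple ?A ?P
     (Seq (Store (Lit 4) (Lit 0))
       (Seq (for_loop 3 (Op Mul (reg 1) (reg 1)) (Store (Lit 4) (Op Add (reg 4) output_summand_expr)))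
         (Print (Op Add (Op Div (reg 4) (fact_expr (reg 0))) (Op Sub (Lit 1) (reg 2))))))
     (\<lambda>n i m out. m 2 = i \<and> tables n (partial_table n (Suc n ^ 3)) (m(2 := Suc i)) \<and> out = coeff_list (Suc i))"
  proof (rule ptriple_seq[OF _ ptriple_seq])
    show "ptriple ?A ?P (Store (Lit 4) (Lit 0)) (\<lambda>n i m out. ?P n i m out \<and> m 4 = 0)"
      by (rule ptriple_store) (auto intro!: tables_upd)
    show "ptriple ?A (\<lambda>n i m out. ?P n i m out \<and> m 4 = 0)
       (for_loop 3 (Op Mul (reg 1) (reg 1)) (Store (Lit 4) (Op Add (reg 4) output_summand_expr)))
       (\<lambda>n i m out. ?P n i m out \<and> m 4 = 0 + ?S n i)"
    proof (rule ptriple_sum_loop)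
      show "poly_bounded (\<lambda>n. Suc n * Suc n)" by (intro poly_bounded_mult poly_bounded_Suc poly_bounded_id)
      show "Suc n * Suc n \<le> 2 ^ word_size n" for n by (rule small_le_word)
      show "0 + ?S n i \<le> 2 ^ word_size n" if "?A n i" for n i
        using small_le_word(6)[OF exact[OF that]] by simp
      show "expr_val m (Op Mul (reg 1) (reg 1)) = Suc n * Suc n" if "?P n i m out" for n i m out
        using that tables_regs[of n _ m] by auto
      show "expr_val m output_summand_expr = ?g n i j"
        if "?A n i" "?P n i m out" "m 3 = j" "j < Suc n * Suc n" for n i m out j
        using that by (intro val_output_summand_expr) auto
    qed (auto intro!: tables_upd)
    show "ptriple ?A (\<lambda>n i m out. ?P n i m out \<and> m 4 = 0 + ?S n i)
       (Print (Op Add (Op Div (reg 4) (fact_expr (reg 0))) (Op Sub (Lit 1) (reg 2))))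
       (\<lambda>n i m out. m 2 = i \<and> tables n (partial_table n (Suc n ^ 3)) (m(2 := Suc i)) \<and> out = coeff_list (Suc i))"
    proof (rule ptriple_print)
      fix n i m out assume i: "?A n i" and *: "?P n i m out \<and> m 4 = 0 + ?S n i"
      have t: "tables n (partial_table n (Suc n ^ 3)) m" using * by simp
      have "expr_val m (fact_expr (reg 0)) = fact n"
        using val_table_exprs(3)[OF t, of "reg 0"] tables_regs[OF t] by simp
      moreover have "m 4 = ?S n i" "m 2 = i" "out = coeff_list i" using * by simp_all
      ultimately have "expr_val m (Op Add (Op Div (reg 4) (fact_expr (reg 0))) (Op Sub (Lit 1) (reg 2))) =
          fps_nth cogrowth_series i"
        using val[OF i] by (simp del: sum.lessThan_Suc mult_Suc mult_Suc_right)
      then show "m 2 = i \<and> tables n (partial_table n (Suc n ^ 3)) (m(2 := Suc i)) \<and>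
          out @ [expr_val m (Op Add (Op Div (reg 4) (fact_expr (reg 0))) (Op Sub (Lit 1) (reg 2)))] = coeff_list (Suc i)"
        using t \<open>m 2 = i\<close> \<open>out = coeff_list i\<close> by (auto intro!: tables_upd)
    qed auto
  qed
  show "poly_bounded Suc" using poly_bounded_Suc[OF poly_bounded_id] .
  show "Suc n \<le> 2 ^ word_size n" for n by (rule Suc_le_word)
qed (auto intro!: tables_upd simp: tables_regs)

theorem mainTheorem5:
  shows "\<exists>(c :: ram_prog) (p :: nat poly). \<forall>n. \<exists>t m.
    ram_exec c (ram_input n) t (m, map (fps_nth cogrowth_series) [0..<Suc n]) \<and>
    t \<le> poly p n"
proof -
  let ?c = "Seq fact_prog (Seq table_prog output_prog)"
  have "ptriple (\<lambda>_ _. True) (\<lambda>n _ m out. m = (\<lambda>_. 0)(0 := n) \<and> out = []) ?c (\<lambda>n _ m out. out = coeff_list (Suc n))"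
    by (rule ptriple_seq[OF fact_prog_correct ptriple_seq[OF table_prog_correct output_prog_correct]])
  then obtain T where T: "poly_bounded T" "\<And>n. triple (word_size n) (\<lambda>m out. m = (\<lambda>_. 0)(0 := n) \<and> out = []) ?c (T n)
      (\<lambda>m out. out = coeff_list (Suc n))"
    unfolding ptriple_def by auto
  obtain p where p: "\<And>n. T n \<le> poly p n" using T(1) unfolding poly_bounded_def by blast
  have "\<exists>t m. ram_exec ?c (ram_input n) t (m, coeff_list (Suc n)) \<and> t \<le> poly p n" for n
  proof -
    have "bounded_mem (word_size n) ((\<lambda>_. 0)(0 := n))"
      using small_le_word(3)[of n] by (auto simp: bounded_mem_def)
    then show ?thesis using T(2)[of n] p[of n] unfolding triple_def ram_input_def
      by (blast intro: order_trans)
  qed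
  then show ?thesis by blast
qed

end
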